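(* For every endpoint-local monotone rule on the cycle $C_n$ ($n\ge3$), every starting profile $x\in\mathbb{Z}^V$, and the initialization of the tag by $\mathbb{P}(J_0=w\mid X_0=x)=\lambda_w(x)/m$ (with $m=n$), the tag after exactly $h$ allocations, $h\in\mathbb{Z}_{\ge0}$, satisfies $$\mathbb{E}\,\operatorname{dist}_{C_n}(J_h,J_0)^2\le\frac{2\pi^2h}{n}+2 .$$ Consequently, at physical time $s\ge0$, $$\mathbb{E}\,\operatorname{dist}_{C_n}(J_s,J_0)^2\le2\pi^2s+2 .$$
   Context: Load vectors (profiles) are elements $x\in\mathbb{Z}^V$, where $V$ is the vertex set and $E$ the edge set of the graph; $e_w$ is the standard basis vector at $w$; $\operatorname{dist}_{C_n}$ is graph distance on $C_n$. An endpoint-local monotone rule is given by, for each edge $e\in E$, a fixed orientation $(u,v)$ of $e$ and a nonincreasing function $p_e:\mathbb{Z}\to[0,1]$ (the functions may differ between edges; constants allowed). The edges ring according to independent rate-one Poisson processes. When $e$ with orientation $(u,v)$ rings and the current load vector is $x$, a fresh independent $U$ uniform on $(0,1)$ is drawn, and one ball is added to $u$ if $U\le p_e(x_u-x_v)$ and to $v$ otherwise. $\lambda_w(x)$ is the total rate at which vertex $w$ receives a ball in profile $x$; $\sum_w\lambda_w(x)=m=|E|$. Tag: run two copies of the process from $x$ and $x+e_v$ with the same clocks and the same marks $U$. At every time their difference (second minus first) is $e_J$ for a single vertex $J$, the tag, with initial value $J_0=v$. $J_h$ denotes the tag after exactly $h$ allocation events, and $J_s$ the tag at physical time $s$ (that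 is, $J_{N_s}$, with $N_s$ the number of events by time $s$). When $J_0$ is random it is chosen, given $X_0$, independently of the future clocks and marks. *)

theory Defs
  imports "HOL-Probability.Probability"
begin

definition cycle_edges :: "nat \<Rightarrow> nat set set" where
  "cycle_edges n = {{i, (i + 1) mod n} | i. i < n}"

(* A k-fold relational power of adjacency is a walk of length k.  For vertices that are not
   connected the value is unspecified, which does not occur on a cycle. *)
definition graph_dist :: "'a set set \<Rightarrow> 'a \<Rightarrow> 'a \<Rightarrow> nat" where
  "graph_dist E u v = (LEAST k. (u, v) \<in> {(a, b). {a, b} \<in> E} ^^ k)"

(* Profiles are total functions; the dynamics reads and changes them only at endpoints of edges,
   so the values off the vertex set play no role. *)
type_synonym 'a profile = "'a \<Rightarrow> int"

definition unit_profile :: "'a \<Rightarrow> 'a profile" where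
  "unit_profile w = (\<lambda>u. of_bool (u = w))"

definition add_profile :: "'a profile \<Rightarrow> 'a profile \<Rightarrow> 'a profile" where
  "add_profile x y = (\<lambda>u. x u + y u)"

definition endpoint_local_monotone ::
  "'a set set \<Rightarrow> ('a set \<Rightarrow> 'a \<times> 'a) \<Rightarrow> ('a set \<Rightarrow> int \<Rightarrow> real) \<Rightarrow> bool" where
  "endpoint_local_monotone E orient p \<longleftrightarrow>
     (\<forall>e\<in>E. {fst (orient e), snd (orient e)} = e \<and> antimono (p e) \<and> range (p e) \<subseteq> {0..1})"

definition receiver ::
  "('a set \<Rightarrow> 'a \<times> 'a) \<Rightarrow> ('a set \<Rightarrow> int \<Rightarrow> real) \<Rightarrow> 'a set \<Rightarrow> real \<Rightarrow> 'a profile \<Rightarrow> 'a" where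
  "receiver orient p e r x =
     (let (u, v) = orient e in if r \<le> p e (x u - x v) then u else v)"

(* Every edge rings at rate one, and the mark is uniform on (0,1), so the rate at which w receives
   a ball through e is the Lebesgue measure of the marks that send the ball to w. *)
definition receive_rate ::
  "'a set set \<Rightarrow> ('a set \<Rightarrow> 'a \<times> 'a) \<Rightarrow> ('a set \<Rightarrow> int \<Rightarrow> real) \<Rightarrow> 'a profile \<Rightarrow> 'a \<Rightarrow> real" where
  "receive_rate E orient p x w =
     (\<Sum>e\<in>E. measure lborel {r \<in> {0<..<1}. receiver orient p e r x = w})"

(* The definitions up to tag_at are pathwise: c e i is the i-th waiting time of the clock of e and
   m i is the mark used at the allocation event with index i, indices starting at 0. *)
definition ring_time :: "('e \<Rightarrow> nat \<Rightarrow> real) \<Rightarrow> 'e \<Rightarrow> nat \<Rightarrow> real" where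
  "ring_time c e k = (\<Sum>i\<le>k. c e i)"

definition num_events :: "'e set \<Rightarrow> ('e \<Rightarrow> nat \<Rightarrow> real) \<Rightarrow> real \<Rightarrow> nat" where
  "num_events E c s = card {(e, k). e \<in> E \<and> ring_time c e k \<le> s}"

(* The edge of the event that has exactly h predecessors.  It is unique when all ring times are
   distinct and locally finite, hence almost surely; otherwise the value is unspecified. *)
definition event_edge :: "'e set \<Rightarrow> ('e \<Rightarrow> nat \<Rightarrow> real) \<Rightarrow> nat \<Rightarrow> 'e" where
  "event_edge E c h =
     (THE e. e \<in> E \<and> (\<exists>k.
        finite {(e', k'). e' \<in> E \<and> ring_time c e' k' < ring_time c e k} \<and>
        card {(e', k'). e' \<in> E \<and> ring_time c e' k' < ring_time c e k} = h))"

primrec profile_after ::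
  "'a set set \<Rightarrow> ('a set \<Rightarrow> 'a \<times> 'a) \<Rightarrow> ('a set \<Rightarrow> int \<Rightarrow> real) \<Rightarrow>
   ('a set \<Rightarrow> nat \<Rightarrow> real) \<Rightarrow> (nat \<Rightarrow> real) \<Rightarrow> 'a profile \<Rightarrow> nat \<Rightarrow> 'a profile" where
  "profile_after E orient p c m x 0 = x"
| "profile_after E orient p c m x (Suc h) =
     (let y = profile_after E orient p c m x h
      in add_profile y (unit_profile (receiver orient p (event_edge E c h) (m h) y)))"

definition tag_after ::
  "'a set set \<Rightarrow> ('a set \<Rightarrow> 'a \<times> 'a) \<Rightarrow> ('a set \<Rightarrow> int \<Rightarrow> real) \<Rightarrow>
   ('a set \<Rightarrow> nat \<Rightarrow> real) \<Rightarrow> (nat \<Rightarrow> real) \<Rightarrow> 'a profile \<Rightarrow> 'a \<Rightarrow> nat \<Rightarrow> 'a" where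
  "tag_after E orient p c m x v h =
     (THE j. profile_after E orient p c m (add_profile x (unit_profile v)) h =
             add_profile (profile_after E orient p c m x h) (unit_profile j))"

definition tag_at ::
  "'a set set \<Rightarrow> ('a set \<Rightarrow> 'a \<times> 'a) \<Rightarrow> ('a set \<Rightarrow> int \<Rightarrow> real) \<Rightarrow>
   ('a set \<Rightarrow> nat \<Rightarrow> real) \<Rightarrow> (nat \<Rightarrow> real) \<Rightarrow> 'a profile \<Rightarrow> 'a \<Rightarrow> real \<Rightarrow> 'a" where
  "tag_at E orient p c m x v s = tag_after E orient p c m x v (num_events E c s)"

datatype 'e source = Start | Wait 'e nat | Mark nat

(* indep_vars needs a common target type, so the initial tag, a vertex of the cycle and hence a
   natural number, enters as a real number; this does not change the sigma-algebra it generates. *)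
primrec source_var ::
  "('w \<Rightarrow> nat) \<Rightarrow> ('e \<Rightarrow> nat \<Rightarrow> 'w \<Rightarrow> real) \<Rightarrow> (nat \<Rightarrow> 'w \<Rightarrow> real) \<Rightarrow> 'e source \<Rightarrow> 'w \<Rightarrow> real" where
  "source_var J0 C U Start = (\<lambda>\<omega>. real (J0 \<omega>))"
| "source_var J0 C U (Wait e k) = C e k"
| "source_var J0 C U (Mark k) = U k"

(* Independent rate-one Poisson processes are given by their waiting times, which are i.i.d.
   exponential of rate one over all edges and indices.  Clocks, marks and initial tag are
   mutually independent. *)
definition driving_randomness ::
  "'w measure \<Rightarrow> 'e set \<Rightarrow> ('w \<Rightarrow> nat) \<Rightarrow> ('e \<Rightarrow> nat \<Rightarrow> 'w \<Rightarrow> real) \<Rightarrow> (nat \<Rightarrow> 'w \<Rightarrow> real) \<Rightarrow> bool" where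
  "driving_randomness M E J0 C U \<longleftrightarrow>
     prob_space M \<and>
     (\<forall>e\<in>E. \<forall>k. distributed M lborel (C e k) (exponential_density 1)) \<and>
     (\<forall>k. distr M borel (U k) = uniform_measure lborel {0<..<1}) \<and>
     prob_space.indep_vars M (\<lambda>_. borel) (source_var J0 C U)
       ({Start} \<union> {Wait e k | e k. e \<in> E} \<union> range Mark)"

end

theory Submission
  imports Defs
begin

text \<open>
  The tag moves at a ring of an edge precisely when the two copies send the ball to different
  endpoints, and by monotonicity the first copy then gives it to the vertex of the tag.
  For \<open>f v = exp (2 \<pi> \<i> v / n)\<close> let \<open>\<psi> h x v\<close> be the expectation of \<open>f (J h)\<close> for the tag
  started at \<open>v\<close> and the profile \<open>x\<close>. If the tag has law \<open>\<lambda> / n\<close> initially, then, given the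
  profile of the first copy, it has this law at every later step. Hence the average of
  \<open>\<bar>\<psi> h\<bar>\<^sup>2\<close> decreases in \<open>h\<close>, and the loss in a step is at least an explicit quadratic form in the
  differences of \<open>\<psi> h\<close> across a jump. The correlation of \<open>\<psi> h\<close> with the Fourier mode at edge
  midpoints changes in a step by terms that carry a difference of neighbouring modes, of size
  \<open>2 sin (\<pi> / n)\<close>, and that the Cauchy-Schwarz inequality bounds by this loss. Summing over the
  steps shows that \<open>1 - cos (2 \<pi> (J h - J 0) / n)\<close> has expectation at most
  \<open>8 h sin\<^sup>2 (\<pi> / n) / n + 2 \<pi>\<^sup>2 / n\<^sup>2\<close>, and the squared distance is at most \<open>n\<^sup>2 / 8\<close> times
  this variable. For \<open>h \<le> n / 2\<close> the additive term is too large, and a Gronwall estimate is used.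

  The first \<open>h\<close> ringing edges are uniformly distributed over all words of length \<open>h\<close>, also when
  \<open>h\<close> is replaced by the number of events up to time \<open>s\<close> and conditioned on, and that number has
  mean \<open>n s\<close>.
\<close>

section \<open>The coupled one-step operator on the cycle\<close>

text \<open>The tag keeps its law because of a balance: a ball added at \<open>u\<close> moves the
  amount \<open>jump_right x u\<close> of \<open>load_rate\<close> from \<open>u\<close> to the next
  vertex and \<open>jump_left x u\<close> to the previous one, and a tag at \<open>u\<close> jumps
  with these very rates. The total load grows forever, so no stationary law of the profile is
  available; the conditional law of the tag and the loss of energy take the place of a spectral
  argument. A weight \<open>c\<close> on the edges disturbs the balance only by
  \<open>c u - c (prv u)\<close>, which is why the mode is first attached to edges. The energy
  deficit enters the recursion for the midpoint correlation and the comparison with vertices with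
  the same weight 1/4, so it drops out of the final bound. For \<open>2 * h > n\<close> the
  resulting \<open>pi\<^sup>2 * h / n + pi\<^sup>2 / 4\<close> lies below
  \<open>2 * pi\<^sup>2 * h / n\<close>; the factor 2 in this constant is exactly what the
  short-time estimate yields.\<close>

definition bump :: "'a profile \<Rightarrow> 'a \<Rightarrow> 'a profile" where
  "bump x u = add_profile x (unit_profile u)"

lemma bump_apply: "bump x u w = x w + (if w = u then 1 else 0)"
  by (simp add: bump_def add_profile_def unit_profile_def)

lemma bump_commute: "bump (bump x u) w = bump (bump x w) u"
  by (auto simp: bump_apply fun_eq_iff)

lemma bump_inject: "bump x u = bump x w \<longleftrightarrow> u = w"
proof
  assume "bump x u = bump x w"
  then have "bump x u u = bump x w u" by simp
  then show "u = w" by (simp add: bump_apply split: if_splits)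
qed simp

text \<open>\<open>q v d\<close> is the probability that the edge \<open>{v, v + 1}\<close> gives its ball to \<open>v\<close> when the
  load at \<open>v\<close> exceeds the load at \<open>v + 1\<close> by \<open>d\<close>.\<close>

locale cycle_rule =
  fixes n :: nat and q :: "nat \<Rightarrow> int \<Rightarrow> real"
  assumes n_ge: "n \<ge> 3"
    and q_antimono: "v < n \<Longrightarrow> antimono (q v)"
    and q_nonneg: "v < n \<Longrightarrow> 0 \<le> q v d"
    and q_le_1: "v < n \<Longrightarrow> q v d \<le> 1"
begin

section \<open>Cyclic order of the vertices\<close>

definition nxt :: "nat \<Rightarrow> nat" where "nxt v = (v + 1) mod n"
definition prv :: "nat \<Rightarrow> nat" where "prv v = (v + (n - 1)) mod n"

lemma nxt_less [simp]: "nxt v < n" and prv_less [simp]: "prv v < n"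
  using n_ge by (auto simp: nxt_def prv_def)

lemma nxt_eq: "v < n \<Longrightarrow> nxt v = (if v = n - 1 then 0 else v + 1)"
  using n_ge by (auto simp: nxt_def)

lemma prv_eq: "v < n \<Longrightarrow> prv v = (if v = 0 then n - 1 else v - 1)"
proof (cases "v = 0")
  case False
  assume "v < n"
  have "v + (n - 1) = (v - 1) + n" using False n_ge by auto
  then have "prv v = ((v - 1) + n) mod n" unfolding prv_def by (rule arg_cong)
  also have "\<dots> = v - 1" using \<open>v < n\<close> unfolding mod_add_self2 by simp
  finally show ?thesis using False by simp
qed (use n_ge in \<open>auto simp: prv_def\<close>)

lemma nxt_prv [simp]: "v < n \<Longrightarrow> nxt (prv v) = v"
  using n_ge by (auto simp: nxt_eq prv_eq split: if_splits)

lemma prv_nxt [simp]: "v < n \<Longrightarrow> prv (nxt v) = v"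
  using n_ge by (auto simp: nxt_eq prv_eq split: if_splits)

lemma nxt_neq: "v < n \<Longrightarrow> nxt v \<noteq> v" and prv_neq: "v < n \<Longrightarrow> prv v \<noteq> v"
  and nxt_neq_prv: "v < n \<Longrightarrow> nxt v \<noteq> prv v"
  using n_ge by (auto simp: nxt_eq prv_eq split: if_splits)

lemma sum_nxt: "(\<Sum>v<n. F (nxt v)) = (\<Sum>v<n. F v)"
  by (rule sum.reindex_bij_witness[where i = prv and j = nxt]) auto

lemma sum_prv: "(\<Sum>v<n. F (prv v)) = (\<Sum>v<n. F v)"
  by (rule sum.reindex_bij_witness[where i = nxt and j = prv]) auto

text \<open>The name refers to the side on which the edge lies: the edge to the right of
  \<open>v\<close> gives its ball to \<open>v\<close> itself.\<close>

definition give_right :: "nat profile \<Rightarrow> nat \<Rightarrow> real" where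
  "give_right x v = q v (x v - x (nxt v))"

definition give_left :: "nat profile \<Rightarrow> nat \<Rightarrow> real" where
  "give_left x v = 1 - give_right x (prv v)"

definition load_rate :: "nat profile \<Rightarrow> nat \<Rightarrow> real" where
  "load_rate x v = give_right x v + give_left x v"

text \<open>The rates at which a tag at \<open>v\<close> jumps to the next and to the previous vertex; in both cases
  the ball of the first copy goes to \<open>v\<close>.\<close>

definition jump_right :: "nat profile \<Rightarrow> nat \<Rightarrow> real" where
  "jump_right x v = q v (x v - x (nxt v)) - q v (x v - x (nxt v) + 1)"

definition jump_left :: "nat profile \<Rightarrow> nat \<Rightarrow> real" where
  "jump_left x v = q (prv v) (x (prv v) - x v - 1) - q (prv v) (x (prv v) - x v)"

text \<open>Mean of \<open>g\<close> at the next profile and tag when a uniformly chosen edge rings.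
  The sum keeps the tag at \<open>v\<close>; the two corrections move it on the part of the event
  that \<open>v\<close> gets the ball where the copies disagree. The codomain is general because
  \<open>tag_mode\<close> is complex and \<open>displacement\<close> is real.\<close>

definition step :: "(nat profile \<Rightarrow> nat \<Rightarrow> 'b::real_normed_field) \<Rightarrow> nat profile \<Rightarrow> nat \<Rightarrow> 'b" where
  "step g x v =
     ((\<Sum>u<n. of_real (load_rate x u) * g (bump x u) v)
      + of_real (jump_right x v) * (g (bump x v) (nxt v) - g (bump x v) v)
      + of_real (jump_left x v) * (g (bump x v) (prv v) - g (bump x v) v)) / of_nat n"

lemma give_right_nonneg: "v < n \<Longrightarrow> 0 \<le> give_right x v"
  and give_right_le_1: "v < n \<Longrightarrow> give_right x v \<le> 1"
  by (auto simp: give_right_def q_nonneg q_le_1)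

lemma give_left_nonneg: "0 \<le> give_left x v"
  and give_left_le_1: "give_left x v \<le> 1"
  by (auto simp: give_left_def give_right_le_1 give_right_nonneg)

lemma load_rate_nonneg: "v < n \<Longrightarrow> 0 \<le> load_rate x v"
  and load_rate_le_2: "v < n \<Longrightarrow> load_rate x v \<le> 2"
  using give_right_nonneg[of v x] give_right_le_1[of v x] give_left_nonneg[of x v]
    give_left_le_1[of x v] by (auto simp: load_rate_def)

lemma sum_load_rate: "(\<Sum>v<n. load_rate x v) = n"
  by (simp add: load_rate_def give_left_def sum.distrib sum_subtractf sum_prv)

lemma jump_right_nonneg: "v < n \<Longrightarrow> 0 \<le> jump_right x v"
  using q_antimono[of v] by (auto simp: jump_right_def antimono_def)

lemma jump_left_nonneg: "0 \<le> jump_left x v"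
  using q_antimono[of "prv v"] by (auto simp: jump_left_def antimono_def)

lemma jump_right_le: "v < n \<Longrightarrow> jump_right x v \<le> give_right x v"
  by (simp add: jump_right_def give_right_def q_nonneg)

lemma jump_left_le: "v < n \<Longrightarrow> jump_left x v \<le> give_left x v"
  by (simp add: jump_left_def give_left_def give_right_def q_le_1)

text \<open>Only the two edges at \<open>u\<close> see the new ball, and the changes of their
  thresholds are the jump rates of a tag at \<open>u\<close>. This is the source of the balance
  between the rates and the tag.\<close>

lemma give_right_bump:
  assumes "u < n" "v < n"
  shows "give_right (bump x u) v = give_right x v - (if v = u then jump_right x u else 0)
    + (if v = prv u then jump_left x u else 0)"
proof -
  consider "v = u" | "v = prv u" "v \<noteq> u" | "v \<noteq> u" "v \<noteq> prv u" by blast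
  then show ?thesis
  proof cases
    case 1
    then show ?thesis using assms nxt_neq[of u] prv_neq[of u]
      by (auto simp: give_right_def jump_right_def bump_apply algebra_simps)
  next
    case 2
    then show ?thesis using assms
      by (auto simp: give_right_def jump_left_def bump_apply algebra_simps)
  next
    case 3
    then have "nxt v \<noteq> u" using assms by auto
    with 3 show ?thesis by (simp add: give_right_def bump_apply)
  qed
qed

lemma give_left_bump:
  assumes "u < n" "v < n"
  shows "give_left (bump x u) v = give_left x v + (if v = nxt u then jump_right x u else 0)
    - (if v = u then jump_left x u else 0)"
proof -
  have "prv v = u \<longleftrightarrow> v = nxt u" "prv v = prv u \<longleftrightarrow> v = u"
    using assms by (metis nxt_prv prv_nxt)+
  then show ?thesis using assms
    by (simp add: give_left_def give_right_bump)
qed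

text \<open>Here \<open>c v\<close> is a weight on the edge \<open>{v, nxt v}\<close>. Divided by
  \<open>n\<close>, the sum is the mean of the weight of the ringing edge times \<open>g\<close> at
  the receiver of its ball.\<close>

definition weighted :: "(nat \<Rightarrow> 'b) \<Rightarrow> nat profile \<Rightarrow> (nat \<Rightarrow> 'b) \<Rightarrow> 'b::real_normed_field" where
  "weighted c x g =
     (\<Sum>v<n. (c v * of_real (give_right x v) + c (prv v) * of_real (give_left x v)) * g v)"

lemma weighted_bump:
  assumes "u < n"
  shows "weighted c (bump x u) g = weighted c x g
    + c u * of_real (jump_right x u) * (g (nxt u) - g u)
    + c (prv u) * of_real (jump_left x u) * (g (prv u) - g u)"
proof -
  have "weighted c (bump x u) g = (\<Sum>v<n.
     (c v * of_real (give_right x v) + c (prv v) * of_real (give_left x v)) * g v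
     - (if v = u then c v * of_real (jump_right x u) * g v else 0)
     + (if v = prv u then c v * of_real (jump_left x u) * g v else 0)
     + (if v = nxt u then c (prv v) * of_real (jump_right x u) * g v else 0)
     - (if v = u then c (prv v) * of_real (jump_left x u) * g v else 0))"
    unfolding weighted_def
    by (rule sum.cong) (use assms in \<open>auto simp: give_right_bump give_left_bump algebra_simps\<close>)
  also have "\<dots> = weighted c x g + c u * of_real (jump_right x u) * (g (nxt u) - g u)
    + c (prv u) * of_real (jump_left x u) * (g (prv u) - g u)"
    using assms by (simp add: sum.distrib sum_subtractf weighted_def algebra_simps)
  finally show ?thesis .
qed

text \<open>For constant \<open>c\<close> the right-hand side vanishes: conditionally on the profile of the first copy,
  the tag keeps the law \<open>load_rate / n\<close>.\<close>

lemma weighted_step: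
  fixes c :: "nat \<Rightarrow> 'b::real_normed_field"
  shows "weighted c x (step g x) - (\<Sum>u<n. of_real (load_rate x u) * weighted c (bump x u) (g (bump x u))) / of_nat n
    = (\<Sum>u<n. (c u - c (prv u)) *
        (of_real (give_right x u) * of_real (jump_left x u) * (g (bump x u) (prv u) - g (bump x u) u)
         - of_real (give_left x u) * of_real (jump_right x u) * (g (bump x u) (nxt u) - g (bump x u) u))) / of_nat n"
proof -
  define w where "w v = c v * of_real (give_right x v) + c (prv v) * of_real (give_left x v)" for v
  define z where "z u = g (bump x u) (nxt u) - g (bump x u) u" for u
  define z' where "z' u = g (bump x u) (prv u) - g (bump x u) u" for u
  \<comment> \<open>The double sum over the receiver and a tag that stays is common to both terms
    and cancels; what is left is a single sum over the vertex that holds the tag and gets the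
    ball.\<close>
  define S where "S = (\<Sum>v<n. \<Sum>u<n. of_real (load_rate x u) * (w v * g (bump x u) v))"
  have "weighted c x (step g x) =
    (S + (\<Sum>v<n. w v * (of_real (jump_right x v) * z v + of_real (jump_left x v) * z' v))) / of_nat n"
    unfolding weighted_def step_def w_def[symmetric] z_def[symmetric] z'_def[symmetric] S_def
    by (simp add: sum_divide_distrib sum.distrib[symmetric] sum_distrib_left algebra_simps
             add_divide_distrib)
  moreover have "(\<Sum>u<n. of_real (load_rate x u) * weighted c (bump x u) (g (bump x u)))
    = S + (\<Sum>u<n. of_real (load_rate x u) *
        (c u * of_real (jump_right x u) * z u + c (prv u) * of_real (jump_left x u) * z' u))"
  proof -
    have "(\<Sum>u<n. of_real (load_rate x u) * weighted c (bump x u) (g (bump x u)))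
      = (\<Sum>u<n. of_real (load_rate x u) * weighted c x (g (bump x u))
       + of_real (load_rate x u) *
        (c u * of_real (jump_right x u) * z u + c (prv u) * of_real (jump_left x u) * z' u))"
      by (rule sum.cong) (auto simp: weighted_bump z_def z'_def algebra_simps)
    moreover have "(\<Sum>u<n. of_real (load_rate x u) * weighted c x (g (bump x u))) = S"
      unfolding S_def weighted_def w_def[symmetric] sum_distrib_left by (rule sum.swap)
    ultimately show ?thesis by (simp add: sum.distrib)
  qed
  ultimately have "weighted c x (step g x) - (\<Sum>u<n. of_real (load_rate x u) * weighted c (bump x u) (g (bump x u))) / of_nat n
    = (\<Sum>u<n. w u * (of_real (jump_right x u) * z u + of_real (jump_left x u) * z' u)
       - of_real (load_rate x u) *
        (c u * of_real (jump_right x u) * z u + c (prv u) * of_real (jump_left x u) * z' u)) / of_nat n"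
    by (simp add: sum_subtractf diff_divide_distrib add_divide_distrib)
  also have "\<dots> = (\<Sum>u<n. (c u - c (prv u)) *
        (of_real (give_right x u) * of_real (jump_left x u) * z' u
         - of_real (give_left x u) * of_real (jump_right x u) * z u)) / of_nat n"
    by (rule arg_cong[where f = "\<lambda>s. s / of_nat n"], rule sum.cong)
       (auto simp: w_def load_rate_def algebra_simps)
  finally show ?thesis unfolding z_def z'_def .
qed

lemma weighted_1: "weighted (\<lambda>_. 1) x g = (\<Sum>v<n. of_real (load_rate x v) * g v)"
  by (simp add: weighted_def load_rate_def)

lemma load_rate_step:
  "(\<Sum>v<n. of_real (load_rate x v) * step g x v)
    = (\<Sum>u<n. of_real (load_rate x u) * (\<Sum>v<n. of_real (load_rate (bump x u) v) * g (bump x u) v)) / of_nat n"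
  using weighted_step[of "\<lambda>_. 1" x g] by (simp add: weighted_1)

text \<open>Regrouping shows \<open>step\<close> as a nonnegative combination of values of
  \<open>g\<close>: the coefficient of \<open>g (bump x v) v\<close> is what the two jumps leave of
  \<open>load_rate x v\<close>, and each jump rate is at most the rate of its own edge.\<close>

lemma step_mono:
  fixes g h :: "nat profile \<Rightarrow> nat \<Rightarrow> real"
  assumes "\<And>y w. w < n \<Longrightarrow> g y w \<le> h y w" "v < n"
  shows "step g x v \<le> step h x v"
proof -
  have split: "step k x v = ((\<Sum>u\<in>{..<n}-{v}. load_rate x u * k (bump x u) v)
      + (load_rate x v - jump_right x v - jump_left x v) * k (bump x v) v
      + jump_right x v * k (bump x v) (nxt v) + jump_left x v * k (bump x v) (prv v)) / real n"
    for k :: "nat profile \<Rightarrow> nat \<Rightarrow> real"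
    using assms(2) by (simp add: step_def sum.remove[of "{..<n}" v] algebra_simps)
  have "0 \<le> load_rate x v - jump_right x v - jump_left x v"
    using jump_right_le[of v x] jump_left_le[of v x] assms(2) by (simp add: load_rate_def)
  then show ?thesis unfolding split
    by (intro divide_right_mono add_mono sum_mono mult_left_mono assms)
       (use assms(2) in \<open>auto simp: load_rate_nonneg jump_right_nonneg jump_left_nonneg\<close>)
qed

end

section \<open>Energy of the tag\<close>

text \<open>The left-hand side is the error term of \<open>weighted_step\<close>, and the second factor on the
  right is the loss of energy in a step.\<close>

lemma jump_cross_bound:
  fixes z z' :: complex and R R' a a' :: real
  assumes "0 \<le> a" "a \<le> R" "0 \<le> a'" "a' \<le> R'"
  shows "(cmod (of_real R * of_real a' * z' - of_real R' * of_real a * z))\<^sup>2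
    \<le> R * R' * ((R + R') * (a * (cmod z)\<^sup>2 + a' * (cmod z')\<^sup>2) - (cmod (of_real a * z + of_real a' * z'))\<^sup>2)"
proof -
  \<comment> \<open>The products of \<open>z\<close> with \<open>z'\<close> in the two squares
    cancel, so the difference is a sum of visibly nonnegative terms.\<close>
  have "R * R' * ((R + R') * (a * (cmod z)\<^sup>2 + a' * (cmod z')\<^sup>2) - (cmod (of_real a * z + of_real a' * z'))\<^sup>2)
      - (cmod (of_real R * of_real a' * z' - of_real R' * of_real a * z))\<^sup>2
    = (R + R') * (R' * a * (R - a) * (cmod z)\<^sup>2 + R * a' * (R' - a') * (cmod z')\<^sup>2)"
    by (simp add: cmod_power2) algebra
  also have "\<dots> \<ge> 0" using assms by auto
  finally show ?thesis by simp
qed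

context cycle_rule
begin

definition energy :: "nat profile \<Rightarrow> (nat \<Rightarrow> complex) \<Rightarrow> real" where
  "energy x g = (\<Sum>v<n. load_rate x v * (cmod (g v))\<^sup>2) / n"

text \<open>For a tag at \<open>u\<close>, this is \<open>load_rate x u\<close> squared times the
  variance of the change of \<open>g\<close> caused by the jump, given that the ball goes to
  \<open>u\<close>. In this scaling no division by a rate that may vanish occurs.\<close>

definition gap :: "(nat profile \<Rightarrow> nat \<Rightarrow> complex) \<Rightarrow> nat profile \<Rightarrow> nat \<Rightarrow> real" where
  "gap g x u =
     load_rate x u * (jump_right x u * (cmod (g (bump x u) (nxt u) - g (bump x u) u))\<^sup>2
                    + jump_left x u * (cmod (g (bump x u) (prv u) - g (bump x u) u))\<^sup>2)
     - (cmod (of_real (jump_right x u) * (g (bump x u) (nxt u) - g (bump x u) u)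
            + of_real (jump_left x u) * (g (bump x u) (prv u) - g (bump x u) u)))\<^sup>2"

text \<open>Jensen's inequality for the probability weights
  \<open>load_rate x u / n\<close>.\<close>

lemma sum_cmod_convex:
  fixes h :: "nat \<Rightarrow> complex"
  shows "(cmod ((\<Sum>u<n. of_real (load_rate x u) * h u) / of_nat n))\<^sup>2
    \<le> (\<Sum>u<n. load_rate x u * (cmod (h u))\<^sup>2) / n"
proof -
  have "cmod (\<Sum>u<n. of_real (load_rate x u) * h u) \<le> (\<Sum>u<n. load_rate x u * cmod (h u))"
    by (rule sum_norm_le) (auto simp: norm_mult load_rate_nonneg)
  then have "(cmod (\<Sum>u<n. of_real (load_rate x u) * h u))\<^sup>2 \<le> (\<Sum>u<n. load_rate x u * cmod (h u))\<^sup>2"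
    by (rule power_mono) simp
  also have "\<dots> = (\<Sum>u<n. sqrt (load_rate x u) * (sqrt (load_rate x u) * cmod (h u)))\<^sup>2"
    by (rule arg_cong[where f = "\<lambda>s. s\<^sup>2"], rule sum.cong)
       (auto simp: load_rate_nonneg mult.assoc[symmetric])
  also have "\<dots> \<le> (\<Sum>u<n. (sqrt (load_rate x u))\<^sup>2) * (\<Sum>u<n. (sqrt (load_rate x u) * cmod (h u))\<^sup>2)"
    by (rule Cauchy_Schwarz_ineq_sum)
  also have "\<dots> = n * (\<Sum>u<n. load_rate x u * (cmod (h u))\<^sup>2)"
    by (simp add: load_rate_nonneg sum_load_rate power_mult_distrib)
  finally show ?thesis using n_ge
    by (simp add: norm_divide power_divide divide_simps power2_eq_square mult_ac)
qed

text \<open>The variance of a step splits according to the receiver of the ball. Only the part given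
  that \<open>v\<close> receives it, where the tag can jump, is kept; the variance between receivers
  is dropped by convexity.\<close>

lemma step_variance:
  fixes g :: "nat profile \<Rightarrow> nat \<Rightarrow> complex"
  assumes "v < n"
  shows "load_rate x v * (step (\<lambda>y w. (cmod (g y w))\<^sup>2) x v - (cmod (step g x v))\<^sup>2) \<ge> gap g x v / n"
proof -
  define a where "a = jump_right x v"
  define a' where "a' = jump_left x v"
  define l where "l = load_rate x v"
  define z where "z = g (bump x v) (nxt v) - g (bump x v) v"
  define z' where "z' = g (bump x v) (prv v) - g (bump x v) v"
  define g0 where "g0 = g (bump x v) v"
  define S where "S = of_real a * z + of_real a' * z'"
  have aa: "0 \<le> a" "0 \<le> a'" "a + a' \<le> l"
    using jump_right_nonneg[OF assms] jump_left_nonneg jump_right_le[OF assms, of x] jump_left_le[OF assms, of x]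
    by (auto simp: a_def a'_def l_def load_rate_def)
  have g1: "g (bump x v) (nxt v) = g0 + z" and g2: "g (bump x v) (prv v) = g0 + z'"
    by (auto simp: z_def z'_def g0_def)
  show ?thesis
  proof (cases "l = 0")
    case True
    then have "a = 0" "a' = 0" using aa by auto
    then show ?thesis using True by (simp add: gap_def l_def a_def a'_def)
  next
    case False
    then have l: "l > 0" using aa by auto
    \<comment> \<open>At \<open>v\<close> the value is replaced by its conditional mean over the
      jump, so that \<open>step g x v\<close> becomes a plain average over receivers.\<close>
    define h where "h u = (if u = v then g0 + S / of_real l else g (bump x u) v)" for u
    have "(\<Sum>u<n. of_real (load_rate x u) * h u) = (\<Sum>u<n. of_real (load_rate x u) * g (bump x u) v) + S"
      using assms l by (simp add: sum.remove[of "{..<n}" v] h_def l_def g0_def algebra_simps)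
    then have step: "step g x v = (\<Sum>u<n. of_real (load_rate x u) * h u) / of_nat n"
      by (simp add: step_def S_def a_def a'_def z_def z'_def g0_def algebra_simps)
    have "(\<Sum>u<n. load_rate x u * (cmod (h u))\<^sup>2)
      = (\<Sum>u<n. load_rate x u * (cmod (g (bump x u) v))\<^sup>2)
        + l * ((cmod (g0 + S / of_real l))\<^sup>2 - (cmod g0)\<^sup>2)"
      using assms by (simp add: sum.remove[of "{..<n}" v] h_def l_def g0_def algebra_simps)
    also have "l * ((cmod (g0 + S / of_real l))\<^sup>2 - (cmod g0)\<^sup>2)
      = 2 * (Re g0 * Re S + Im g0 * Im S) + (cmod S)\<^sup>2 / l"
      using l unfolding cmod_power2 by (simp add: field_simps power2_eq_square)
    finally have "(cmod (step g x v))\<^sup>2 \<le> ((\<Sum>u<n. load_rate x u * (cmod (g (bump x u) v))\<^sup>2)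
      + (2 * (Re g0 * Re S + Im g0 * Im S) + (cmod S)\<^sup>2 / l)) / n"
      using sum_cmod_convex[of x h] by (simp add: step)
    moreover have "step (\<lambda>y w. (cmod (g y w))\<^sup>2) x v = ((\<Sum>u<n. load_rate x u * (cmod (g (bump x u) v))\<^sup>2)
      + (2 * (Re g0 * Re S + Im g0 * Im S) + a * (cmod z)\<^sup>2 + a' * (cmod z')\<^sup>2)) / n"
    proof -
      have sq: "(cmod (g0 + w))\<^sup>2 = (cmod g0)\<^sup>2 + 2 * (Re g0 * Re w + Im g0 * Im w) + (cmod w)\<^sup>2" for w
        unfolding cmod_power2 by (simp add: power2_eq_square algebra_simps)
      show ?thesis
        unfolding step_def g1 g2 g0_def[symmetric] a_def[symmetric] a'_def[symmetric] sq
        by (simp add: S_def field_simps)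
    qed
    ultimately have "step (\<lambda>y w. (cmod (g y w))\<^sup>2) x v - (cmod (step g x v))\<^sup>2
        \<ge> (a * (cmod z)\<^sup>2 + a' * (cmod z')\<^sup>2 - (cmod S)\<^sup>2 / l) / n"
      by (simp add: add_divide_distrib diff_divide_distrib)
    then have "l * (step (\<lambda>y w. (cmod (g y w))\<^sup>2) x v - (cmod (step g x v))\<^sup>2)
        \<ge> l * ((a * (cmod z)\<^sup>2 + a' * (cmod z')\<^sup>2 - (cmod S)\<^sup>2 / l) / n)"
      using l by (intro mult_left_mono) auto
    also have "l * ((a * (cmod z)\<^sup>2 + a' * (cmod z')\<^sup>2 - (cmod S)\<^sup>2 / l) / n) = gap g x v / n"
      unfolding gap_def l_def[symmetric] a_def[symmetric] a'_def[symmetric]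
          z_def[symmetric] z'_def[symmetric] S_def[symmetric]
      using l by (simp add: right_diff_distrib)
    finally show ?thesis by (simp add: l_def)
  qed
qed

text \<open>The variance bound is averaged over the law of the tag, and
  \<open>load_rate_step\<close> (the invariance of that law) turns the mean of the squared modulus
  into the mean energy after the ball.\<close>

lemma energy_step:
  "energy x (step g x) + (\<Sum>u<n. gap g x u) / n\<^sup>2
    \<le> (\<Sum>u<n. load_rate x u * energy (bump x u) (g (bump x u))) / n"
proof -
  have "(\<Sum>v<n. gap g x v) / n \<le>
      (\<Sum>v<n. load_rate x v * (step (\<lambda>y w. (cmod (g y w))\<^sup>2) x v - (cmod (step g x v))\<^sup>2))"
    unfolding sum_divide_distrib by (rule sum_mono) (use step_variance in auto)
  also have "\<dots> = (\<Sum>v<n. load_rate x v * step (\<lambda>y w. (cmod (g y w))\<^sup>2) x v) - n * energy x (step g x)"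
    using n_ge by (simp add: energy_def right_diff_distrib sum_subtractf)
  also have "(\<Sum>v<n. load_rate x v * step (\<lambda>y w. (cmod (g y w))\<^sup>2) x v)
     = (\<Sum>u<n. load_rate x u * energy (bump x u) (g (bump x u)))"
    using load_rate_step[of x "\<lambda>y w. (cmod (g y w))\<^sup>2"]
    by (simp add: energy_def flip: sum_divide_distrib)
  finally have "((\<Sum>v<n. gap g x v) / n + n * energy x (step g x)) / n
      \<le> (\<Sum>u<n. load_rate x u * energy (bump x u) (g (bump x u))) / n"
    by (intro divide_right_mono) auto
  then show ?thesis using n_ge
    by (simp add: add_divide_distrib power2_eq_square)
qed

lemma gap_nonneg: "u < n \<Longrightarrow> gap g x u \<ge> 0"
proof -
  assume u: "u < n"
  define a where "a = jump_right x u"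
  define a' where "a' = jump_left x u"
  define l where "l = load_rate x u"
  define z where "z = g (bump x u) (nxt u) - g (bump x u) u"
  define z' where "z' = g (bump x u) (prv u) - g (bump x u) u"
  have aa: "0 \<le> a" "0 \<le> a'" "a + a' \<le> l"
    using jump_right_nonneg[OF u] jump_left_nonneg jump_right_le[OF u, of x] jump_left_le[OF u, of x]
    by (auto simp: a_def a'_def l_def load_rate_def)
  \<comment> \<open>A variance as a sum over pairs of outcomes: the values \<open>z\<close>,
    \<open>z'\<close> and 0 have weights \<open>a\<close>, \<open>a'\<close> and
    \<open>l - a - a'\<close>.\<close>
  have "gap g x u = (l - a - a') * (a * (cmod z)\<^sup>2 + a' * (cmod z')\<^sup>2) + a * a' * (cmod (z - z'))\<^sup>2"
    unfolding gap_def a_def[symmetric] a'_def[symmetric] l_def[symmetric] z_def[symmetric] z'_def[symmetric]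
    by (simp add: cmod_power2) algebra
  then show ?thesis using aa by simp
qed

end

section \<open>Displacement of the tag in the first Fourier mode\<close>

context cycle_rule
begin

definition mode :: "nat \<Rightarrow> complex" where "mode v = cis (2 * pi * v / n)"
definition mid_mode :: "nat \<Rightarrow> complex" where "mid_mode v = cis (2 * pi * v / n + pi / n)"

lemma cmod_mode [simp]: "cmod (mode v) = 1" and cmod_mid_mode [simp]: "cmod (mid_mode v) = 1"
  by (auto simp: mode_def mid_mode_def)

lemma mode_nxt: "v < n \<Longrightarrow> mode (nxt v) = mode v * cis (2 * pi / n)"
proof -
  assume v: "v < n"
  show ?thesis
  proof (cases "v = n - 1")
    case True
    have "mode v * cis (2 * pi / n) = cis (2 * pi * (real v + 1) / n)"
      by (simp add: mode_def cis_mult distrib_left add_divide_distrib)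
    also have "\<dots> = 1" using True v by (simp add: of_nat_diff)
    finally show ?thesis using True v by (simp add: nxt_eq mode_def)
  next
    case False
    then show ?thesis using v
      by (simp add: nxt_eq mode_def cis_mult distrib_left add_divide_distrib add.commute)
  qed
qed

lemma mid_mode_eq: "mid_mode v = mode v * cis (pi / n)"
  by (simp add: mid_mode_def mode_def cis_mult)

lemma mode_nxt_mid: "v < n \<Longrightarrow> mode (nxt v) = mid_mode v * cis (pi / n)"
  by (simp add: mode_nxt mid_mode_eq cis_mult mult.assoc)

lemma mid_mode_prv: "v < n \<Longrightarrow> mid_mode v = mid_mode (prv v) * cis (2 * pi / n)"
  using mode_nxt[of "prv v"] by (simp add: mid_mode_eq)

lemma cmod_1_minus_cis: "0 \<le> t \<Longrightarrow> t \<le> 2 * pi \<Longrightarrow> cmod (1 - cis t) = 2 * sin (t / 2)"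
proof -
  assume t: "0 \<le> t" "t \<le> 2 * pi"
  have "(cmod (1 - cis t))\<^sup>2 = (1 - cos t)\<^sup>2 + (sin t)\<^sup>2"
    by (simp add: cmod_power2)
  also have "\<dots> = 2 - 2 * cos t"
    using sin_cos_squared_add[of t] by (simp add: power2_eq_square algebra_simps)
  also have "\<dots> = (2 * sin (t / 2))\<^sup>2"
    using cos_double_sin[of "t / 2"] by (simp add: power_mult_distrib)
  finally show ?thesis using t sin_ge_zero[of "t / 2"]
    by (intro power2_eq_imp_eq[of "cmod (1 - cis t)"]) auto
qed

lemma cmod_mid_mode_diff: "v < n \<Longrightarrow> cmod (mid_mode v - mid_mode (prv v)) = 2 * sin (pi / n)"
proof -
  assume "v < n"
  then have "mid_mode v - mid_mode (prv v) = - (mid_mode (prv v) * (1 - cis (2 * pi / n)))"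
    by (simp add: mid_mode_prv[of v] algebra_simps)
  then have "cmod (mid_mode v - mid_mode (prv v)) = cmod (1 - cis (2 * pi / n))"
    by (simp add: norm_mult)
  also have "\<dots> = 2 * sin ((2 * pi / n) / 2)"
    using n_ge by (intro cmod_1_minus_cis) (auto simp: field_simps)
  finally show ?thesis by simp
qed

text \<open>The function called \<psi> above. The outermost \<open>step\<close> is the first event,
  so inductions over \<open>h\<close> have to leave the profile arbitrary.\<close>

definition tag_mode :: "nat \<Rightarrow> nat profile \<Rightarrow> nat \<Rightarrow> complex" where
  "tag_mode h = (step ^^ h) (\<lambda>x. mode)"

lemma tag_mode_0: "tag_mode 0 x = mode" and tag_mode_Suc: "tag_mode (Suc h) = step (tag_mode h)"
  by (auto simp: tag_mode_def)

lemma energy_mode: "energy x mode = 1"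
  using n_ge by (simp add: energy_def sum_load_rate)

text \<open>The correlation with the mode at the midpoint of the edge that gives the ball. Unlike the one
  with the mode of the receiving vertex, \<open>weighted_step\<close> applies to it, with an error term that \<open>gap\<close> controls.\<close>

definition mid_corr :: "nat \<Rightarrow> nat profile \<Rightarrow> real" where
  "mid_corr h x = Re (weighted (\<lambda>v. cnj (mid_mode v)) x (tag_mode h x)) / n"

lemma weighted_by_edge:
  "weighted c x g = (\<Sum>v<n. c v * (of_real (give_right x v) * g v + of_real (1 - give_right x v) * g (nxt v)))"
proof -
  have "(\<Sum>v<n. c (prv v) * of_real (give_left x v) * g v)
      = (\<Sum>v<n. c (prv (nxt v)) * of_real (give_left x (nxt v)) * g (nxt v))"
    by (rule sum_nxt[symmetric])
  also have "\<dots> = (\<Sum>v<n. c v * of_real (1 - give_right x v) * g (nxt v))"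
    by (rule sum.cong) (auto simp: give_left_def)
  finally show ?thesis
    by (simp add: weighted_def distrib_left distrib_right sum.distrib mult.assoc)
qed

text \<open>Both endpoints of an edge lie at angle \<open>pi / n\<close> from its midpoint, so it
  does not matter which of them gets the ball.\<close>

lemma mid_corr_0: "mid_corr 0 x = cos (pi / n)"
proof -
  have "Re (cnj (mid_mode v) * (of_real (give_right x v) * mode v
      + of_real (1 - give_right x v) * mode (nxt v))) = cos (pi / n)" if "v < n" for v
  proof -
    have 1: "cnj (mid_mode v) * mode v = cis (- (pi / n))"
      by (simp add: mid_mode_def mode_def cis_cnj cis_mult)
    have "cnj (mid_mode v) * mode (nxt v) = (cnj (mid_mode v) * mid_mode v) * cis (pi / n)"
      using that by (simp add: mode_nxt_mid)
    then have 2: "cnj (mid_mode v) * mode (nxt v) = cis (pi / n)"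
      by (simp add: mid_mode_def cis_cnj cis_mult)
    have "cnj (mid_mode v) * (of_real (give_right x v) * mode v + of_real (1 - give_right x v) * mode (nxt v))
      = of_real (give_right x v) * (cnj (mid_mode v) * mode v)
        + of_real (1 - give_right x v) * (cnj (mid_mode v) * mode (nxt v))"
      by (simp only: distrib_left mult.left_commute)
    then show ?thesis unfolding 1 2 by (simp add: left_diff_distrib)
  qed
  then have "Re (weighted (\<lambda>v. cnj (mid_mode v)) x mode) = n * cos (pi / n)"
    by (simp add: weighted_by_edge Re_sum del: times_complex.sel)
  then show ?thesis using n_ge by (simp add: mid_corr_def tag_mode_0)
qed

text \<open>In the error of \<open>weighted_step\<close> the difference of neighbouring midpoint
  modes has modulus \<open>2 * sin (pi / n)\<close>, and by \<open>jump_cross_bound\<close> the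
  other factor is at most the root of \<open>gap\<close>.\<close>

lemma mid_corr_Suc:
  "(\<Sum>u<n. load_rate x u * mid_corr h (bump x u)) / n - mid_corr (Suc h) x
    \<le> 4 * (sin (pi / n))\<^sup>2 / n + (\<Sum>u<n. gap (tag_mode h) x u) / (4 * n\<^sup>2)"
proof -
  define c where "c v = cnj (mid_mode v)" for v
  define g where "g = tag_mode h"
  define e where "e u = of_real (give_right x u) * of_real (jump_left x u) * (g (bump x u) (prv u) - g (bump x u) u)
         - of_real (give_left x u) * of_real (jump_right x u) * (g (bump x u) (nxt u) - g (bump x u) u)" for u
  define s where "s = sin (pi / n)"
  have s: "s \<ge> 0" using n_ge unfolding s_def by (intro sin_ge_zero) (auto simp: field_simps)
  have bd: "cmod ((c u - c (prv u)) * e u) \<le> 4 * s\<^sup>2 + gap g x u / 4" if u: "u < n" for u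
  proof -
    have "(cmod (e u))\<^sup>2 \<le> give_right x u * give_left x u * gap g x u"
      unfolding e_def gap_def load_rate_def
      by (rule jump_cross_bound)
         (use u in \<open>auto simp: jump_right_nonneg jump_left_nonneg jump_right_le jump_left_le\<close>)
    also have "\<dots> \<le> 1 * gap g x u"
      using u give_right_nonneg[of u x] give_right_le_1[of u x] give_left_nonneg[of x u]
        give_left_le_1[of x u]
      by (intro mult_right_mono mult_le_one gap_nonneg) auto
    finally have e: "(cmod (e u))\<^sup>2 \<le> gap g x u" by simp
    have "c u - c (prv u) = cnj (mid_mode u - mid_mode (prv u))" by (simp add: c_def)
    then have "cmod (c u - c (prv u)) = 2 * s" using cmod_mid_mode_diff[OF u]
      by (simp only: complex_mod_cnj s_def)
    then have "cmod ((c u - c (prv u)) * e u) = 2 * s * cmod (e u)"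
      by (simp add: norm_mult)
    \<comment> \<open>The product is split so that \<open>gap\<close> gets the coefficient 1/4, the
      weight of the energy deficit in \<open>mid_corr_ge\<close>.\<close>
    also have "\<dots> \<le> 4 * s\<^sup>2 + (cmod (e u))\<^sup>2 / 4"
      using zero_le_power2[of "2 * s - cmod (e u) / 2"] by (simp add: power2_eq_square algebra_simps)
    finally show ?thesis using e by simp
  qed
  have "(\<Sum>u<n. load_rate x u * mid_corr h (bump x u)) / n - mid_corr (Suc h) x
     = - Re (weighted c x (step g x) - (\<Sum>u<n. of_real (load_rate x u) * weighted c (bump x u) (g (bump x u))) / of_nat n) / n"
    by (simp add: mid_corr_def tag_mode_Suc c_def[abs_def] g_def Re_divide_of_nat Re_sum diff_divide_distrib
          flip: sum_divide_distrib)
  also have "\<dots> = - Re ((\<Sum>u<n. (c u - c (prv u)) * e u) / of_nat n) / n"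
    unfolding weighted_step e_def ..
  also have "\<dots> = - Re (\<Sum>u<n. (c u - c (prv u)) * e u) / n\<^sup>2"
    by (simp add: Re_divide_of_nat power2_eq_square)
  also have "\<dots> \<le> cmod (\<Sum>u<n. (c u - c (prv u)) * e u) / n\<^sup>2"
    by (intro divide_right_mono) (use abs_Re_le_cmod in \<open>smt (verit)\<close>, simp)
  also have "\<dots> \<le> (\<Sum>u<n. 4 * s\<^sup>2 + gap g x u / 4) / n\<^sup>2"
    by (intro divide_right_mono sum_norm_le bd) auto
  also have "\<dots> = 4 * s\<^sup>2 / n + (\<Sum>u<n. gap g x u) / (4 * n\<^sup>2)"
    using n_ge by (simp add: sum.distrib add_divide_distrib power2_eq_square flip: sum_divide_distrib)
  finally show ?thesis unfolding s_def g_def .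
qed

text \<open>The energy deficit serves as a potential: the \<open>gap\<close> charged to the
  correlation in a step is paid by the energy lost in the same step, so each step costs only
  \<open>4 * (sin (pi / n))\<^sup>2 / n\<close>.\<close>

lemma mid_corr_ge:
  "cos (pi / n) - mid_corr h x \<le> 4 * h * (sin (pi / n))\<^sup>2 / n + (1 - energy x (tag_mode h x)) / 4"
proof (induction h arbitrary: x)
  case 0
  then show ?case by (simp add: mid_corr_0 tag_mode_0 energy_mode)
next
  case (Suc h)
  define K where "K = 4 * h * (sin (pi / n))\<^sup>2 / n"
  have avg: "(\<Sum>u<n. load_rate x u * k) / n = k" for k
    using n_ge by (simp add: sum_load_rate flip: sum_distrib_right)
  have "(\<Sum>u<n. load_rate x u * (cos (pi / n) - mid_corr h (bump x u))) / n
     \<le> (\<Sum>u<n. load_rate x u * (K + (1 - energy (bump x u) (tag_mode h (bump x u))) / 4)) / n"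
    using Suc.IH unfolding K_def
    by (intro divide_right_mono sum_mono mult_left_mono) (auto simp: load_rate_nonneg)
  then have "cos (pi / n) - (\<Sum>u<n. load_rate x u * mid_corr h (bump x u)) / n
     \<le> K + (1 - (\<Sum>u<n. load_rate x u * energy (bump x u) (tag_mode h (bump x u))) / n) / 4"
    using avg[of "cos (pi / n)"] avg[of K] avg[of "1"]
    by (simp add: distrib_left right_diff_distrib sum.distrib sum_subtractf add_divide_distrib diff_divide_distrib
         flip: sum_divide_distrib)
  moreover have *: "4 * real (Suc h) * (sin (pi / n))\<^sup>2 / n = K + 4 * (sin (pi / n))\<^sup>2 / n"
    by (simp add: K_def distrib_left distrib_right add_divide_distrib)
  moreover have "(\<Sum>u<n. gap (tag_mode h) x u) / (4 * n\<^sup>2) = (\<Sum>u<n. gap (tag_mode h) x u) / n\<^sup>2 / 4"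
    by simp
  moreover have "c - m' \<le> K' + (1 - E') / 4"
    if "c - m \<le> K + (1 - E) / 4" "K' = K + p" "G' = G / 4" "m - m' \<le> p + G'" "E' + G \<le> E"
    for c m m' K' p E E' G G' :: real
    using that by argo
  ultimately show ?case
    using mid_corr_Suc[of x h] energy_step[of x "tag_mode h"]
    unfolding tag_mode_Suc by blast
qed

section \<open>Correlation with the mode at the starting vertex\<close>

definition tag_corr :: "nat \<Rightarrow> nat profile \<Rightarrow> real" where
  "tag_corr h x = (\<Sum>v<n. load_rate x v * Re (cnj (mode v) * tag_mode h x v)) / n"

lemma cmod_mode_diff_mid:
  assumes "v < n"
  shows "(cmod (mode v - mid_mode v))\<^sup>2 \<le> pi\<^sup>2 / n\<^sup>2" "(cmod (mode (nxt v) - mid_mode v))\<^sup>2 \<le> pi\<^sup>2 / n\<^sup>2"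
proof -
  have n: "0 \<le> pi / n" "pi / n \<le> 2 * pi" using n_ge by (auto simp: field_simps)
  have *: "cmod (1 - cis (pi / n)) \<le> pi / n"
    using cmod_1_minus_cis[OF n] sin_x_le_x[of "pi / n / 2"] n by auto
  have "mode v - mid_mode v = mode v * (1 - cis (pi / n))"
    by (simp add: mid_mode_eq algebra_simps)
  then have 1: "cmod (mode v - mid_mode v) \<le> pi / n" using * by (simp add: norm_mult)
  have "mode (nxt v) - mid_mode v = - (mid_mode v * (1 - cis (pi / n)))"
    using assms by (simp add: mode_nxt_mid algebra_simps)
  then have 2: "cmod (mode (nxt v) - mid_mode v) \<le> pi / n"
    using * by (simp only: norm_mult norm_minus_cancel cmod_mid_mode mult_1)
  show "(cmod (mode v - mid_mode v))\<^sup>2 \<le> pi\<^sup>2 / n\<^sup>2" "(cmod (mode (nxt v) - mid_mode v))\<^sup>2 \<le> pi\<^sup>2 / n\<^sup>2"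
    using power_mono[OF 1, of 2] power_mono[OF 2, of 2] by (auto simp: power_divide)
qed

text \<open>Pointwise form of the comparison of \<open>tag_corr\<close> with \<open>mid_corr\<close>; here \<open>f\<close> and \<open>m\<close> are
  neighbouring vertex and edge modes, and \<open>u\<close> is a value of \<open>tag_mode\<close>.\<close>

lemma corr_pointwise:
  fixes f m u :: complex
  assumes "cmod f = 1"
  shows "(1 - Re (cnj f * u)) / 2 \<le> Re (cnj m * f) - Re (cnj m * u) - (1 - (cmod u)\<^sup>2) / 4 + (cmod (f - m))\<^sup>2"
proof -
  have f: "(Re f)\<^sup>2 + (Im f)\<^sup>2 = 1" using assms by (metis cmod_power2 power_one)
  \<comment> \<open>The factor 1/2 is chosen so that \<open>(cmod u)\<^sup>2\<close> appears with
    coefficient 1/4, the weight of the energy deficit in \<open>mid_corr_ge\<close>.\<close>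
  have "0 \<le> (cmod ((f - m) + (u - f) / 2))\<^sup>2" by simp
  also have "\<dots> = (cmod (f - m))\<^sup>2 + (((cmod u)\<^sup>2 - 2 * Re (cnj f * u) + ((Re f)\<^sup>2 + (Im f)\<^sup>2)) / 4)
      + (Re (cnj f * u) - Re (cnj m * u) + Re (cnj m * f) - ((Re f)\<^sup>2 + (Im f)\<^sup>2))"
    unfolding cmod_power2 by (simp add: power2_eq_square field_simps)
  finally show ?thesis unfolding f by (simp add: field_simps)
qed

text \<open>The pointwise inequality is used at both endpoints of every edge with the midpoint of
  that edge as \<open>m\<close>. The deficit \<open>(1 - energy x g) / 4\<close> that it subtracts
  is the one that \<open>mid_corr_ge\<close> adds.\<close>

lemma tag_corr_diffusive:
  "1 - tag_corr h x \<le> 8 * h * (sin (pi / n))\<^sup>2 / n + 2 * pi\<^sup>2 / n\<^sup>2"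
proof -
  define g where "g = tag_mode h x"
  define r where "r v = give_right x v" for v
  have by_edge: "(\<Sum>v<n. load_rate x v * F v) = (\<Sum>v<n. r v * F v + (1 - r v) * F (nxt v))" for F :: "nat \<Rightarrow> real"
    using weighted_by_edge[of "\<lambda>_. 1" x F] by (simp add: weighted_1 r_def)
  define P where "P u f m = Re (cnj m * f) - Re (cnj m * u) - (1 - (cmod u)\<^sup>2) / 4 + pi\<^sup>2 / n\<^sup>2" for u f m :: complex
  have pt: "(1 - Re (cnj (mode v) * g v)) / 2 \<le> P (g v) (mode v) (mid_mode v)"
    "(1 - Re (cnj (mode (nxt v)) * g (nxt v))) / 2 \<le> P (g (nxt v)) (mode (nxt v)) (mid_mode v)" if "v < n" for v
    using corr_pointwise[of "mode v" "g v" "mid_mode v"] corr_pointwise[of "mode (nxt v)" "g (nxt v)" "mid_mode v"]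
      cmod_mode_diff_mid[OF that] unfolding P_def by auto
  have tot: "(\<Sum>v<n. load_rate x v * 1) = n" using sum_load_rate by simp
  have "(n - n * tag_corr h x) / 2 = (\<Sum>v<n. load_rate x v * ((1 - Re (cnj (mode v) * g v)) / 2))"
    using n_ge tot by (simp add: tag_corr_def g_def sum_subtractf right_diff_distrib diff_divide_distrib
         flip: sum_divide_distrib del: times_complex.sel)
  also have "\<dots> \<le> (\<Sum>v<n. r v * P (g v) (mode v) (mid_mode v) + (1 - r v) * P (g (nxt v)) (mode (nxt v)) (mid_mode v))"
    unfolding by_edge
    by (intro sum_mono add_mono mult_left_mono pt) (auto simp: r_def give_right_nonneg give_right_le_1)
  also have "\<dots> = n * mid_corr 0 x - n * mid_corr h x - (n - n * energy x g) / 4 + pi\<^sup>2 / n"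
  proof -
    have c: "n * mid_corr k x = (\<Sum>v<n. r v * Re (cnj (mid_mode v) * tag_mode k x v)
        + (1 - r v) * Re (cnj (mid_mode v) * tag_mode k x (nxt v)))" for k
    proof -
      have "n * mid_corr k x = Re (weighted (\<lambda>v. cnj (mid_mode v)) x (tag_mode k x))"
        using n_ge by (simp add: mid_corr_def)
      then show ?thesis unfolding weighted_by_edge r_def
        by (simp add: Re_sum algebra_simps)
    qed
    have e: "(n - n * energy x g) / 4 = (\<Sum>v<n. r v * ((1 - (cmod (g v))\<^sup>2) / 4) + (1 - r v) * ((1 - (cmod (g (nxt v)))\<^sup>2) / 4))"
      unfolding by_edge[of "\<lambda>v. (1 - (cmod (g v))\<^sup>2) / 4", symmetric]
      using n_ge tot by (simp add: energy_def right_diff_distrib sum_subtractf diff_divide_distrib flip: sum_divide_distrib)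
    have p: "pi\<^sup>2 / n = (\<Sum>v<n. pi\<^sup>2 / n\<^sup>2)" using n_ge by (simp add: power2_eq_square)
    show ?thesis unfolding c[of 0] c[of h] e p g_def[symmetric] tag_mode_0
      unfolding sum_subtractf[symmetric] sum.distrib[symmetric]
      by (rule sum.cong) (simp_all add: P_def algebra_simps diff_divide_distrib del: times_complex.sel)
  qed
  also have "\<dots> \<le> n * (4 * h * (sin (pi / n))\<^sup>2 / n) + pi\<^sup>2 / n"
  proof -
    define c where "c = 4 * h * (sin (pi / n))\<^sup>2 / n"
    have "n * (cos (pi / n) - mid_corr h x) \<le> n * (c + (1 - energy x g) / 4)"
      using mid_corr_ge[of h x] unfolding c_def g_def by (intro mult_left_mono) auto
    then show ?thesis unfolding c_def[symmetric] mid_corr_0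
      by (simp add: right_diff_distrib distrib_left diff_divide_distrib)
  qed
  finally have "2 / n * ((n - n * tag_corr h x) / 2) \<le> 2 / n * (n * (4 * h * (sin (pi / n))\<^sup>2 / n) + pi\<^sup>2 / n)"
    by (intro mult_left_mono) auto
  moreover have "2 / n * ((n - n * tag_corr h x) / 2) = 1 - tag_corr h x"
    using n_ge by (simp add: diff_divide_distrib right_diff_distrib)
  moreover have "2 / n * (n * (4 * h * (sin (pi / n))\<^sup>2 / n) + pi\<^sup>2 / n) = 8 * h * (sin (pi / n))\<^sup>2 / n + 2 * pi\<^sup>2 / n\<^sup>2"
    using n_ge by (simp add: distrib_left power2_eq_square)
  ultimately show ?thesis by simp
qed

text \<open>The squared chord, which controls the squared distance on the cycle and whose mean is
  real-affine in \<open>tag_mode\<close>.\<close>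

definition displacement :: "nat \<Rightarrow> nat \<Rightarrow> real" where
  "displacement v w = (cmod (mode w - mode v))\<^sup>2"

lemma displacement_eq: "displacement v w = 2 * (1 - Re (cnj (mode v) * mode w))"
proof -
  have f: "(Re (mode u))\<^sup>2 + (Im (mode u))\<^sup>2 = 1" for u by (metis cmod_mode cmod_power2 power_one)
  show ?thesis using f[of v] f[of w]
    unfolding displacement_def cmod_power2 by (simp add: power2_eq_square algebra_simps)
qed

lemma cmod_mode_nxt: "v < n \<Longrightarrow> cmod (mode (nxt v) - mode v) = 2 * sin (pi / n)"
proof -
  assume "v < n"
  then have "mode (nxt v) - mode v = - (mode v * (1 - cis (2 * pi / n)))"
    by (simp add: mode_nxt[of v] algebra_simps)
  then have "cmod (mode (nxt v) - mode v) = cmod (1 - cis (2 * pi / n))"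
    by (simp add: norm_mult)
  also have "\<dots> = 2 * sin ((2 * pi / n) / 2)"
    using n_ge by (intro cmod_1_minus_cis) (auto simp: field_simps)
  finally show ?thesis by simp
qed

section \<open>Growth of the displacement over short times, and both regimes combined\<close>

lemma displacement_neighbour:
  assumes "w < n" "w' = nxt w \<or> w' = prv w"
  shows "displacement v w' \<le> 2 * displacement v w + 8 * (sin (pi / n))\<^sup>2"
proof -
  have "cmod (mode w' - mode w) = 2 * sin (pi / n)"
    using assms cmod_mode_nxt[of w] cmod_mode_nxt[of "prv w"] by (auto simp: norm_minus_commute)
  then have "cmod (mode w' - mode v) \<le> 2 * sin (pi / n) + cmod (mode w - mode v)"
    using norm_triangle_ineq[of "mode w' - mode w" "mode w - mode v"] by simp
  then have "(cmod (mode w' - mode v))\<^sup>2 \<le> (2 * sin (pi / n) + cmod (mode w - mode v))\<^sup>2"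
    by (rule power_mono) simp
  also have "\<dots> \<le> 2 * (2 * sin (pi / n))\<^sup>2 + 2 * (cmod (mode w - mode v))\<^sup>2"
    using zero_le_power2[of "2 * sin (pi / n) - cmod (mode w - mode v)"]
    by (simp add: power2_eq_square algebra_simps)
  finally show ?thesis by (simp add: displacement_def power_mult_distrib)
qed

text \<open>For short times the tag has hardly moved: \<open>displacement\<close> grows by a factor \<open>1 + 2 / n\<close> per step up to an additive term, because a jump changes \<open>mode\<close> by
  \<open>2 * sin (pi / n)\<close> only and occurs with probability at most \<open>2 / n\<close>.\<close>

lemma step_displacement:
  assumes "w < n"
  shows "step (\<lambda>y. displacement v) x w \<le> (1 + 2 / n) * displacement v w + 16 * (sin (pi / n))\<^sup>2 / n"
proof -
  define d where "d = displacement v w"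
  define B where "B = d + 8 * (sin (pi / n))\<^sup>2"
  have B: "B \<ge> 0" by (simp add: B_def d_def displacement_def)
  have "jump_right x w * (displacement v (nxt w) - d) + jump_left x w * (displacement v (prv w) - d)
     \<le> jump_right x w * B + jump_left x w * B"
    using displacement_neighbour[of w "nxt w" v] displacement_neighbour[of w "prv w" v] assms
    by (intro add_mono mult_left_mono) (auto simp: B_def d_def jump_right_nonneg jump_left_nonneg)
  also have "\<dots> = (jump_right x w + jump_left x w) * B" by (simp add: distrib_right)
  also have "\<dots> \<le> 2 * B"
    using jump_right_le[OF assms, of x] jump_left_le[OF assms, of x] load_rate_le_2[OF assms, of x] B
    by (intro mult_right_mono) (auto simp: load_rate_def)
  finally have "step (\<lambda>y. displacement v) x w \<le> ((\<Sum>u<n. load_rate x u) * d + 2 * B) / n"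
    unfolding step_def by (intro divide_right_mono) (auto simp: d_def sum_distrib_right)
  also have "\<dots> = (1 + 2 / n) * d + 16 * (sin (pi / n))\<^sup>2 / n"
    using n_ge by (simp add: sum_load_rate B_def field_simps)
  finally show ?thesis by (simp add: d_def)
qed

lemma step_affine:
  fixes g :: "nat profile \<Rightarrow> nat \<Rightarrow> 'b::real_normed_field"
  shows "step (\<lambda>y w. a * g y w + b) x v = a * step g x v + b"
proof -
  have "(\<Sum>u<n. of_real (load_rate x u)) = (of_nat n :: 'b)"
    using sum_load_rate[of x] by (metis of_real_of_nat_eq of_real_sum)
  then show ?thesis using n_ge
    by (simp add: step_def distrib_left sum.distrib sum_distrib_left[symmetric] sum_distrib_right[symmetric]
        mult.left_commute[of _ a] field_simps)
qed

text \<open>Discrete Gronwall estimate: the affine map \<open>d \<mapsto> (1 + 2 / n) * d + 16 *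
  (sin (pi / n))\<^sup>2 / n\<close> from \<open>step_displacement\<close> has the fixed point
  \<open>- 8 * (sin (pi / n))\<^sup>2\<close>.\<close>

lemma step_pow_displacement:
  "w < n \<Longrightarrow> (step ^^ h) (\<lambda>y. displacement v) x w
    \<le> (1 + 2 / n) ^ h * displacement v w + 8 * (sin (pi / n))\<^sup>2 * ((1 + 2 / n) ^ h - 1)"
proof (induction h arbitrary: x w)
  case (Suc h)
  define a where "a = (1 + 2 / n) ^ h"
  have "(step ^^ Suc h) (\<lambda>y. displacement v) x w
      \<le> step (\<lambda>y w. a * displacement v w + 8 * (sin (pi / n))\<^sup>2 * (a - 1)) x w"
    unfolding funpow.simps comp_def by (intro step_mono Suc.prems) (auto simp: Suc.IH a_def)
  also have "\<dots> = a * step (\<lambda>y. displacement v) x w + 8 * (sin (pi / n))\<^sup>2 * (a - 1)"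
    by (rule step_affine)
  also have "\<dots> \<le> a * ((1 + 2 / n) * displacement v w + 16 * (sin (pi / n))\<^sup>2 / n) + 8 * (sin (pi / n))\<^sup>2 * (a - 1)"
    using step_displacement[OF Suc.prems] by (intro add_right_mono mult_left_mono) (auto simp: a_def)
  also have "\<dots> = (1 + 2 / n) ^ Suc h * displacement v w + 8 * (sin (pi / n))\<^sup>2 * ((1 + 2 / n) ^ Suc h - 1)"
    by (simp add: a_def[symmetric] algebra_simps add_divide_distrib)
  finally show ?case .
qed simp

text \<open>For fixed \<open>v\<close>, \<open>displacement v w\<close> is real-affine in
  \<open>mode w\<close>, and \<open>step\<close> commutes with affine maps and with real
  parts.\<close>

lemma step_pow_displacement_eq:
  "(step ^^ h) (\<lambda>y. displacement v) x w = 2 * (1 - Re (cnj (mode v) * tag_mode h x w))"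
proof (induction h arbitrary: x w)
  case 0
  then show ?case by (simp add: tag_mode_0 displacement_eq)
next
  case (Suc h)
  have Re_step: "step (\<lambda>y w. Re (g y w)) x w = Re (step g x w)" for g :: "nat profile \<Rightarrow> nat \<Rightarrow> complex"
    by (simp add: step_def Re_divide_of_nat Re_sum)
  have "(step ^^ Suc h) (\<lambda>y. displacement v) x w
      = step (\<lambda>y w. (-2) * Re (cnj (mode v) * tag_mode h y w) + 2) x w"
    by (simp add: Suc[abs_def] del: times_complex.sel)
  also have "\<dots> = -2 * Re (step (\<lambda>y w. cnj (mode v) * tag_mode h y w + 0) x w) + 2"
    unfolding step_affine[of "-2"] by (simp only: Re_step add_0_right)
  also have "step (\<lambda>y w. cnj (mode v) * tag_mode h y w + 0) x w = cnj (mode v) * tag_mode (Suc h) x w"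
    unfolding step_affine by (simp add: tag_mode_Suc)
  finally show ?case by (simp del: times_complex.sel)
qed

lemma exp_minus_1_le: "0 \<le> t \<Longrightarrow> t \<le> 1 \<Longrightarrow> exp t - 1 \<le> 2 * (t::real)"
proof -
  assume t: "0 \<le> t" "t \<le> 1"
  then have "t\<^sup>2 \<le> t" by (simp add: power2_eq_square mult_left_le)
  then show ?thesis using exp_bound[OF t] by simp
qed

lemma sin_pi_n: "(sin (pi / n))\<^sup>2 \<le> pi\<^sup>2 / n\<^sup>2"
proof -
  have "0 \<le> sin (pi / n)" using n_ge by (intro sin_ge_zero) (auto simp: field_simps)
  then have "(sin (pi / n))\<^sup>2 \<le> (pi / n)\<^sup>2" by (intro power_mono sin_x_le_x) auto
  then show ?thesis by (simp add: power_divide)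
qed

lemma sum_displacement_le:
  "n\<^sup>2 / 16 * ((\<Sum>v<n. load_rate x v * (step ^^ h) (\<lambda>y. displacement v) x v) / n) \<le> 2 * pi\<^sup>2 * h / n + 2"
proof (cases "2 * h \<le> n")
  case False
  then have h: "1 / 2 \<le> h / n" using n_ge by (simp add: field_simps)
  have "(\<Sum>v<n. load_rate x v * (step ^^ h) (\<lambda>y. displacement v) x v) / n
      = 2 * ((\<Sum>v<n. load_rate x v) / n - tag_corr h x)"
    unfolding step_pow_displacement_eq tag_corr_def
    by (simp add: sum_subtractf right_diff_distrib diff_divide_distrib sum_distrib_left mult.left_commute mult.commute[of _ 2]
        del: times_complex.sel)
  also have "\<dots> \<le> 2 * (8 * h * (sin (pi / n))\<^sup>2 / n + 2 * pi\<^sup>2 / n\<^sup>2)"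
    using tag_corr_diffusive[of h x] n_ge by (simp add: sum_load_rate)
  also have "\<dots> = 16 * (h / n) * (sin (pi / n))\<^sup>2 + 4 * pi\<^sup>2 / n\<^sup>2" by simp
  also have "\<dots> \<le> 16 * (h / n) * (pi\<^sup>2 / n\<^sup>2) + 4 * pi\<^sup>2 / n\<^sup>2"
    by (intro add_right_mono mult_left_mono sin_pi_n) auto
  finally have "n\<^sup>2 / 16 * ((\<Sum>v<n. load_rate x v * (step ^^ h) (\<lambda>y. displacement v) x v) / n)
     \<le> n\<^sup>2 / 16 * (16 * (h / n) * (pi\<^sup>2 / n\<^sup>2) + 4 * pi\<^sup>2 / n\<^sup>2)"
    by (intro mult_left_mono) auto
  also have "\<dots> = pi\<^sup>2 * (h / n) + pi\<^sup>2 / 4" using n_ge by (simp add: field_simps)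
  \<comment> \<open>Since \<open>1 / 2 \<le> h / n\<close>, the additive term is absorbed into a
    multiple of \<open>h / n\<close>.\<close>
  also have "\<dots> \<le> pi\<^sup>2 * (h / n) + pi\<^sup>2 * (h / n)"
  proof -
    have "pi\<^sup>2 / 4 \<le> pi\<^sup>2 * (1 / 2)" by simp
    also have "\<dots> \<le> pi\<^sup>2 * (h / n)" by (intro mult_left_mono h) simp
    finally show ?thesis by (rule add_left_mono)
  qed
  also have "\<dots> = 2 * pi\<^sup>2 * h / n" by simp
  also have "\<dots> \<le> 2 * pi\<^sup>2 * h / n + 2" by simp
  finally show ?thesis .
next
  case True
  \<comment> \<open>The exponent in \<open>(1 + 2 / n) ^ h \<le> exp s\<close>. It is at most 1 in
    this case, and \<open>exp s - 1 \<le> 2 * s\<close> leads exactly to the constant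
    \<open>2 * pi\<^sup>2\<close>.\<close>
  define s where "s = 2 * (h / n)"
  have s: "0 \<le> s" "s \<le> 1" using True n_ge by (auto simp: s_def field_simps)
  have "(1 + 2 / n) ^ h \<le> exp (2 / n) ^ h" by (intro power_mono exp_ge_add_one_self) auto
  also have "\<dots> = exp s" by (simp add: s_def exp_of_nat_mult[symmetric] mult.commute)
  finally have p: "(1 + 2 / n) ^ h - 1 \<le> 2 * s" using exp_minus_1_le[OF s] by simp
  have D: "(step ^^ h) (\<lambda>y. displacement v) x v \<le> 8 * (pi\<^sup>2 / n\<^sup>2) * (2 * s)" if "v < n" for v
  proof -
    have "(step ^^ h) (\<lambda>y. displacement v) x v \<le> 8 * (sin (pi / n))\<^sup>2 * ((1 + 2 / n) ^ h - 1)"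
      using step_pow_displacement[OF that, of h v x] by (simp add: displacement_def)
    also have "\<dots> \<le> 8 * (pi\<^sup>2 / n\<^sup>2) * (2 * s)"
      using p sin_pi_n by (intro mult_mono) auto
    finally show ?thesis .
  qed
  have "(\<Sum>v<n. load_rate x v * (step ^^ h) (\<lambda>y. displacement v) x v) / n
     \<le> (\<Sum>v<n. load_rate x v * (8 * (pi\<^sup>2 / n\<^sup>2) * (2 * s))) / n"
    by (intro divide_right_mono sum_mono mult_left_mono D) (auto simp: load_rate_nonneg)
  also have "\<dots> = 8 * (pi\<^sup>2 / n\<^sup>2) * (2 * s)"
    unfolding sum_distrib_right[symmetric] sum_load_rate using n_ge by simp
  finally have "n\<^sup>2 / 16 * ((\<Sum>v<n. load_rate x v * (step ^^ h) (\<lambda>y. displacement v) x v) / n)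
    \<le> n\<^sup>2 / 16 * (8 * (pi\<^sup>2 / n\<^sup>2) * (2 * s))"
    by (intro mult_left_mono) auto
  also have "\<dots> = 2 * pi\<^sup>2 * h / n" using n_ge by (simp add: s_def field_simps)
  finally show ?thesis by linarith
qed

end

section \<open>Graph distance on the cycle\<close>

text \<open>Jordan's inequality: the sine is concave on the quarter period and lies above its
  chord.\<close>

lemma sin_ge_chord:
  fixes t :: real
  assumes "0 \<le> t" "t \<le> 1"
  shows "t \<le> sin (t * (pi / 2))"
proof -
  have "concave_on {0..pi / 2} sin"
    by (rule f''_le0_imp_concave[where f' = cos and f'' = "\<lambda>x. - sin x"])
       (auto intro!: derivative_eq_intros sin_ge_zero)
  then have "sin ((1 - t) *\<^sub>R 0 + t *\<^sub>R (pi / 2)) \<ge> (1 - t) * sin 0 + t * sin (pi / 2)"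
    using assms by (intro concave_onD[of "{0..pi / 2}" sin]) auto
  then show ?thesis by simp
qed

context cycle_rule
begin

lemma nxt_pow: "u < n \<Longrightarrow> (nxt ^^ k) u = (u + k) mod n"
  by (induction k) (auto simp: nxt_def mod_simps)

lemma mode_nxt_pow: "u < n \<Longrightarrow> mode ((nxt ^^ k) u) = mode u * cis (2 * pi * k / n)"
proof (induction k)
  case (Suc k)
  have "(nxt ^^ k) u < n" using Suc.prems by (simp add: nxt_pow)
  then have "mode ((nxt ^^ Suc k) u) = mode u * (cis (2 * pi * k / n) * cis (2 * pi / n))"
    using Suc by (simp add: mode_nxt)
  also have "cis (2 * pi * k / n) * cis (2 * pi / n) = cis (2 * pi * Suc k / n)"
    by (simp add: cis_mult distrib_left add_divide_distrib add.commute)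
  finally show ?case .
qed simp

lemma displacement_commute: "displacement u v = displacement v u"
  by (simp add: displacement_def norm_minus_commute)

text \<open>The chord over \<open>k\<close> edges has length \<open>2 * sin (pi * k / n)\<close>,
  which is at least \<open>4 * k / n\<close> as long as the arc is at most half of the
  cycle.\<close>

lemma displacement_nxt_pow:
  assumes "u < n" "2 * k \<le> n"
  shows "(real k)\<^sup>2 \<le> n\<^sup>2 / 16 * displacement u ((nxt ^^ k) u)"
proof -
  have "mode ((nxt ^^ k) u) - mode u = - (mode u * (1 - cis (2 * pi * k / n)))"
    using assms by (simp add: mode_nxt_pow algebra_simps)
  then have "cmod (mode ((nxt ^^ k) u) - mode u) = cmod (1 - cis (2 * pi * k / n))"
    by (simp add: norm_mult)
  also have "\<dots> = 2 * sin (2 * pi * k / n / 2)"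
    using assms n_ge by (intro cmod_1_minus_cis) (auto simp: field_simps)
  also have "\<dots> = 2 * sin (2 * k / n * (pi / 2))" by (simp add: mult_ac)
  finally have "4 * k / n \<le> cmod (mode ((nxt ^^ k) u) - mode u)"
    using sin_ge_chord[of "2 * k / n"] assms n_ge by (simp add: field_simps)
  then have "(4 * k / n)\<^sup>2 \<le> displacement u ((nxt ^^ k) u)"
    unfolding displacement_def by (rule power_mono) simp
  then have "n\<^sup>2 / 16 * (4 * k / n)\<^sup>2 \<le> n\<^sup>2 / 16 * displacement u ((nxt ^^ k) u)"
    by (intro mult_left_mono) auto
  then show ?thesis using n_ge by (simp add: power_divide power_mult_distrib)
qed

lemma relpow_nxt:
  assumes "u < n"
  shows "(u, (nxt ^^ k) u) \<in> {(a, b). {a, b} \<in> cycle_edges n} ^^ k"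
    and "((nxt ^^ k) u, u) \<in> {(a, b). {a, b} \<in> cycle_edges n} ^^ k"
proof (induction k)
  case (Suc k)
  have "(nxt ^^ k) u < n" using assms by (simp add: nxt_pow)
  then have e: "{(nxt ^^ k) u, nxt ((nxt ^^ k) u)} \<in> cycle_edges n"
    unfolding cycle_edges_def nxt_def by auto
  {
    case 1
    show ?case using Suc(1) e by auto
  next
    case 2
    show ?case
      by (rule relpow_Suc_I2[OF _ Suc(2)]) (use e in \<open>auto simp: insert_commute\<close>)
  }
qed auto

lemma graph_dist_le_displacement:
  assumes "u < n" "v < n"
  shows "(real (graph_dist (cycle_edges n) u v))\<^sup>2 \<le> n\<^sup>2 / 16 * displacement u v"
proof -
  have *: "(real (graph_dist (cycle_edges n) u v))\<^sup>2 \<le> n\<^sup>2 / 16 * displacement u v"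
    "(real (graph_dist (cycle_edges n) v u))\<^sup>2 \<le> n\<^sup>2 / 16 * displacement u v"
    if "u < n" "2 * k \<le> n" "v = (nxt ^^ k) u" for u v k
  proof -
    have "graph_dist (cycle_edges n) u v \<le> k" "graph_dist (cycle_edges n) v u \<le> k"
      unfolding graph_dist_def using relpow_nxt[of u k] that by (auto intro: Least_le)
    then have "(real (graph_dist (cycle_edges n) u v))\<^sup>2 \<le> (real k)\<^sup>2"
      "(real (graph_dist (cycle_edges n) v u))\<^sup>2 \<le> (real k)\<^sup>2"
      by (auto intro: power_mono)
    moreover have "(real k)\<^sup>2 \<le> n\<^sup>2 / 16 * displacement u v"
      using displacement_nxt_pow[of u k] that by simp
    ultimately show "(real (graph_dist (cycle_edges n) u v))\<^sup>2 \<le> n\<^sup>2 / 16 * displacement u v"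
      "(real (graph_dist (cycle_edges n) v u))\<^sup>2 \<le> n\<^sup>2 / 16 * displacement u v"
      by (blast intro: order_trans)+
  qed
  \<comment> \<open>One of the two arcs between the vertices has at most \<open>n / 2\<close> edges,
    and \<open>nxt\<close> runs along it from one of them to the other.\<close>
  have near: "(\<exists>k. 2 * k \<le> n \<and> v = (nxt ^^ k) u) \<or> (\<exists>k. 2 * k \<le> n \<and> u = (nxt ^^ k) v)"
    if "u \<le> v" "v < n" for u v
  proof (cases "2 * (v - u) \<le> n")
    case True
    then have "v = (nxt ^^ (v - u)) u" using that by (simp add: nxt_pow)
    then show ?thesis using True by blast
  next
    case False
    have "(v + (n - (v - u))) = u + n" using that by auto
    then have "u = (nxt ^^ (n - (v - u))) v" using that by (simp add: nxt_pow)
    moreover have "2 * (n - (v - u)) \<le> n" using False by auto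
    ultimately show ?thesis by blast
  qed
  show ?thesis
  proof (cases "u \<le> v")
    case True
    then show ?thesis using near[of u v] *[of u _ v] *[of v _ u] assms displacement_commute by auto
  next
    case False
    then show ?thesis using near[of v u] *[of u _ v] *[of v _ u] assms displacement_commute by auto
  qed
qed

end

section \<open>Resampling one coordinate of a product measure\<close>

text \<open>Takes the place of conditioning: one waiting time or mark is revealed at a time. The
  inner integral again runs over all coordinates, so the measure stays the same under repeated
  use.\<close>

lemma nn_integral_PiM_resample:
  fixes M :: "'i \<Rightarrow> 'a measure"
  assumes M: "\<And>i. i \<in> I \<Longrightarrow> prob_space (M i)" and i: "i \<in> I"
    and F: "F \<in> borel_measurable (PiM I M)"
  shows "(\<integral>\<^sup>+X. F X \<partial>PiM I M) = (\<integral>\<^sup>+c. \<integral>\<^sup>+X. F (X(i := c)) \<partial>PiM I M \<partial>M i)"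
proof -
  define J where "J = I - {i}"
  have I: "I = insert i J" using i by (auto simp: J_def)
  have MJ: "\<And>j. j \<in> J \<Longrightarrow> prob_space (M j)" and Mi: "prob_space (M i)" using M i by (auto simp: J_def)
  interpret Mi: prob_space "M i" by (rule Mi)
  interpret PJ: prob_space "PiM J M" by (rule prob_space_PiM[OF MJ])
  have upd: "(\<lambda>(c, X). X(i := c)) \<in> measurable (M i \<Otimes>\<^sub>M PiM J M) (PiM I M)"
    unfolding I by measurable
  have *: "(\<integral>\<^sup>+X. G X \<partial>PiM I M) = (\<integral>\<^sup>+c. \<integral>\<^sup>+X. G (X(i := c)) \<partial>PiM J M \<partial>M i)"
    if G: "G \<in> borel_measurable (PiM I M)" for G
  proof -
    have "(\<integral>\<^sup>+X. G X \<partial>PiM I M) = (\<integral>\<^sup>+X. G X \<partial>distr (M i \<Otimes>\<^sub>M PiM J M) (PiM I M) (\<lambda>(c, X). X(i := c)))"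
      using distr_pair_PiM_eq_PiM[of J M i, OF MJ Mi] by (simp add: I)
    also have "\<dots> = (\<integral>\<^sup>+z. G ((\<lambda>(c, X). X(i := c)) z) \<partial>(M i \<Otimes>\<^sub>M PiM J M))"
      by (rule nn_integral_distr[OF upd]) (use G in simp)
    also have "\<dots> = (\<integral>\<^sup>+c. \<integral>\<^sup>+X. G ((\<lambda>(c, X). X(i := c)) (c, X)) \<partial>PiM J M \<partial>M i)"
      by (rule PJ.nn_integral_fst[symmetric]) (rule measurable_compose[OF upd G])
    finally show ?thesis by simp
  qed
  have "(\<integral>\<^sup>+X. F (X(i := c)) \<partial>PiM I M) = (\<integral>\<^sup>+X. F (X(i := c)) \<partial>PiM J M)" if c: "c \<in> space (M i)" for c
  proof -
    have u: "(\<lambda>X. X(i := c)) \<in> measurable (PiM I M) (PiM I M)"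
    proof (rule measurable_PiM_single')
      show "(\<lambda>X. (X(i := c)) j) \<in> measurable (PiM I M) (M j)" if "j \<in> I" for j
        using that c by (cases "j = i") auto
    qed (use i c in \<open>auto simp: space_PiM PiE_def extensional_def\<close>)
    \<comment> \<open>The integrand ignores coordinate \<open>i\<close>, so splitting that
      coordinate off once more leaves the integral over \<open>J\<close>.\<close>
    have "(\<integral>\<^sup>+X. F (X(i := c)) \<partial>PiM I M) = (\<integral>\<^sup>+c'. \<integral>\<^sup>+X. F ((X(i := c'))(i := c)) \<partial>PiM J M \<partial>M i)"
      by (rule *) (rule measurable_compose[OF u F])
    then show ?thesis by (simp add: Mi.emeasure_space_1)
  qed
  then show ?thesis unfolding *[OF F] by (intro nn_integral_cong) simp
qed

lemma borel_measurable_of_bool [measurable (raw)]: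
  "Measurable.pred M P \<Longrightarrow> (\<lambda>x. of_bool (P x) :: ennreal) \<in> borel_measurable M"
  by (simp add: of_bool_def[abs_def])

section \<open>The canonical driving randomness\<close>

definition sources :: "'e set \<Rightarrow> 'e source set" where
  "sources E = {Start} \<union> {Wait e k | e k. e \<in> E} \<union> range Mark"

lemma Start_in_sources [simp]: "Start \<in> sources E"
  and Wait_in_sources [simp]: "Wait e k \<in> sources E \<longleftrightarrow> e \<in> E"
  and Mark_in_sources [simp]: "Mark k \<in> sources E"
  by (auto simp: sources_def)

primrec source_law :: "real measure \<Rightarrow> 'e source \<Rightarrow> real measure" where
  "source_law S Start = S"
| "source_law S (Wait e k) = density lborel (exponential_density 1)"
| "source_law S (Mark k) = uniform_measure lborel {0<..<1}"

definition waits :: "('e source \<Rightarrow> real) \<Rightarrow> 'e \<Rightarrow> nat \<Rightarrow> real" where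
  "waits X e k = X (Wait e k)"

definition marks :: "('e source \<Rightarrow> real) \<Rightarrow> nat \<Rightarrow> real" where
  "marks X k = X (Mark k)"

text \<open>The next events after time \<open>t\<close> are \<open>w\<close>, each at a time satisfying \<open>P\<close>, and every clock is
  silent from then on up to time \<open>b t'\<close>, where \<open>t'\<close> is the time of the last one. Before time \<open>t\<close> the
  clock of \<open>e\<close> rang \<open>k e\<close> times, last at time \<open>\<tau> e\<close>. No condition
  that the other clocks stay silent before the first event of \<open>w\<close> is necessary, since their next
  rings are compared with a later time in the recursion.\<close>

primrec follows :: "'e set \<Rightarrow> (real \<Rightarrow> bool) \<Rightarrow> (real \<Rightarrow> real) \<Rightarrow> 'e list \<Rightarrow>
    ('e \<Rightarrow> nat) \<Rightarrow> ('e \<Rightarrow> real) \<Rightarrow> real \<Rightarrow> ('e \<Rightarrow> nat \<Rightarrow> real) \<Rightarrow> bool" where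
  "follows E P b [] k \<tau> t c \<longleftrightarrow> (\<forall>e\<in>E. b t < \<tau> e + c e (k e))"
| "follows E P b (e # w) k \<tau> t c \<longleftrightarrow> t < \<tau> e + c e (k e) \<and> P (\<tau> e + c e (k e)) \<and>
     follows E P b w (k(e := Suc (k e))) (\<tau>(e := \<tau> e + c e (k e))) (\<tau> e + c e (k e)) c"

text \<open>For each edge the recursion reads only the waiting times from index \<open>k e\<close>
  on, which makes a waiting time already used independent of the rest of the word.\<close>

lemma follows_cong:
  assumes "set w \<subseteq> E" "\<And>e j. e \<in> E \<Longrightarrow> k e \<le> j \<Longrightarrow> c e j = c' e j"
  shows "follows E P b w k \<tau> t c = follows E P b w k \<tau> t c'"
  using assms
proof (induction w arbitrary: k \<tau> t)
  case (Cons e w)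
  have "follows E P b w (k(e := Suc (k e))) \<tau>' t' c = follows E P b w (k(e := Suc (k e))) \<tau>' t' c'" for \<tau>' t'
    using Cons.prems by (intro Cons.IH) (auto split: if_splits)
  moreover have "c e (k e) = c' e (k e)" using Cons.prems by auto
  ultimately show ?case by simp
qed auto

text \<open>The arguments \<tau> and \<open>t\<close> are random because the recursion replaces them
  by ring times.\<close>

lemma pred_follows [measurable (raw)]:
  assumes "finite E" "set w \<subseteq> E"
    and c: "\<And>e j. e \<in> E \<Longrightarrow> (\<lambda>x. c x e j) \<in> borel_measurable M"
    and [measurable]: "Measurable.pred borel P" "b \<in> borel_measurable borel"
  shows "(\<And>e. e \<in> E \<Longrightarrow> (\<lambda>x. \<tau> x e) \<in> borel_measurable M) \<Longrightarrow> t \<in> borel_measurable M \<Longrightarrow>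
    Measurable.pred M (\<lambda>x. follows E P b w k (\<tau> x) (t x) (c x))"
  using assms(2)
proof (induction w arbitrary: k \<tau> t)
  case Nil
  have [measurable]: "t \<in> borel_measurable M" by fact
  show ?case unfolding follows.simps
    by (rule pred_intros_finite(3)[OF assms(1)])
       (use Nil c in \<open>intro borel_measurable_pred_less borel_measurable_add measurable_compose[OF Nil.prems(2)]; simp\<close>)
next
  case (Cons e w)
  define r where "r x = \<tau> x e + c x e (k e)" for x
  have r [measurable]: "r \<in> borel_measurable M"
    unfolding r_def using Cons.prems c by (intro borel_measurable_add) auto
  have [measurable]: "t \<in> borel_measurable M" by fact
  have "Measurable.pred M (\<lambda>x. follows E P b w (k(e := Suc (k e))) ((\<tau> x)(e := r x)) (r x) (c x))"
    by (rule Cons.IH) (use Cons.prems r in auto)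
  then show ?case
    unfolding follows.simps r_def[symmetric]
    by (intro pred_intros_logic) measurable
qed

locale driving_law =
  fixes E :: "'e set" and S :: "real measure"
  assumes finite_E: "finite E" and prob_S: "prob_space S" and sets_S: "sets S = sets borel"
begin

abbreviation law :: "('e source \<Rightarrow> real) measure" where
  "law \<equiv> PiM (sources E) (source_law S)"

abbreviation expo :: "real measure" where "expo \<equiv> density lborel (exponential_density 1)"

lemma prob_space_source_law: "prob_space (source_law S i)"
proof (cases i)
  case (Mark k)
  then show ?thesis
    by (auto intro!: prob_space_uniform_measure)
qed (auto simp: prob_S intro: prob_space_exponential_density)

lemma sets_source_law: "sets (source_law S i) = sets borel"
  by (cases i) (auto simp: sets_S)

sublocale prob_space law
  by (rule prob_space_PiM) (rule prob_space_source_law)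

lemma coord_measurable [measurable (raw)]: "i \<in> sources E \<Longrightarrow> (\<lambda>X. X i) \<in> borel_measurable law"
  using measurable_component_singleton[of i "sources E" "source_law S"]
  by (simp cong: measurable_cong_sets add: sets_source_law)

lemma resample:
  assumes "i \<in> sources E" "F \<in> borel_measurable law"
  shows "(\<integral>\<^sup>+X. F X \<partial>law) = (\<integral>\<^sup>+c. \<integral>\<^sup>+X. F (X(i := c)) \<partial>law \<partial>source_law S i)"
  by (rule nn_integral_PiM_resample[OF prob_space_source_law assms])

definition follows_prob where
  "follows_prob P b w k \<tau> t = (\<integral>\<^sup>+X. of_bool (follows E P b w k \<tau> t (waits X)) \<partial>law)"

lemma measurable_follows:
  assumes "set w \<subseteq> E" "Measurable.pred borel P" "b \<in> borel_measurable borel"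
  shows "Measurable.pred law (\<lambda>X. follows E P b w k \<tau> t (waits X))"
  using assms by (intro pred_follows finite_E) (auto simp: waits_def)

lemma follows_prob_Cons:
  assumes w: "set (e # w) \<subseteq> E" and [measurable]: "Measurable.pred borel P" "b \<in> borel_measurable borel"
  shows "follows_prob P b (e # w) k \<tau> t = (\<integral>\<^sup>+r. of_bool (t < \<tau> e + r \<and> P (\<tau> e + r)) *
     follows_prob P b w (k(e := Suc (k e))) (\<tau>(e := \<tau> e + r)) (\<tau> e + r) \<partial>expo)"
proof -
  have [measurable]: "Measurable.pred law (\<lambda>X. follows E P b (e # w) k \<tau> t (waits X))"
    using w by (intro measurable_follows) auto
  have m[measurable]: "Measurable.pred law (\<lambda>X. follows E P b w k' \<tau>' t' (waits X))" for k' \<tau>' t'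
    using w by (intro measurable_follows) auto
  have f: "follows E P b w (k(e := Suc (k e))) \<tau>' t' (waits (X(Wait e (k e) := r)))
      = follows E P b w (k(e := Suc (k e))) \<tau>' t' (waits X)" for \<tau>' t' r X
    by (rule follows_cong) (use w in \<open>auto simp: waits_def\<close>)
  have "follows_prob P b (e # w) k \<tau> t
    = (\<integral>\<^sup>+r. \<integral>\<^sup>+X. of_bool (follows E P b (e # w) k \<tau> t (waits (X(Wait e (k e) := r)))) \<partial>law
        \<partial>source_law S (Wait e (k e)))"
    unfolding follows_prob_def
    by (rule resample, use w in simp) (rule borel_measurable_of_bool, fact)
  also have "\<dots> = (\<integral>\<^sup>+r. \<integral>\<^sup>+X. of_bool (t < \<tau> e + r \<and> P (\<tau> e + r)) *
     of_bool (follows E P b w (k(e := Suc (k e))) (\<tau>(e := \<tau> e + r)) (\<tau> e + r) (waits X)) \<partial>law \<partial>expo)"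
    unfolding follows.simps f source_law.simps by (intro nn_integral_cong) (auto simp: waits_def)
  also have "\<dots> = (\<integral>\<^sup>+r. of_bool (t < \<tau> e + r \<and> P (\<tau> e + r)) *
     follows_prob P b w (k(e := Suc (k e))) (\<tau>(e := \<tau> e + r)) (\<tau> e + r) \<partial>expo)"
    unfolding follows_prob_def by (intro nn_integral_cong nn_integral_cmult) measurable
  finally show ?thesis .
qed

section \<open>Exponential waiting times and the probability of a word\<close>

lemma emeasure_expo_greater: "0 \<le> a \<Longrightarrow> emeasure expo {a<..} = ennreal (exp (- a))"
proof -
  assume a: "0 \<le> a"
  interpret expo: prob_space expo by (rule prob_space_exponential_density) simp
  have "distributed expo lborel (\<lambda>x. x) (exponential_density 1)"
    by (auto simp: distributed_def erlang_density_nonneg distr_id2 cong: distr_cong)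
  from expo.exponential_distributedD_gt[OF this a] show ?thesis
    by (simp add: expo.emeasure_eq_measure greaterThan_def)
qed

lemma prob_all_waits_greater:
  assumes "finite A" "A \<subseteq> E" "\<And>e. e \<in> A \<Longrightarrow> 0 \<le> a e"
  shows "(\<integral>\<^sup>+X. of_bool (\<forall>e\<in>A. a e < waits X e (k e)) \<partial>law) = ennreal (exp (- (\<Sum>e\<in>A. a e)))"
  using assms
proof (induction A rule: finite_induct)
  case empty
  then show ?case by (simp add: emeasure_space_1)
next
  case (insert e A)
  have [measurable]: "Measurable.pred law (\<lambda>X. \<forall>e\<in>B. a e < waits X e (k e))" if "B \<subseteq> E" for B
    unfolding waits_def using that finite_E finite_subset
    by (intro pred_intros_finite) (auto intro!: borel_measurable_pred_less)
  have "(\<integral>\<^sup>+X. of_bool (\<forall>e'\<in>insert e A. a e' < waits X e' (k e')) \<partial>law)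
    = (\<integral>\<^sup>+r. \<integral>\<^sup>+X. of_bool (\<forall>e'\<in>insert e A. a e' < waits (X(Wait e (k e) := r)) e' (k e')) \<partial>law
         \<partial>source_law S (Wait e (k e)))"
    by (rule resample, use insert.prems in simp)
       (rule borel_measurable_of_bool, use insert.prems in measurable)
  also have "\<dots> = (\<integral>\<^sup>+r. indicator {a e<..} r * (\<integral>\<^sup>+X. of_bool (\<forall>e'\<in>A. a e' < waits X e' (k e')) \<partial>law) \<partial>expo)"
  proof -
    have "(\<forall>e'\<in>insert e A. a e' < waits (X(Wait e (k e) := r)) e' (k e')) \<longleftrightarrow>
       a e < r \<and> (\<forall>e'\<in>A. a e' < waits X e' (k e'))" for X r
      using insert.hyps by (auto simp: waits_def)
    then show ?thesis
      by (auto intro!: nn_integral_cong split: split_indicator)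
  qed
  also have "\<dots> = ennreal (exp (- a e)) * ennreal (exp (- (\<Sum>e\<in>A. a e)))"
    using insert by (simp add: nn_integral_multc emeasure_expo_greater)
  also have "\<dots> = ennreal (exp (- (\<Sum>e\<in>insert e A. a e)))"
    using insert.hyps by (simp add: ennreal_mult[symmetric] exp_add[symmetric])
  finally show ?case .
qed

lemma follows_prob_Nil:
  assumes "\<And>e. e \<in> E \<Longrightarrow> \<tau> e \<le> b t"
  shows "follows_prob P b [] k \<tau> t = ennreal (exp (- (\<Sum>e\<in>E. b t - \<tau> e)))"
  using prob_all_waits_greater[OF finite_E order.refl, of "\<lambda>e. b t - \<tau> e" k] assms
  by (simp add: follows_prob_def diff_less_eq add.commute)

lemma sum_upd_diff:
  fixes \<tau> :: "'e \<Rightarrow> real"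
  assumes "e \<in> E"
  shows "(\<Sum>e'\<in>E. s - (\<tau>(e := r)) e') = (\<Sum>e'\<in>E. s - \<tau> e') + \<tau> e - r"
proof -
  have "(\<Sum>e'\<in>E - {e}. s - (\<tau>(e := r)) e') = (\<Sum>e'\<in>E - {e}. s - \<tau> e')"
    by (rule sum.cong) auto
  then show ?thesis using assms finite_E by (simp add: sum.remove[of E e])
qed

lemma nn_integral_expo:
  assumes [measurable]: "f \<in> borel_measurable borel"
  shows "(\<integral>\<^sup>+r. f r \<partial>expo) = (\<integral>\<^sup>+r. ennreal (exp (- r)) * indicator {0..} r * f r \<partial>lborel)"
  by (subst nn_integral_density)
     (auto simp: exponential_density_def intro!: nn_integral_cong split: split_indicator)

lemma nn_integral_power_Ioc:
  fixes l a :: real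
  assumes "l \<le> a" "0 \<le> K"
  shows "(\<integral>\<^sup>+r. ennreal (K * (a - r) ^ h / fact h) * indicator {l<..a} r \<partial>lborel)
    = ennreal (K * (a - l) ^ Suc h / fact (Suc h))"
proof -
  have "(\<integral>\<^sup>+r. ennreal (K * (a - r) ^ h / fact h) * indicator {l<..a} r \<partial>lborel)
      = (\<integral>\<^sup>+r. ennreal (K * (a - r) ^ h / fact h) * indicator {l..a} r \<partial>lborel)"
    by (intro nn_integral_cong_AE eventually_mono[OF AE_lborel_singleton[of l]])
       (auto split: split_indicator)
  also have "\<dots> = ennreal ((- K * (a - a) ^ Suc h / fact (Suc h)) - (- K * (a - l) ^ Suc h / fact (Suc h)))"
  proof (rule nn_integral_FTC_Icc[where F = "\<lambda>r. - K * (a - r) ^ Suc h / fact (Suc h)"])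
    show "((\<lambda>r. - K * (a - r) ^ Suc h / fact (Suc h)) has_real_derivative K * (a - r) ^ h / fact h) (at r)"
      for r
      by (rule derivative_eq_intros refl | simp del: power_Suc of_nat_Suc)+
  qed (use assms in auto)
  finally show ?thesis by simp
qed

text \<open>The densities and the final survival factors multiply to one exponential, and the event
  times fill an ordered simplex of volume \<open>(s - t) ^ length w / fact (length w)\<close>. The
  exponent starts at \<open>\<tau> e\<close> rather than \<open>t\<close> because the clocks are not
  conditioned on silence up to \<open>t\<close>. Only the length of \<open>w\<close> enters, so
  words of equal length are equally likely.\<close>

lemma follows_prob_until:
  assumes "set w \<subseteq> E" "\<And>e. e \<in> E \<Longrightarrow> \<tau> e \<le> t" "t \<le> s"
  shows "follows_prob (\<lambda>r. r \<le> s) (\<lambda>_. s) w k \<tau> t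
    = ennreal (exp (- (\<Sum>e\<in>E. s - \<tau> e)) * (s - t) ^ length w / fact (length w))"
  using assms
proof (induction w arbitrary: k \<tau> t)
  case Nil
  have "\<tau> e \<le> s" if "e \<in> E" for e using Nil(2)[OF that] Nil(3) by simp
  then show ?case by (simp add: follows_prob_Nil)
next
  case (Cons e w)
  define K where "K = exp (- (\<Sum>e\<in>E. s - \<tau> e))"
  have e: "e \<in> E" "\<tau> e \<le> t" using Cons.prems by auto
  have "follows_prob (\<lambda>r. r \<le> s) (\<lambda>_. s) (e # w) k \<tau> t
    = (\<integral>\<^sup>+r. of_bool (t < \<tau> e + r \<and> \<tau> e + r \<le> s) *
     follows_prob (\<lambda>r. r \<le> s) (\<lambda>_. s) w (k(e := Suc (k e))) (\<tau>(e := \<tau> e + r)) (\<tau> e + r) \<partial>expo)"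
    by (rule follows_prob_Cons) (use Cons.prems in auto)
  also have "\<dots> = (\<integral>\<^sup>+r. of_bool (t < \<tau> e + r \<and> \<tau> e + r \<le> s) *
     ennreal (K * exp r * (s - (\<tau> e + r)) ^ length w / fact (length w)) \<partial>expo)"
  proof (intro nn_integral_cong)
    fix r
    show "of_bool (t < \<tau> e + r \<and> \<tau> e + r \<le> s) *
      follows_prob (\<lambda>r. r \<le> s) (\<lambda>_. s) w (k(e := Suc (k e))) (\<tau>(e := \<tau> e + r)) (\<tau> e + r)
      = of_bool (t < \<tau> e + r \<and> \<tau> e + r \<le> s) *
      ennreal (K * exp r * (s - (\<tau> e + r)) ^ length w / fact (length w))"
    proof (cases "t < \<tau> e + r \<and> \<tau> e + r \<le> s")
      case True
      have "follows_prob (\<lambda>r. r \<le> s) (\<lambda>_. s) w (k(e := Suc (k e))) (\<tau>(e := \<tau> e + r)) (\<tau> e + r)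
        = ennreal (exp (- (\<Sum>e'\<in>E. s - (\<tau>(e := \<tau> e + r)) e')) * (s - (\<tau> e + r)) ^ length w / fact (length w))"
        by (rule Cons.IH) (use Cons.prems True in \<open>force+\<close>)
      also have "exp (- (\<Sum>e'\<in>E. s - (\<tau>(e := \<tau> e + r)) e')) = K * exp r"
        unfolding sum_upd_diff[OF e(1)] K_def by (simp flip: exp_add)
      finally show ?thesis using True by (simp add: fun_upd_def)
    qed auto
  qed
  also have "\<dots> = (\<integral>\<^sup>+r. ennreal (exp (- r)) * indicator {0..} r * (of_bool (t < \<tau> e + r \<and> \<tau> e + r \<le> s) *
     ennreal (K * exp r * (s - (\<tau> e + r)) ^ length w / fact (length w))) \<partial>lborel)"
    by (rule nn_integral_expo) measurable
  also have "\<dots> = (\<integral>\<^sup>+r. ennreal (K * ((s - \<tau> e) - r) ^ length w / fact (length w)) * indicator {t - \<tau> e<..s - \<tau> e} r \<partial>lborel)"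
  proof (intro nn_integral_cong)
    fix r
    have "ennreal (exp (- r)) * ennreal (K * exp r * (s - (\<tau> e + r)) ^ length w / fact (length w))
      = ennreal (K * (s - \<tau> e - r) ^ length w / fact (length w))"
      by (simp add: ennreal_mult'[symmetric] exp_minus diff_diff_add field_simps)
    then show "ennreal (exp (- r)) * indicator {0..} r * (of_bool (t < \<tau> e + r \<and> \<tau> e + r \<le> s) *
     ennreal (K * exp r * (s - (\<tau> e + r)) ^ length w / fact (length w)))
      = ennreal (K * ((s - \<tau> e) - r) ^ length w / fact (length w)) * indicator {t - \<tau> e<..s - \<tau> e} r"
      using e(2) by (auto split: split_indicator)
  qed
  also have "\<dots> = ennreal (K * ((s - \<tau> e) - (t - \<tau> e)) ^ Suc (length w) / fact (Suc (length w)))"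
    by (rule nn_integral_power_Ioc) (use Cons.prems in \<open>auto simp: K_def\<close>)
  finally show ?case by (simp add: K_def)
qed

lemma nn_integral_exp_Ioi:
  fixes l a :: real
  assumes "0 < a" "0 \<le> K"
  shows "(\<integral>\<^sup>+r. ennreal (K * exp (- a * (r - l))) * indicator {l<..} r \<partial>lborel) = ennreal (K / a)"
proof -
  have "(\<integral>\<^sup>+r. ennreal (K * exp (- a * (r - l))) * indicator {l<..} r \<partial>lborel)
      = (\<integral>\<^sup>+r. ennreal (K * exp (- a * (r - l))) * indicator {l..} r \<partial>lborel)"
    by (intro nn_integral_cong_AE eventually_mono[OF AE_lborel_singleton[of l]])
       (auto split: split_indicator)
  also have "\<dots> = ennreal (0 - (- K / a * exp (- a * (l - l))))"
  proof (rule nn_integral_FTC_atLeast[where F = "\<lambda>r. - K / a * exp (- a * (r - l))" and T = 0])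
    show "((\<lambda>r. - K / a * exp (- a * (r - l))) has_real_derivative K * exp (- a * (r - l))) (at r)" for r
      using assms by (auto intro!: derivative_eq_intros)
    show "((\<lambda>r. - K / a * exp (- a * (r - l))) \<longlongrightarrow> 0) at_top"
      using assms by real_asymp
  qed (use assms in auto)
  finally show ?thesis by simp
qed

text \<open>Competing clocks: silence of all \<open>card E\<close> of them costs an exponential with
  that rate, and integrating over the time of the next ring gives one factor
  \<open>1 / card E\<close> per letter.\<close>

lemma follows_prob_prefix:
  assumes "set w \<subseteq> E" "\<And>e. e \<in> E \<Longrightarrow> \<tau> e \<le> t"
  shows "follows_prob (\<lambda>_. True) (\<lambda>r. r) w k \<tau> t
    = ennreal (exp (- (\<Sum>e\<in>E. t - \<tau> e)) / real (card E) ^ length w)"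
  using assms
proof (induction w arbitrary: k \<tau> t)
  case Nil
  then show ?case by (simp add: follows_prob_Nil)
next
  case (Cons e w)
  define m where "m = real (card E)"
  define K where "K = exp (- (\<Sum>e\<in>E. t - \<tau> e)) / m ^ length w"
  have e: "e \<in> E" "\<tau> e \<le> t" using Cons.prems by auto
  have m: "m > 0" using e(1) finite_E by (auto simp: m_def card_gt_0_iff)
  have "follows_prob (\<lambda>_. True) (\<lambda>r. r) (e # w) k \<tau> t
    = (\<integral>\<^sup>+r. of_bool (t < \<tau> e + r \<and> True) *
     follows_prob (\<lambda>_. True) (\<lambda>r. r) w (k(e := Suc (k e))) (\<tau>(e := \<tau> e + r)) (\<tau> e + r) \<partial>expo)"
    by (rule follows_prob_Cons) (use Cons.prems in auto)
  also have "\<dots> = (\<integral>\<^sup>+r. of_bool (t < \<tau> e + r) *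
     ennreal (K * exp r * exp (- m * (r - (t - \<tau> e)))) \<partial>expo)"
  proof (intro nn_integral_cong)
    fix r
    show "of_bool (t < \<tau> e + r \<and> True) *
      follows_prob (\<lambda>_. True) (\<lambda>r. r) w (k(e := Suc (k e))) (\<tau>(e := \<tau> e + r)) (\<tau> e + r)
      = of_bool (t < \<tau> e + r) * ennreal (K * exp r * exp (- m * (r - (t - \<tau> e))))"
    proof (cases "t < \<tau> e + r")
      case True
      have "\<tau> e' \<le> \<tau> e + r" if "e' \<in> E" for e' using Cons.prems(2)[OF that] True by simp
      then have "follows_prob (\<lambda>_. True) (\<lambda>r. r) w (k(e := Suc (k e))) (\<tau>(e := \<tau> e + r)) (\<tau> e + r)
        = ennreal (exp (- (\<Sum>e'\<in>E. (\<tau> e + r) - (\<tau>(e := \<tau> e + r)) e')) / m ^ length w)"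
        unfolding m_def by (intro Cons.IH) (use Cons.prems in auto)
      \<comment> \<open>Moving the reference time from \<open>t\<close> to
        \<open>\<tau> e + r\<close> adds \<open>r - (t - \<tau> e)\<close> for every clock; the term
        \<open>r\<close> is given back because the clock of \<open>e\<close> restarts there.\<close>
      also have "(\<Sum>e'\<in>E. (\<tau> e + r) - (\<tau>(e := \<tau> e + r)) e') = (\<Sum>e'\<in>E. (t - \<tau> e') + (r - (t - \<tau> e))) - r"
        unfolding sum_upd_diff[OF e(1)] by (simp add: algebra_simps)
      also have "\<dots> = (\<Sum>e'\<in>E. t - \<tau> e') + m * (r - (t - \<tau> e)) - r"
        by (simp only: sum.distrib sum_constant m_def)
      also have "exp (- \<dots>) / m ^ length w = K * exp r * exp (- m * (r - (t - \<tau> e)))"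
        by (simp add: K_def exp_diff exp_add exp_minus field_simps)
      finally show ?thesis using True by (simp add: fun_upd_def)
    qed auto
  qed
  also have "\<dots> = (\<integral>\<^sup>+r. ennreal (exp (- r)) * indicator {0..} r * (of_bool (t < \<tau> e + r) *
     ennreal (K * exp r * exp (- m * (r - (t - \<tau> e))))) \<partial>lborel)"
    by (rule nn_integral_expo) measurable
  also have "\<dots> = (\<integral>\<^sup>+r. ennreal (K * exp (- m * (r - (t - \<tau> e)))) * indicator {t - \<tau> e<..} r \<partial>lborel)"
  proof (intro nn_integral_cong)
    fix r
    have "ennreal (exp (- r)) * ennreal (K * exp r * exp (- m * (r - (t - \<tau> e))))
      = ennreal (exp (- r) * (K * exp r * exp (- m * (r - (t - \<tau> e)))))"
      by (rule ennreal_mult'[symmetric]) simp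
    also have "exp (- r) * (K * exp r * exp (- m * (r - (t - \<tau> e)))) = K * exp (- m * (r - (t - \<tau> e)))"
      by (simp add: exp_minus)
    finally show "ennreal (exp (- r)) * indicator {0..} r * (of_bool (t < \<tau> e + r) *
     ennreal (K * exp r * exp (- m * (r - (t - \<tau> e)))))
      = ennreal (K * exp (- m * (r - (t - \<tau> e)))) * indicator {t - \<tau> e<..} r"
      using e(2) by (auto split: split_indicator)
  qed
  also have "\<dots> = ennreal (K / m)"
    by (rule nn_integral_exp_Ioi) (use m in \<open>auto simp: K_def\<close>)
  finally show ?case by (simp add: K_def m_def mult.commute)
qed

end

section \<open>The monotone coupling along a sequence of edges\<close>

lemma receiver_eq:
  "receiver orient p e r x =
     (if r \<le> p e (x (fst (orient e)) - x (snd (orient e))) then fst (orient e) else snd (orient e))"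
  by (simp add: receiver_def case_prod_beta Let_def)

definition moved_tag where
  "moved_tag orient p e r x v =
     (let a = receiver orient p e r x; b = receiver orient p e r (bump x v) in if a = b then v else b)"

text \<open>An extra ball at \<open>v\<close> can only deter an edge from giving to
  \<open>v\<close>. So if the receivers differ, the first copy gives to \<open>v\<close> and removes
  the surplus there, while the ball of the second copy becomes the new surplus.\<close>

lemma bump_receiver:
  assumes "antimono (p e)"
  shows "bump (bump x v) (receiver orient p e r (bump x v))
    = bump (bump x (receiver orient p e r x)) (moved_tag orient p e r x v)"
proof (cases "receiver orient p e r x = receiver orient p e r (bump x v)")
  case True
  then show ?thesis by (simp add: moved_tag_def bump_commute)
next
  case False
  obtain a b where ab: "orient e = (a, b)" by (cases "orient e") auto
  define d where "d = x a - x b"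
  have d: "p e (d + 1) \<le> p e d" "p e d \<le> p e (d - 1)" using assms by (auto simp: antimono_def)
  have "bump x v a - bump x v b = (if a = v then d + 1 else d) - (if b = v then 1 else 0)"
    by (simp add: bump_apply d_def)
  then have "receiver orient p e r x = v"
    using False d by (auto simp: receiver_eq ab d_def[symmetric] split: if_splits)
  then show ?thesis using False by (simp add: moved_tag_def)
qed

text \<open>The recursion starts with the first event, as in \<open>follows\<close>, so that the
  first mark can be integrated out; \<open>profile_after\<close> adds events at the end. The index
  of the next mark is \<open>l\<close>.\<close>

primrec profile_run where
  "profile_run orient p [] m l x = x"
| "profile_run orient p (e # w) m l x = profile_run orient p w m (Suc l) (bump x (receiver orient p e (m l) x))"

primrec tag_run where
  "tag_run orient p [] m l x v = v"
| "tag_run orient p (e # w) m l x v =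
     tag_run orient p w m (Suc l) (bump x (receiver orient p e (m l) x)) (moved_tag orient p e (m l) x v)"

lemma profile_run_bump:
  assumes "\<And>e. e \<in> set w \<Longrightarrow> antimono (p e)"
  shows "profile_run orient p w m l (bump x v) = bump (profile_run orient p w m l x) (tag_run orient p w m l x v)"
  using assms
proof (induction w arbitrary: l x v)
  case (Cons e w)
  then show ?case by (simp add: bump_receiver)
qed simp

lemma profile_run_snoc:
  "profile_run orient p (w @ [e]) m l x =
     bump (profile_run orient p w m l x) (receiver orient p e (m (l + length w)) (profile_run orient p w m l x))"
  by (induction w arbitrary: l x) auto

lemma profile_after_eq_run:
  assumes "\<And>i. i < length w \<Longrightarrow> event_edge E c i = w ! i"
  shows "profile_after E orient p c m x (length w) = profile_run orient p w m 0 x"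
  using assms
proof (induction w rule: rev_induct)
  case (snoc e w)
  have "event_edge E c i = w ! i" if "i < length w" for i
    using snoc.prems[of i] that by (simp add: nth_append)
  moreover have "event_edge E c (length w) = e" using snoc.prems[of "length w"] by simp
  ultimately show ?case using snoc.IH by (simp add: profile_run_snoc bump_def Let_def)
qed simp

lemma tag_after_eq_run:
  assumes "\<And>i. i < length w \<Longrightarrow> event_edge E c i = w ! i" "\<And>e. e \<in> set w \<Longrightarrow> antimono (p e)"
  shows "tag_after E orient p c m x v (length w) = tag_run orient p w m 0 x v"
proof -
  have "profile_after E orient p c m y (length w) = profile_run orient p w m 0 y" for y
    by (rule profile_after_eq_run) (rule assms(1))
  then show ?thesis
    by (simp add: tag_after_def bump_def[symmetric] profile_run_bump[OF assms(2)] bump_inject)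
qed

lemma tag_run_cong:
  "(\<And>j. l \<le> j \<Longrightarrow> m j = m' j) \<Longrightarrow> tag_run orient p w m l x v = tag_run orient p w m' l x v"
proof (induction w arbitrary: l x v)
  case (Cons e w)
  have "tag_run orient p w m (Suc l) x' v' = tag_run orient p w m' (Suc l) x' v'" for x' v'
    by (rule Cons.IH) (use Cons.prems in auto)
  then show ?case using Cons.prems by simp
qed simp

text \<open>The pair of receivers takes at most four values, each on a measurable set determined by
  two thresholds, so only fixed values of the first two arguments of \<open>F\<close> have to be
  examined.\<close>

lemma measurable_threshold:
  fixes x :: "'a profile"
  assumes [measurable]: "\<rho> \<in> borel_measurable M" and "\<And>a b. (\<lambda>X. F a b X) \<in> measurable M N"
  shows "(\<lambda>X. F (receiver orient p e (\<rho> X) x) (moved_tag orient p e (\<rho> X) x v) X) \<in> measurable M N"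
proof -
  define t where "t y = p e (y (fst (orient e)) - y (snd (orient e)))" for y :: "'a \<Rightarrow> int"
  define F' where "F' a b X = F a (if a = b then v else b) X" for a b X
  have [measurable]: "(\<lambda>X. F' a b X) \<in> measurable M N" for a b
    unfolding F'_def by (rule assms)
  have "(\<lambda>X. F (receiver orient p e (\<rho> X) x) (moved_tag orient p e (\<rho> X) x v) X) =
    (\<lambda>X. if \<rho> X \<le> t x
       then if \<rho> X \<le> t (bump x v) then F' (fst (orient e)) (fst (orient e)) X else F' (fst (orient e)) (snd (orient e)) X
       else if \<rho> X \<le> t (bump x v) then F' (snd (orient e)) (fst (orient e)) X else F' (snd (orient e)) (snd (orient e)) X)"
    by (auto simp: fun_eq_iff moved_tag_def receiver_eq Let_def t_def F'_def)
  also have "\<dots> \<in> measurable M N" by measurable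
  finally show ?thesis .
qed

lemma measurable_tag_run:
  assumes "\<And>k. (\<lambda>X. m X k) \<in> borel_measurable M"
  shows "(\<lambda>X. G (tag_run orient p w (m X) l x v) :: ennreal) \<in> borel_measurable M"
proof (induction w arbitrary: l x v)
  case (Cons e w)
  show ?case unfolding tag_run.simps
    by (rule measurable_threshold[where F = "\<lambda>a b X. G (tag_run orient p w (m X) (Suc l) (bump x a) b)",
          OF assms Cons])
qed simp

abbreviation uniform01 :: "real measure" where
  "uniform01 \<equiv> uniform_measure lborel {0<..<1}"

primrec mark_avg :: "_ \<Rightarrow> _ \<Rightarrow> ('a \<Rightarrow> ennreal) \<Rightarrow> 'a set list \<Rightarrow> 'a profile \<Rightarrow> 'a \<Rightarrow> ennreal" where
  "mark_avg orient p g [] x v = g v"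
| "mark_avg orient p g (e # w) x v =
     (\<integral>\<^sup>+r. mark_avg orient p g w (bump x (receiver orient p e r x)) (moved_tag orient p e r x v) \<partial>uniform01)"

context driving_law
begin

text \<open>Independence of the marks from everything else: \<open>A\<close> collects what does not
  read the marks from index \<open>l\<close> on, and it stays a factor while these marks are
  integrated out one by one.\<close>

lemma nn_integral_tag_run:
  fixes orient :: "'a set \<Rightarrow> 'a \<times> 'a"
  assumes "A \<in> borel_measurable law" "\<And>X j r. l \<le> j \<Longrightarrow> A (X(Mark j := r)) = A X"
  shows "(\<integral>\<^sup>+X. A X * g (tag_run orient p w (marks X) l x v) \<partial>law)
    = (\<integral>\<^sup>+X. A X \<partial>law) * mark_avg orient p g w x v"
  using assms
proof (induction w arbitrary: l x v)
  case Nil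
  then show ?case by (simp add: nn_integral_multc)
next
  case (Cons e w)
  have marks: "(\<lambda>X. marks X k) \<in> borel_measurable law" for k
    unfolding marks_def by measurable
  have [measurable]: "(\<lambda>X. g (tag_run orient p w' (marks X) l x v)) \<in> borel_measurable law" for w' l x v
    by (rule measurable_tag_run) (rule marks)
  have [measurable]: "A \<in> borel_measurable law" by fact
  have "(\<integral>\<^sup>+X. A X * g (tag_run orient p (e # w) (marks X) l x v) \<partial>law)
    = (\<integral>\<^sup>+r. \<integral>\<^sup>+X. A (X(Mark l := r)) * g (tag_run orient p (e # w) (marks (X(Mark l := r))) l x v) \<partial>law
        \<partial>source_law S (Mark l :: 'e source))"
    by (rule resample, simp) (rule borel_measurable_times_ennreal; fact)
  also have "\<dots> = (\<integral>\<^sup>+r. \<integral>\<^sup>+X. A X * g (tag_run orient p w (marks X) (Suc l)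
      (bump x (receiver orient p e r x)) (moved_tag orient p e r x v)) \<partial>law \<partial>uniform01)"
  proof -
    have 1: "marks (X(Mark l := r)) l = r" for X :: "'e source \<Rightarrow> real" and r by (simp add: marks_def)
    have 2: "tag_run orient p w (marks (X(Mark l := r))) (Suc l) x' v' = tag_run orient p w (marks X) (Suc l) x' v'"
      for X :: "'e source \<Rightarrow> real" and r x' v' by (rule tag_run_cong) (simp add: marks_def)
    show ?thesis unfolding tag_run.simps 1 2 Cons.prems(2)[OF order.refl] source_law.simps ..
  qed
  also have "\<dots> = (\<integral>\<^sup>+r. (\<integral>\<^sup>+X. A X \<partial>law) * mark_avg orient p g w
      (bump x (receiver orient p e r x)) (moved_tag orient p e r x v) \<partial>uniform01)"
    by (intro nn_integral_cong Cons.IH) (use Cons.prems in auto)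
  also have "\<dots> = (\<integral>\<^sup>+X. A X \<partial>law) * mark_avg orient p g (e # w) x v"
    unfolding mark_avg.simps
    by (rule nn_integral_cmult)
       (rule measurable_threshold[where \<rho> = "\<lambda>r. r" and F = "\<lambda>a b r. mark_avg orient p g w (bump x a) b"]; simp)
  finally show ?case .
qed

text \<open>Initial tag, clocks and marks occupy disjoint coordinates of the product, which gives
  the three factors.\<close>

lemma nn_integral_Start_follows_tag_run:
  fixes orient :: "'a set \<Rightarrow> 'a \<times> 'a"
  assumes w: "set w \<subseteq> E" and [measurable]: "Measurable.pred borel P" "b \<in> borel_measurable borel"
  shows "(\<integral>\<^sup>+X. of_bool (X Start = s) * of_bool (follows E P b w k \<tau> t (waits X))
      * g (tag_run orient p w' (marks X) l x v) \<partial>law)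
    = emeasure S {s} * follows_prob P b w k \<tau> t * mark_avg orient p g w' x v"
proof -
  have [measurable]: "Measurable.pred law (\<lambda>X. follows E P b w k \<tau> t (waits X))"
    using w by (intro measurable_follows) auto
  have [measurable]: "(\<lambda>X. of_bool (X Start = s) * of_bool (follows E P b w k \<tau> t (waits X)) :: ennreal) \<in> borel_measurable law"
    by measurable
  have "(\<integral>\<^sup>+X. of_bool (X Start = s) * of_bool (follows E P b w k \<tau> t (waits X))
      * g (tag_run orient p w' (marks X) l x v) \<partial>law)
    = (\<integral>\<^sup>+X. of_bool (X Start = s) * of_bool (follows E P b w k \<tau> t (waits X)) \<partial>law)
      * mark_avg orient p g w' x v"
  proof (rule nn_integral_tag_run)
    fix X :: "'e source \<Rightarrow> real" and j r
    have "waits (X(Mark j := r)) = waits X" by (simp add: waits_def fun_eq_iff)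
    then show "of_bool ((X(Mark j := r)) Start = s) * of_bool (follows E P b w k \<tau> t (waits (X(Mark j := r))))
      = (of_bool (X Start = s) * of_bool (follows E P b w k \<tau> t (waits X)) :: ennreal)" by simp
  qed measurable
  also have "(\<integral>\<^sup>+X. of_bool (X Start = s) * of_bool (follows E P b w k \<tau> t (waits X)) \<partial>law)
    = (\<integral>\<^sup>+c. \<integral>\<^sup>+X. of_bool ((X(Start := c)) Start = s) * of_bool (follows E P b w k \<tau> t (waits (X(Start := c)))) \<partial>law
        \<partial>source_law S (Start :: 'e source))"
    by (rule resample) auto
  also have "\<dots> = (\<integral>\<^sup>+c. indicator {s} c * follows_prob P b w k \<tau> t \<partial>S)"
  proof -
    have "waits (X(Start := c)) = waits X" for X :: "'e source \<Rightarrow> real" and c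
      by (simp add: waits_def fun_eq_iff)
    then show ?thesis
      by (auto intro!: nn_integral_cong simp: follows_prob_def source_law.simps split: split_indicator)
  qed
  also have "\<dots> = emeasure S {s} * follows_prob P b w k \<tau> t"
    by (subst nn_integral_multc) (auto simp: sets_S intro!: borel_measurable_indicator)
  finally show ?thesis .
qed

end

section \<open>Averaging over marks and edges\<close>

lemma nn_integral_uniform01_thresholds:
  fixes H :: "bool \<Rightarrow> bool \<Rightarrow> real"
  assumes t: "0 \<le> t" "t \<le> 1" "0 \<le> t'" "t' \<le> 1" and H: "\<And>a b. 0 \<le> H a b"
  shows "(\<integral>\<^sup>+r. ennreal (H (r \<le> t) (r \<le> t')) \<partial>uniform01)
    = ennreal (min t t' * H True True + max 0 (t - t') * H True False + max 0 (t' - t) * H False True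
        + (1 - max t t') * H False False)"
proof -
  have "(\<integral>\<^sup>+r. ennreal (H (r \<le> t) (r \<le> t')) \<partial>uniform01)
    = (\<integral>\<^sup>+r. ennreal (H (r \<le> t) (r \<le> t')) * indicator {0<..<1} r \<partial>lborel)"
    by (subst nn_integral_uniform_measure) (auto simp: divide_ennreal_def)
  \<comment> \<open>The unit interval is cut at both thresholds; at least one of the two middle
    pieces is empty.\<close>
  also have "\<dots> = (\<integral>\<^sup>+r. ennreal (H True True) * indicator {0..min t t'} r + ennreal (H True False) * indicator {t'<..t} r
      + ennreal (H False True) * indicator {t<..t'} r + ennreal (H False False) * indicator {max t t'<..1} r \<partial>lborel)"
    by (intro nn_integral_cong_AE eventually_mono[OF eventually_conj[OF AE_lborel_singleton[of 0] AE_lborel_singleton[of 1]]])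
       (use t in \<open>auto split: split_indicator\<close>)
  also have "\<dots> = ennreal (H True True) * ennreal (min t t') + ennreal (H True False) * ennreal (max 0 (t - t'))
      + ennreal (H False True) * ennreal (max 0 (t' - t)) + ennreal (H False False) * ennreal (1 - max t t')"
  proof -
    have "emeasure lborel {a<..b} = ennreal (max 0 (b - a))" for a b :: real
      by (cases "a \<le> b") (auto simp: max_def)
    then show ?thesis using t
      by (simp add: nn_integral_add nn_integral_cmult_indicator)
  qed
  also have "\<dots> = ennreal (min t t' * H True True + max 0 (t - t') * H True False + max 0 (t' - t) * H False True
        + (1 - max t t') * H False False)"
  proof -
    have *: "ennreal h1 * ennreal s1 + ennreal h2 * ennreal s2 + ennreal h3 * ennreal s3 + ennreal h4 * ennreal s4
      = ennreal (s1 * h1 + s2 * h2 + s3 * h3 + s4 * h4)"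
      if "0 \<le> s1" "0 \<le> s2" "0 \<le> s3" "0 \<le> s4" "0 \<le> h1" "0 \<le> h2" "0 \<le> h3" "0 \<le> h4"
      for s1 s2 s3 s4 h1 h2 h3 h4
      using that by (simp add: ennreal_mult'[symmetric] ennreal_plus[symmetric] mult.commute del: ennreal_plus)
    show ?thesis by (rule *) (use t H in auto)
  qed
  finally show ?thesis .
qed

text \<open>Replaces the given orientation by the direction of the cycle. For a reversed edge, the
  complement and the change of sign together keep the function nonincreasing.\<close>

definition cycle_q ::
  "nat \<Rightarrow> (nat set \<Rightarrow> nat \<times> nat) \<Rightarrow> (nat set \<Rightarrow> int \<Rightarrow> real) \<Rightarrow> nat \<Rightarrow> int \<Rightarrow> real" where
  "cycle_q n orient p v d =
     (let e = {v, (v + 1) mod n} in if fst (orient e) = v then p e d else 1 - p e (- d))"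

locale cycle_process =
  fixes n :: nat and orient :: "nat set \<Rightarrow> nat \<times> nat" and p :: "nat set \<Rightarrow> int \<Rightarrow> real"
  assumes n_ge_3: "n \<ge> 3" and rule: "endpoint_local_monotone (cycle_edges n) orient p"
begin

lemma cycle_edgesI: "v < n \<Longrightarrow> {v, (v + 1) mod n} \<in> cycle_edges n"
  by (auto simp: cycle_edges_def)

lemma antimono_p: "e \<in> cycle_edges n \<Longrightarrow> antimono (p e)"
  and p_bounds: "e \<in> cycle_edges n \<Longrightarrow> 0 \<le> p e d" "e \<in> cycle_edges n \<Longrightarrow> p e d \<le> 1"
  and orient_edge: "e \<in> cycle_edges n \<Longrightarrow> {fst (orient e), snd (orient e)} = e"
proof -
  show "antimono (p e)" "{fst (orient e), snd (orient e)} = e" if "e \<in> cycle_edges n"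
    using rule that by (auto simp: endpoint_local_monotone_def)
  show "0 \<le> p e d" "p e d \<le> 1" if "e \<in> cycle_edges n"
    using rule that subsetD[OF _ rangeI[of "p e" d], of "{0..1}"]
    by (auto simp: endpoint_local_monotone_def)
qed

sublocale cycle_rule n "cycle_q n orient p"
proof
  fix v d assume v: "v < n"
  note e = cycle_edgesI[OF v]
  show "antimono (cycle_q n orient p v)"
    using antimono_p[OF e] by (auto simp: cycle_q_def antimono_def Let_def)
  show "0 \<le> cycle_q n orient p v d" "cycle_q n orient p v d \<le> 1"
    using p_bounds[OF e] by (auto simp: cycle_q_def Let_def)
qed (rule n_ge_3)

definition edge :: "nat \<Rightarrow> nat set" where "edge v = {v, nxt v}"

lemma edge_in: "v < n \<Longrightarrow> edge v \<in> cycle_edges n"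
  using cycle_edgesI[of v] by (simp add: edge_def nxt_def)

text \<open>Two vertices that follow each other in both directions would form a cycle of length 2,
  which \<open>n \<ge> 3\<close> rules out.\<close>

lemma inj_on_edge: "inj_on edge {..<n}"
proof (rule inj_onI)
  fix u v assume uv: "u \<in> {..<n}" "v \<in> {..<n}" "edge u = edge v"
  show "u = v"
  proof (rule ccontr)
    assume "u \<noteq> v"
    then have "u = nxt v" "v = nxt u" using uv(3) by (auto simp: edge_def doubleton_eq_iff)
    then show False using nxt_neq_prv[of v] prv_nxt[of u] uv by auto
  qed
qed

lemma cycle_edges_eq: "cycle_edges n = edge ` {..<n}"
  by (auto simp: cycle_edges_def edge_def nxt_def)

lemma finite_cycle_edges: "finite (cycle_edges n)" and card_cycle_edges: "card (cycle_edges n) = n"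
  by (auto simp: cycle_edges_eq card_image inj_on_edge)

lemma sum_cycle_edges: "(\<Sum>e\<in>cycle_edges n. F e) = (\<Sum>v<n. F (edge v))"
  by (simp add: cycle_edges_eq sum.reindex inj_on_edge)

text \<open>For either orientation the receivers of the two copies are threshold functions of the mark;
  the law of the pair is determined by the values of \<open>cycle_q\<close>.\<close>

lemma edge_pair_average:
  assumes "v < n" and H: "\<And>a b. 0 \<le> H a b"
  shows "(\<integral>\<^sup>+r. ennreal (H (receiver orient p (edge v) r x) (receiver orient p (edge v) r y)) \<partial>uniform01)
    = ennreal (let a = give_right x v; b = give_right y v in
        min a b * H v v + max 0 (a - b) * H v (nxt v) + max 0 (b - a) * H (nxt v) v
        + (1 - max a b) * H (nxt v) (nxt v))"
proof -
  define e where "e = edge v"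
  have e: "e \<in> cycle_edges n" using edge_in[OF assms(1)] by (simp add: e_def)
  have nx: "nxt v = (v + 1) mod n" by (simp add: nxt_def)
  have vn: "v \<noteq> nxt v" using nxt_neq[OF assms(1)] by simp
  have q: "give_right z v = (if fst (orient e) = v then p e (z v - z (nxt v)) else 1 - p e (z (nxt v) - z v))" for z
    by (simp add: give_right_def cycle_q_def e_def edge_def nx Let_def)
  have "orient e = (v, nxt v) \<or> orient e = (nxt v, v)"
    using orient_edge[OF e] by (cases "orient e") (auto simp: e_def edge_def doubleton_eq_iff)
  then show ?thesis
  proof
    assume o: "orient e = (v, nxt v)"
    show ?thesis
      using nn_integral_uniform01_thresholds[of "p e (x v - x (nxt v))" "p e (y v - y (nxt v))"
          "\<lambda>s s'. H (if s then v else nxt v) (if s' then v else nxt v)"] p_bounds[OF e] H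
      unfolding e_def[symmetric] receiver_eq o q fst_conv snd_conv by (simp add: Let_def)
  next
    assume o: "orient e = (nxt v, v)"
    show ?thesis
      using nn_integral_uniform01_thresholds[of "p e (x (nxt v) - x v)" "p e (y (nxt v) - y v)"
          "\<lambda>s s'. H (if s then nxt v else v) (if s' then nxt v else v)"] p_bounds[OF e] H
      unfolding e_def[symmetric] receiver_eq o q fst_conv snd_conv using vn
      by (simp add: Let_def min_def max_def algebra_simps split: if_splits)
  qed
qed

text \<open>The thresholds \<open>a\<close> and \<open>b\<close> of the two copies differ only on
  the two edges at the tag, and there by a jump rate with known sign, which resolves every
  \<open>min\<close> and \<open>max\<close>.\<close>

lemma edge_average:
  assumes "u < n" "v < n" and G: "\<And>y w. 0 \<le> G y w"
  shows "(\<integral>\<^sup>+r. ennreal (G (bump x (receiver orient p (edge u) r x)) (moved_tag orient p (edge u) r x v)) \<partial>uniform01)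
    = ennreal (give_right x u * G (bump x u) v + (1 - give_right x u) * G (bump x (nxt u)) v
       + (if u = v then jump_right x v * (G (bump x v) (nxt v) - G (bump x v) v) else 0)
       + (if u = prv v then jump_left x v * (G (bump x v) (prv v) - G (bump x v) v) else 0))"
proof -
  define a where "a = give_right x u"
  define b where "b = give_right (bump x v) u"
  have b: "b = a - (if u = v then jump_right x v else 0) + (if u = prv v then jump_left x v else 0)"
    unfolding a_def b_def by (rule give_right_bump) (use assms in auto)
  have un: "u \<noteq> nxt u" using nxt_neq[OF assms(1)] by simp
  have "(\<integral>\<^sup>+r. ennreal (G (bump x (receiver orient p (edge u) r x)) (moved_tag orient p (edge u) r x v)) \<partial>uniform01)
    = ennreal (min a b * G (bump x u) v + max 0 (a - b) * G (bump x u) (nxt u) + max 0 (b - a) * G (bump x (nxt u)) u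
        + (1 - max a b) * G (bump x (nxt u)) v)"
    using edge_pair_average[OF assms(1), of "\<lambda>c d. G (bump x c) (if c = d then v else d)" x "bump x v"] G un
    by (simp add: moved_tag_def Let_def a_def b_def)
  also have "min a b * G (bump x u) v + max 0 (a - b) * G (bump x u) (nxt u) + max 0 (b - a) * G (bump x (nxt u)) u
        + (1 - max a b) * G (bump x (nxt u)) v
     = a * G (bump x u) v + (1 - a) * G (bump x (nxt u)) v
       + (if u = v then jump_right x v * (G (bump x v) (nxt v) - G (bump x v) v) else 0)
       + (if u = prv v then jump_left x v * (G (bump x v) (prv v) - G (bump x v) v) else 0)"
  proof -
    have j: "0 \<le> jump_right x v" "0 \<le> jump_left x v"
      using jump_right_nonneg jump_left_nonneg assms by auto
    consider "u = v" "u \<noteq> prv v" | "u \<noteq> v" "u = prv v" | "u \<noteq> v" "u \<noteq> prv v"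
      using prv_neq[OF assms(2)] by auto
    then show ?thesis
    proof cases
      case 1
      then have b: "b = a - jump_right x v" using b by simp
      have "min a b = b" "max 0 (a - b) = jump_right x v" "max 0 (b - a) = 0" "max a b = a" using b j by auto
      then show ?thesis using 1 by (simp add: b algebra_simps)
    next
      case 2
      then have b: "b = a + jump_left x v" using b by simp
      have "min a b = a" "max 0 (a - b) = 0" "max 0 (b - a) = jump_left x v" "max a b = b" using b j by auto
      then show ?thesis using 2 assms by (simp add: b algebra_simps)
    next
      case 3
      then show ?thesis using b by simp
    qed
  qed
  finally show ?thesis by (simp add: a_def)
qed

lemma moved_tag_less: "e \<in> cycle_edges n \<Longrightarrow> v < n \<Longrightarrow> moved_tag orient p e r x v < n"
proof -
  assume e: "e \<in> cycle_edges n" and v: "v < n"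
  have "e \<subseteq> {..<n}" using e by (auto simp: cycle_edges_eq edge_def)
  then have "fst (orient e) < n" "snd (orient e) < n" using orient_edge[OF e] by auto
  then show ?thesis using v by (auto simp: moved_tag_def receiver_eq Let_def)
qed

text \<open>The link between the explicit operator \<open>step\<close> and the coupled dynamics
  driven by a uniform edge and a uniform mark.\<close>

lemma sum_edge_average:
  assumes "v < n" and G: "\<And>y w. 0 \<le> G y w"
  shows "(\<Sum>e\<in>cycle_edges n. \<integral>\<^sup>+r. ennreal (G (bump x (receiver orient p e r x)) (moved_tag orient p e r x v)) \<partial>uniform01)
    = ennreal (n * step G x v)"
proof -
  define F where "F u = give_right x u * G (bump x u) v + (1 - give_right x u) * G (bump x (nxt u)) v
       + (if u = v then jump_right x v * (G (bump x v) (nxt v) - G (bump x v) v) else 0)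
       + (if u = prv v then jump_left x v * (G (bump x v) (prv v) - G (bump x v) v) else 0)" for u
  \<comment> \<open>Addition inside \<open>ennreal\<close> requires a sign for each edge separately;
    the negative jump terms are absorbed by the rate of their own edge.\<close>
  have "0 \<le> F u" if u: "u < n" for u
  proof -
    have g: "0 \<le> give_right x u" "give_right x u \<le> 1" using u give_right_nonneg give_right_le_1 by auto
    have 1: "jump_right x v \<le> give_right x v" "0 \<le> jump_right x v"
      using assms jump_right_le jump_right_nonneg by auto
    have 2: "jump_left x v \<le> 1 - give_right x (prv v)" "0 \<le> jump_left x v"
      using assms jump_left_le[of v x] jump_left_nonneg by (auto simp: give_left_def)
    consider "u = v" "u \<noteq> prv v" | "u \<noteq> v" "u = prv v" | "u \<noteq> v" "u \<noteq> prv v"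
      using prv_neq[OF assms(1)] by auto
    then show ?thesis
    proof cases
      case a: 1
      then have "F u = (give_right x u - jump_right x u) * G (bump x u) u + (1 - give_right x u) * G (bump x (nxt u)) u
        + jump_right x u * G (bump x u) (nxt u)" by (simp add: F_def algebra_simps)
      then show ?thesis using 1 a g G by auto
    next
      case b: 2
      then have "F u = give_right x u * G (bump x u) v + (1 - give_right x u - jump_left x v) * G (bump x v) v
        + jump_left x v * G (bump x v) u" using assms by (simp add: F_def algebra_simps)
      then show ?thesis using 2 b g G by auto
    qed (use g G in \<open>auto simp: F_def\<close>)
  qed
  then have "(\<Sum>e\<in>cycle_edges n. \<integral>\<^sup>+r. ennreal (G (bump x (receiver orient p e r x)) (moved_tag orient p e r x v)) \<partial>uniform01)
    = ennreal (\<Sum>u<n. F u)"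
    unfolding sum_cycle_edges
    by (subst sum_ennreal[symmetric])
       (auto intro!: sum.cong edge_average simp: F_def assms)
  also have "(\<Sum>u<n. F u) = n * step G x v"
  proof -
    have "(\<Sum>u<n. (1 - give_right x u) * G (bump x (nxt u)) v) = (\<Sum>u<n. give_left x u * G (bump x u) v)"
      using sum_nxt[of "\<lambda>u. give_left x u * G (bump x u) v"] by (simp add: give_left_def)
    then show ?thesis using assms(1) n_ge_3
      by (simp add: F_def step_def sum.distrib load_rate_def distrib_right sum_distrib_right)
  qed
  finally show ?thesis .
qed

lemma step_nonneg:
  assumes "\<And>y w. w < n \<Longrightarrow> 0 \<le> g y w" "v < n"
  shows "0 \<le> (step g x v :: real)"
proof -
  have "step (\<lambda>_ _. 0) x v = (0 :: real)" by (simp add: step_def)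
  then show ?thesis using step_mono[of "\<lambda>_ _. 0" g v x] assms by simp
qed

section \<open>Iterates of the step operator as averages over words of edges\<close>

lemma finite_words: "finite {w. set w \<subseteq> cycle_edges n \<and> length w = h}"
  by (rule finite_lists_length_eq) (rule finite_cycle_edges)

lemma sum_words_Suc:
  "(\<Sum>w | set w \<subseteq> cycle_edges n \<and> length w = Suc h. F w)
    = (\<Sum>e\<in>cycle_edges n. \<Sum>w | set w \<subseteq> cycle_edges n \<and> length w = h. F (e # w))"
proof -
  have "(\<Sum>w | set w \<subseteq> cycle_edges n \<and> length w = Suc h. F w)
    = (\<Sum>(e, w)\<in>cycle_edges n \<times> {w. set w \<subseteq> cycle_edges n \<and> length w = h}. F (e # w))"
    by (rule sum.reindex_bij_witness[where i = "\<lambda>(e, w). e # w" and j = "\<lambda>w. (hd w, tl w)"])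
       (auto simp: length_Suc_conv)
  then show ?thesis by (simp add: sum.cartesian_product)
qed

lemma sum_mark_avg:
  assumes g: "\<And>v. 0 \<le> g v" and "v < n"
  shows "(\<Sum>w | set w \<subseteq> cycle_edges n \<and> length w = h. mark_avg orient p (\<lambda>v. ennreal (g v)) w x v)
    = ennreal (n ^ h * (step ^^ h) (\<lambda>_. g) x v)"
  using assms(2)
proof (induction h arbitrary: x v)
  case 0
  have "{w. set w \<subseteq> cycle_edges n \<and> length w = 0} = {[]}" by auto
  then show ?case by (simp del: length_0_conv)
next
  case (Suc h)
  \<comment> \<open>Iterates of \<open>step\<close> are known to be nonnegative only at vertices,
    while \<open>sum_edge_average\<close> asks for it everywhere. The cut-off leaves
    \<open>step G x v\<close> unchanged for \<open>v < n\<close>.\<close>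
  define G where "G y w = (if w < n then (step ^^ h) (\<lambda>_. g) y w else 0)" for y w
  have G: "0 \<le> G y w" for y w
  proof -
    have "w < n \<Longrightarrow> 0 \<le> (step ^^ h) (\<lambda>_. g) y w"
      by (induction h arbitrary: y w) (auto intro!: step_nonneg simp: g)
    then show ?thesis by (simp add: G_def)
  qed
  have "(\<Sum>w | set w \<subseteq> cycle_edges n \<and> length w = Suc h. mark_avg orient p (\<lambda>v. ennreal (g v)) w x v)
    = (\<Sum>e\<in>cycle_edges n. \<integral>\<^sup>+r. (\<Sum>w | set w \<subseteq> cycle_edges n \<and> length w = h. mark_avg orient p (\<lambda>v. ennreal (g v)) w
        (bump x (receiver orient p e r x)) (moved_tag orient p e r x v)) \<partial>uniform01)"
    unfolding sum_words_Suc mark_avg.simps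
    by (intro sum.cong refl nn_integral_sum[symmetric]
        measurable_threshold[where \<rho> = "\<lambda>r. r" and F = "\<lambda>a b r. mark_avg orient p (\<lambda>v. ennreal (g v)) _ (bump x a) b"])
       auto
  also have "\<dots> = (\<Sum>e\<in>cycle_edges n. \<integral>\<^sup>+r. ennreal (n ^ h) *
        ennreal (G (bump x (receiver orient p e r x)) (moved_tag orient p e r x v)) \<partial>uniform01)"
    by (intro sum.cong refl nn_integral_cong)
       (simp add: Suc.IH moved_tag_less Suc.prems G_def ennreal_mult')
  also have "\<dots> = (\<Sum>e\<in>cycle_edges n. ennreal (n ^ h) *
        (\<integral>\<^sup>+r. ennreal (G (bump x (receiver orient p e r x)) (moved_tag orient p e r x v)) \<partial>uniform01))"
    by (intro sum.cong refl nn_integral_cmult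
        measurable_threshold[where \<rho> = "\<lambda>r. r" and F = "\<lambda>a b r. ennreal (G (bump x a) b)"]) auto
  also have "\<dots> = ennreal (n ^ h) * ennreal (n * step G x v)"
    using sum_edge_average[where G = G and x = x, OF Suc.prems G]
    by (simp only: sum_distrib_left[symmetric])
  also have "step G x v = (step ^^ Suc h) (\<lambda>_. g) x v"
    using Suc.prems by (simp add: step_def G_def)
  also have "ennreal (n ^ h) * ennreal (n * (step ^^ Suc h) (\<lambda>_. g) x v) = ennreal (n ^ Suc h * (step ^^ Suc h) (\<lambda>_. g) x v)"
    by (subst ennreal_mult'[symmetric]) (simp_all add: mult_ac)
  finally show ?case .
qed

end

section \<open>Identifying the events\<close>

lemma ring_time_mono: "(\<And>i. 0 \<le> c e i) \<Longrightarrow> j \<le> k \<Longrightarrow> ring_time c e j \<le> ring_time c e k"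
  unfolding ring_time_def by (rule sum_mono2) auto

text \<open>The list \<open>ps\<close> names the rings behind the letters of \<open>w\<close> in
  order of time. The witness for \<open>T\<close> is the time of the last of them, or
  \<open>t\<close> for the empty word.\<close>

lemma follows_events:
  assumes "follows E P b w k \<tau> t c" "set w \<subseteq> E"
    and pos: "\<forall>e\<in>E. \<forall>j. 0 < c e j"
    and \<tau>: "\<And>e. e \<in> E \<Longrightarrow> \<tau> e = (\<Sum>i<k e. c e i)"
  shows "\<exists>ps T. map fst ps = w
    \<and> sorted_wrt (\<lambda>(e, j) (e', j'). ring_time c e j < ring_time c e' j') ps
    \<and> (\<forall>(e, j)\<in>set ps. e \<in> E \<and> k e \<le> j \<and> t < ring_time c e j \<and> ring_time c e j \<le> T \<and> P (ring_time c e j))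
    \<and> (\<forall>e\<in>E. \<forall>j\<ge>k e. (e, j) \<notin> set ps \<longrightarrow> b T < ring_time c e j) \<and> t \<le> T"
  using assms(1,2) \<tau>
proof (induction w arbitrary: k \<tau> t)
  case Nil
  have "b t < ring_time c e j" if "e \<in> E" "k e \<le> j" for e j
  proof -
    have "b t < ring_time c e (k e)"
      using Nil that by (simp add: ring_time_def lessThan_Suc_atMost[symmetric])
    also have "\<dots> \<le> ring_time c e j"
      using that pos by (intro ring_time_mono) (auto simp: less_imp_le)
    finally show ?thesis .
  qed
  then show ?case by (intro exI[of _ "[]"] exI[of _ t]) auto
next
  case (Cons e w)
  define t' where "t' = ring_time c e (k e)"
  have e: "e \<in> E" using Cons.prems by auto
  have t': "\<tau> e + c e (k e) = t'"
    using Cons.prems(3)[OF e] by (simp add: t'_def ring_time_def lessThan_Suc_atMost[symmetric])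
  have f: "t < t'" "P t'" "follows E P b w (k(e := Suc (k e))) (\<tau>(e := t')) t' c"
    using Cons.prems(1) by (simp_all add: t')
  have "(\<tau>(e := t')) e' = (\<Sum>i<(k(e := Suc (k e))) e'. c e' i)" if "e' \<in> E" for e'
    using Cons.prems(3)[OF that] t' by auto
  from Cons.IH[OF f(3) _ this] Cons.prems(2) obtain ps T where ps: "map fst ps = w"
    "sorted_wrt (\<lambda>(e, j) (e', j'). ring_time c e j < ring_time c e' j') ps"
    "\<forall>(e', j)\<in>set ps. e' \<in> E \<and> (k(e := Suc (k e))) e' \<le> j \<and> t' < ring_time c e' j \<and> ring_time c e' j \<le> T \<and> P (ring_time c e' j)"
    "\<forall>e'\<in>E. \<forall>j\<ge>(k(e := Suc (k e))) e'. (e', j) \<notin> set ps \<longrightarrow> b T < ring_time c e' j" "t' \<le> T"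
    by auto
  have "b T < ring_time c e' j" if "e' \<in> E" "k e' \<le> j" "(e', j) \<notin> set ((e, k e) # ps)" for e' j
  proof -
    have "(k(e := Suc (k e))) e' \<le> j" using that by (auto simp: Suc_le_eq)
    then show ?thesis using ps(4) that by auto
  qed
  moreover have "k e' \<le> j" if "(e', j) \<in> set ps" for e' j
    using ps(3) that by (fastforce split: if_splits)
  moreover have "\<forall>(e', j)\<in>set ((e, k e) # ps). e' \<in> E \<and> k e' \<le> j \<and> t < ring_time c e' j
      \<and> ring_time c e' j \<le> T \<and> P (ring_time c e' j)"
  proof safe
    fix e' j assume "(e', j) \<in> set ((e, k e) # ps)"
    then consider "e' = e" "j = k e" | "(e', j) \<in> set ps" by auto
    then have "e' \<in> E \<and> k e' \<le> j \<and> t < ring_time c e' j \<and> ring_time c e' j \<le> T \<and> P (ring_time c e' j)"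
    proof cases
      case 1
      then show ?thesis using e f(1,2) ps(5) by (simp add: t'_def)
    next
      case 2
      then show ?thesis using bspec[OF ps(3) 2] f(1) calculation(2)[OF 2] by auto
    qed
    then show "e' \<in> E" "k e' \<le> j" "t < ring_time c e' j" "ring_time c e' j \<le> T" "P (ring_time c e' j)"
      by auto
  qed
  moreover have "sorted_wrt (\<lambda>(e, j) (e', j'). ring_time c e j < ring_time c e' j') ((e, k e) # ps)"
    using ps(2,3) by (auto simp: t'_def)
  moreover have "map fst ((e, k e) # ps) = e # w" "t \<le> T" using ps(1,5) f(1) by auto
  ultimately show ?case
    by (intro exI[of _ "(e, k e) # ps"] exI[of _ T] conjI) blast+
qed

text \<open>Counting predecessors identifies a ring: before the entry with index \<open>i\<close>
  come exactly the \<open>i\<close> earlier entries, whereas a ring outside \<open>ps\<close> has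
  all of \<open>ps\<close> before it.\<close>

lemma event_edge_eq:
  assumes ps: "sorted_wrt (\<lambda>(e, j) (e', j'). ring_time c e j < ring_time c e' j') ps" "fst ` set ps \<subseteq> E"
    and later: "\<And>e j e' j'. (e, j) \<in> set ps \<Longrightarrow> e' \<in> E \<Longrightarrow> (e', j') \<notin> set ps \<Longrightarrow> ring_time c e j < ring_time c e' j'"
    and i: "i < length ps"
  shows "event_edge E c i = fst (ps ! i)"
proof -
  define before where "before q = {(e', k'). e' \<in> E \<and> ring_time c e' k' < ring_time c (fst q) (snd q)}" for q
  have sorted: "ring_time c (fst (ps ! a)) (snd (ps ! a)) < ring_time c (fst (ps ! b)) (snd (ps ! b))"
    if "a < b" "b < length ps" for a b
    using sorted_wrt_nth_less[OF ps(1) that] by (simp add: case_prod_beta)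
  have dist: "distinct ps" unfolding distinct_conv_nth
    by (metis sorted nat_neq_iff less_irrefl)
  have before: "before (ps ! a) = set (take a ps)" if a: "a < length ps" for a
  proof (intro set_eqI iffI)
    fix q assume q: "q \<in> before (ps ! a)"
    have "ps ! a \<in> set ps" using a by simp
    have "q \<in> set ps"
    proof (rule ccontr)
      assume "q \<notin> set ps"
      then show False
        using q later[of "fst (ps ! a)" "snd (ps ! a)" "fst q" "snd q"] \<open>ps ! a \<in> set ps\<close>
        by (auto simp: before_def)
    qed
    then obtain b where b: "b < length ps" "q = ps ! b" by (auto simp: in_set_conv_nth)
    moreover have "ring_time c (fst q) (snd q) < ring_time c (fst (ps ! a)) (snd (ps ! a))"
      using q by (auto simp: before_def)
    ultimately have "b < a" by (metis sorted less_asym less_irrefl linorder_neqE_nat)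
    then show "q \<in> set (take a ps)" using b a by (auto simp: in_set_conv_nth intro!: exI[of _ b])
  next
    fix q assume "q \<in> set (take a ps)"
    then obtain b where b: "b < a" "q = ps ! b" by (auto simp: in_set_conv_nth)
    moreover have "fst (ps ! b) \<in> E" using b a ps(2) by (auto simp: image_subset_iff)
    ultimately show "q \<in> before (ps ! a)" using sorted[of b a] a by (auto simp: before_def)
  qed
  have card: "finite (before (ps ! a))" "card (before (ps ! a)) = a" if "a < length ps" for a
    using that dist by (auto simp: before distinct_card)
  show ?thesis unfolding event_edge_def
  proof (rule the_equality)
    have "fst (ps ! i) \<in> E" using i ps(2) by (auto simp: image_subset_iff)
    then show "fst (ps ! i) \<in> E \<and> (\<exists>k. finite {(e', k'). e' \<in> E \<and> ring_time c e' k' < ring_time c (fst (ps ! i)) k}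
        \<and> card {(e', k'). e' \<in> E \<and> ring_time c e' k' < ring_time c (fst (ps ! i)) k} = i)"
      using card[OF i] by (auto simp: before_def intro!: exI[of _ "snd (ps ! i)"])
  next
    fix e
    assume "e \<in> E \<and> (\<exists>k. finite {(e', k'). e' \<in> E \<and> ring_time c e' k' < ring_time c e k}
        \<and> card {(e', k'). e' \<in> E \<and> ring_time c e' k' < ring_time c e k} = i)"
    then obtain k where k: "e \<in> E" "finite (before (e, k))" "card (before (e, k)) = i"
      by (auto simp: before_def)
    have "(e, k) \<in> set ps"
    proof (rule ccontr)
      assume "(e, k) \<notin> set ps"
      then have "set ps \<subseteq> before (e, k)" using later k(1) ps(2) by (auto simp: before_def)
      then have "card (set ps) \<le> i" using k(2,3) card_mono by metis
      then show False using i dist by (simp add: distinct_card)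
    qed
    then obtain a where "a < length ps" "(e, k) = ps ! a" by (auto simp: in_set_conv_nth)
    then show "e = fst (ps ! i)" using card(2)[of a] k(3) by (metis fst_conv)
  qed
qed

lemma event_edge_prefix:
  assumes "follows E (\<lambda>_. True) (\<lambda>r. r) w (\<lambda>_. 0) (\<lambda>_. 0) 0 c" "set w \<subseteq> E"
    and "\<forall>e\<in>E. \<forall>j. 0 < c e j" "i < length w"
  shows "event_edge E c i = w ! i"
proof -
  have init: "0 = (\<Sum>i<0. c e i)" for e by simp
  obtain ps T where ps: "map fst ps = w" "sorted_wrt (\<lambda>(e, j) (e', j'). ring_time c e j < ring_time c e' j') ps"
    "\<forall>(e, j)\<in>set ps. e \<in> E \<and> 0 \<le> j \<and> 0 < ring_time c e j \<and> ring_time c e j \<le> T \<and> True"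
    "\<forall>e\<in>E. \<forall>j\<ge>0. (e, j) \<notin> set ps \<longrightarrow> T < ring_time c e j"
    using follows_events[OF assms(1-3) init] by (elim exE conjE) (rule that; assumption)
  have "event_edge E c i = fst (ps ! i)"
  proof (rule event_edge_eq[OF ps(2)])
    fix e j e' j' assume "(e, j) \<in> set ps" "e' \<in> E" "(e', j') \<notin> set ps"
    then have "ring_time c e j \<le> T" "T < ring_time c e' j'" using ps(3,4) by auto
    then show "ring_time c e j < ring_time c e' j'" by simp
  next
    show "fst ` set ps \<subseteq> E" using ps(3) by auto
    show "i < length ps" using assms(4) unfolding ps(1)[symmetric] by simp
  qed
  then show ?thesis using assms(4) unfolding ps(1)[symmetric] by simp
qed

lemma event_edge_until:
  assumes "follows E (\<lambda>r. r \<le> s) (\<lambda>_. s) w (\<lambda>_. 0) (\<lambda>_. 0) 0 c" "set w \<subseteq> E"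
    and "\<forall>e\<in>E. \<forall>j. 0 < c e j"
  shows "num_events E c s = length w" and "i < length w \<Longrightarrow> event_edge E c i = w ! i"
proof -
  have init: "0 = (\<Sum>i<0. c e i)" for e by simp
  obtain ps T where ps: "map fst ps = w" "sorted_wrt (\<lambda>(e, j) (e', j'). ring_time c e j < ring_time c e' j') ps"
    "\<forall>(e, j)\<in>set ps. e \<in> E \<and> 0 \<le> j \<and> 0 < ring_time c e j \<and> ring_time c e j \<le> T \<and> ring_time c e j \<le> s"
    "\<forall>e\<in>E. \<forall>j\<ge>0. (e, j) \<notin> set ps \<longrightarrow> s < ring_time c e j"
    using follows_events[OF assms(1-3) init] by (elim exE conjE) (rule that; assumption)
  have "distinct ps"
    using ps(2) by (induction ps) auto
  moreover have "{(e, k). e \<in> E \<and> ring_time c e k \<le> s} = set ps"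
  proof safe
    fix e k assume "e \<in> E" "ring_time c e k \<le> s"
    then show "(e, k) \<in> set ps" using ps(4) by (meson not_less zero_le)
  qed (use ps(3) in auto)
  ultimately show "num_events E c s = length w"
    using ps(1) by (auto simp: num_events_def distinct_card)
  assume i: "i < length w"
  have "event_edge E c i = fst (ps ! i)"
  proof (rule event_edge_eq[OF ps(2)])
    fix e j e' j' assume "(e, j) \<in> set ps" "e' \<in> E" "(e', j') \<notin> set ps"
    then have "ring_time c e j \<le> s" "s < ring_time c e' j'" using ps(3,4) by auto
    then show "ring_time c e j < ring_time c e' j'" by simp
  next
    show "fst ` set ps \<subseteq> E" using ps(3) by auto
    show "i < length ps" using i unfolding ps(1)[symmetric] by simp
  qed
  then show "event_edge E c i = w ! i" using i unfolding ps(1)[symmetric] by simp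
qed

section \<open>Measurability of the tag\<close>

text \<open>A countable set has only countably many finite subsets, so the event is a countable
  union over the possible values of \<open>B x\<close>.\<close>

lemma pred_finite_card:
  assumes "countable S" and B: "\<And>x. B x \<subseteq> S" and s: "\<And>s. s \<in> S \<Longrightarrow> Measurable.pred M (\<lambda>x. s \<in> B x)"
  shows "Measurable.pred M (\<lambda>x. finite (B x) \<and> card (B x) = h)"
proof -
  have "(finite (B x) \<and> card (B x) = h) \<longleftrightarrow>
      (\<exists>F\<in>{F \<in> {F. F \<subseteq> S \<and> finite F}. card F = h}. \<forall>s\<in>S. s \<in> B x \<longleftrightarrow> s \<in> F)" for x
  proof -
    have "(\<forall>s\<in>S. s \<in> B x \<longleftrightarrow> s \<in> F) \<longleftrightarrow> B x = F" if "F \<subseteq> S" for F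
      using that B[of x] by blast
    then show ?thesis using B[of x] by auto
  qed
  moreover have "countable {F \<in> {F. F \<subseteq> S \<and> finite F}. card F = h}"
    using countable_Collect_finite_subset[OF assms(1)] by (rule countable_subset[rotated]) auto
  moreover have "Measurable.pred M (\<lambda>x. \<forall>s\<in>S. s \<in> B x \<longleftrightarrow> s \<in> F)" for F
    unfolding pred_def
    by (rule sets.sets_Collect_countable_All'[OF _ assms(1)])
       (use s in \<open>simp add: pred_def[symmetric] pred_intros_logic\<close>)
  ultimately show ?thesis
    unfolding pred_def by (simp only:) (rule sets.sets_Collect_countable_Ex')
qed

lemma measurable_ring_time:
  assumes "\<And>k. (\<lambda>\<omega>. c \<omega> e k) \<in> borel_measurable M"
  shows "(\<lambda>\<omega>. ring_time (c \<omega>) e k) \<in> borel_measurable M"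
  unfolding ring_time_def using assms by (intro borel_measurable_sum) auto

text \<open>The edge is a fixed function of the random set \<open>A\<close> of candidates, which has
  finitely many values. This covers the sample points where the description is not unique.\<close>

lemma measurable_event_edge:
  assumes "finite E" and c: "\<And>e k. e \<in> E \<Longrightarrow> (\<lambda>\<omega>. c \<omega> e k) \<in> borel_measurable M"
  shows "(\<lambda>\<omega>. event_edge E (c \<omega>) h) \<in> measurable M (count_space ((\<lambda>A. THE e. e \<in> A) ` Pow E))"
proof -
  define before where "before \<omega> e k = {(e', k'). e' \<in> E \<and> ring_time (c \<omega>) e' k' < ring_time (c \<omega>) e k}" for \<omega> e k
  define A where "A \<omega> = {e \<in> E. \<exists>k. finite (before \<omega> e k) \<and> card (before \<omega> e k) = h}" for \<omega>
  have A: "Measurable.pred M (\<lambda>\<omega>. e \<in> A \<omega>)" if e: "e \<in> E" for e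
  proof -
    define Q where "Q k \<omega> \<longleftrightarrow> finite (before \<omega> e k) \<and> card (before \<omega> e k) = h" for k \<omega>
    have "Measurable.pred M (\<lambda>\<omega>. finite (before \<omega> e k) \<and> card (before \<omega> e k) = h)" for k
    proof (rule pred_finite_card[of "E \<times> UNIV"])
      show "countable (E \<times> (UNIV :: nat set))" using assms(1) by (auto intro: countable_finite)
      show "Measurable.pred M (\<lambda>\<omega>. s \<in> before \<omega> e k)" if sE: "s \<in> E \<times> UNIV" for s
      proof -
        obtain e' k' where s: "s = (e', k')" "e' \<in> E" using sE by (cases s) auto
        have "Measurable.pred M (\<lambda>\<omega>. ring_time (c \<omega>) e' k' < ring_time (c \<omega>) e k)"
          by (intro borel_measurable_pred_less measurable_ring_time c s(2) e)
        then show ?thesis using s by (simp add: before_def)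
      qed
    qed (auto simp: before_def)
    then have "Measurable.pred M (Q k)" for k by (simp add: Q_def[abs_def])
    then have "Measurable.pred M (\<lambda>\<omega>. \<exists>k. Q k \<omega>)" by (rule pred_intros_countable)
    then show ?thesis using e by (simp add: A_def Q_def)
  qed
  have sub: "A \<omega> \<subseteq> E" for \<omega>
    unfolding A_def by blast
  have "A \<in> measurable M (count_space (Pow E))"
    unfolding measurable_count_space_eq2[OF finite_Pow_iff[THEN iffD2, OF assms(1)]]
  proof (intro conjI ballI)
    fix B assume "B \<in> Pow E"
    then have "A \<omega> = B \<longleftrightarrow> (\<forall>e\<in>E. e \<in> A \<omega> \<longleftrightarrow> e \<in> B)" for \<omega>
      using sub[of \<omega>] by blast
    then have "A -` {B} \<inter> space M = {\<omega> \<in> space M. \<forall>e\<in>E. e \<in> A \<omega> \<longleftrightarrow> e \<in> B}"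
      by (simp add: vimage_def Int_def conj_commute)
    also have "\<dots> \<in> sets M"
    proof (rule sets.sets_Collect_finite_All[OF _ assms(1)])
      fix e assume "e \<in> E"
      then have "{\<omega> \<in> space M. e \<in> A \<omega>} \<in> sets M" using A by (simp only: pred_def)
      then show "{\<omega> \<in> space M. e \<in> A \<omega> \<longleftrightarrow> e \<in> B} \<in> sets M"
        by (cases "e \<in> B") (auto intro: sets.sets_Collect_neg)
    qed
    finally show "A -` {B} \<inter> space M \<in> sets M" .
  qed (use sub in auto)
  then have *: "(\<lambda>\<omega>. THE e. e \<in> A \<omega>) \<in> measurable M (count_space ((\<lambda>A. THE e. e \<in> A) ` Pow E))"
    by (rule measurable_compose[where g = "\<lambda>A. THE e. e \<in> A"]) simp
  have "event_edge E (c \<omega>) h = (THE e. e \<in> A \<omega>)" for \<omega>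
    by (simp only: event_edge_def A_def before_def mem_Collect_eq)
  then show ?thesis using * by (simp only:)
qed

lemma measurable_num_events:
  assumes "finite E" and c: "\<And>e k. e \<in> E \<Longrightarrow> (\<lambda>\<omega>. c \<omega> e k) \<in> borel_measurable M"
  shows "(\<lambda>\<omega>. num_events E (c \<omega>) s) \<in> measurable M (count_space UNIV)"
proof -
  define B where "B \<omega> = {(e, k). e \<in> E \<and> ring_time (c \<omega>) e k \<le> s}" for \<omega>
  have *: "Measurable.pred M (\<lambda>\<omega>. finite (B \<omega>) \<and> card (B \<omega>) = h)" for h
  proof (rule pred_finite_card[of "E \<times> UNIV"])
    show "countable (E \<times> (UNIV :: nat set))" using assms(1) by (auto intro: countable_finite)
    show "Measurable.pred M (\<lambda>\<omega>. q \<in> B \<omega>)" if qE: "q \<in> E \<times> UNIV" for q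
    proof -
      obtain e k where q: "q = (e, k)" "e \<in> E" using qE by (cases q) auto
      have "{\<omega> \<in> space M. ring_time (c \<omega>) e k \<le> s} \<in> sets M"
        by (intro borel_measurable_le measurable_ring_time c q(2)) simp
      then show ?thesis using q by (simp add: B_def pred_def)
    qed
  qed (auto simp: B_def)
  define Q where "Q h \<omega> \<longleftrightarrow> finite (B \<omega>) \<and> card (B \<omega>) = h" for h \<omega>
  have Q: "Measurable.pred M (Q h)" for h
    using * by (simp add: Q_def[abs_def])
  have "Measurable.pred M (\<lambda>\<omega>. card (B \<omega>) = h)" for h
  proof -
    \<comment> \<open>Since \<open>card\<close> of an infinite set is 0, the value 0 also collects
      the infinite case.\<close>
    have eq: "(\<lambda>\<omega>. card (B \<omega>) = h) = (\<lambda>\<omega>. Q h \<omega> \<or> (h = 0 \<and> \<not> (\<exists>h'. Q h' \<omega>)))"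
      by (auto simp: Q_def intro: card_ge_0_finite)
    show ?thesis
      unfolding eq by (intro pred_intros_logic pred_intros_countable Q) simp
  qed
  then have "{\<omega> \<in> space M. num_events E (c \<omega>) s = h} \<in> sets M" for h
    by (simp add: num_events_def B_def pred_def)
  then show ?thesis
    by (simp add: measurable_count_space_eq2_countable vimage_def Int_def conj_commute)
qed

text \<open>A countable set that contains all possible values of the profile, although the type of
  profiles is uncountable. All of \<open>UNIV\<close> is allowed as receiver because an unspecified
  \<open>event_edge\<close> may have any endpoints.\<close>

primrec reachable :: "nat profile \<Rightarrow> nat \<Rightarrow> nat profile set" where
  "reachable x 0 = {x}"
| "reachable x (Suc h) = (\<lambda>(y, u). bump y u) ` (reachable x h \<times> UNIV)"

lemma countable_reachable: "countable (reachable x h)"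
  by (induction h) auto

context
  fixes M :: "'w measure" and E :: "nat set set" and c :: "'w \<Rightarrow> nat set \<Rightarrow> nat \<Rightarrow> real"
    and m :: "'w \<Rightarrow> nat \<Rightarrow> real" and orient :: "nat set \<Rightarrow> nat \<times> nat" and p :: "nat set \<Rightarrow> int \<Rightarrow> real"
  assumes E: "finite E" and c: "\<And>e k. e \<in> E \<Longrightarrow> (\<lambda>\<omega>. c \<omega> e k) \<in> borel_measurable M"
    and m: "\<And>k. (\<lambda>\<omega>. m \<omega> k) \<in> borel_measurable M"
begin

lemma measurable_profile_after:
  "(\<lambda>\<omega>. profile_after E orient p (c \<omega>) (m \<omega>) x h) \<in> measurable M (count_space (reachable x h))"
proof (induction h)
  case (Suc h)
  have "(\<lambda>\<omega>. bump y (receiver orient p e (m \<omega> h) y)) \<in> measurable M (count_space (reachable x (Suc h)))"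
    if y: "y \<in> reachable x h" for y e
  proof -
    have [measurable]: "(\<lambda>\<omega>. m \<omega> h) \<in> borel_measurable M" by (rule m)
    have [simp]: "bump y u \<in> reachable x (Suc h)" for u using y by force
    have "(\<lambda>\<omega>. bump y (receiver orient p e (m \<omega> h) y))
       = (\<lambda>\<omega>. if m \<omega> h \<le> p e (y (fst (orient e)) - y (snd (orient e))) then bump y (fst (orient e)) else bump y (snd (orient e)))"
      by (auto simp: receiver_eq)
    also have "\<dots> \<in> measurable M (count_space (reachable x (Suc h)))"
      by (intro measurable_If) (auto simp del: reachable.simps)
    finally show ?thesis .
  qed
  then have "(\<lambda>\<omega>. bump y (receiver orient p (event_edge E (c \<omega>) h) (m \<omega> h) y)) \<in> measurable M (count_space (reachable x (Suc h)))"
    if y: "y \<in> reachable x h" for y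
    by (rule measurable_compose_countable'[OF _ measurable_event_edge[OF E c]])
       (use y E in \<open>auto intro: countable_finite\<close>)
  from measurable_compose_countable'[OF this Suc countable_reachable]
  show ?case by (simp add: Let_def bump_def del: reachable.simps)
qed simp

lemma measurable_tag_after:
  "(\<lambda>\<omega>. tag_after E orient p (c \<omega>) (m \<omega>) x v h) \<in> measurable M (count_space UNIV)"
proof -
  have "(\<lambda>\<omega>. THE j. y = add_profile (profile_after E orient p (c \<omega>) (m \<omega>) x h) (unit_profile j)) \<in> measurable M (count_space UNIV)" for y
    by (rule measurable_compose_countable'[OF _ measurable_profile_after countable_reachable]) simp
  then show ?thesis unfolding tag_after_def
    by (rule measurable_compose_countable'[OF _ measurable_profile_after countable_reachable])
qed

lemma measurable_tag_at:
  "(\<lambda>\<omega>. tag_at E orient p (c \<omega>) (m \<omega>) x v s) \<in> measurable M (count_space UNIV)"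
  unfolding tag_at_def
  by (rule measurable_compose_countable'[OF measurable_tag_after measurable_num_events[OF E c]]) auto

end

section \<open>Decomposition according to the sequence of ringing edges\<close>

lemma follows_unique:
  assumes "\<forall>e\<in>E. \<forall>j. 0 < c e j" "set w \<subseteq> E" "set w' \<subseteq> E"
  shows "length w = length w' \<Longrightarrow> follows E (\<lambda>_. True) (\<lambda>r. r) w (\<lambda>_. 0) (\<lambda>_. 0) 0 c \<Longrightarrow>
      follows E (\<lambda>_. True) (\<lambda>r. r) w' (\<lambda>_. 0) (\<lambda>_. 0) 0 c \<Longrightarrow> w = w'"
    and "follows E (\<lambda>r. r \<le> s) (\<lambda>_. s) w (\<lambda>_. 0) (\<lambda>_. 0) 0 c \<Longrightarrow>
      follows E (\<lambda>r. r \<le> s) (\<lambda>_. s) w' (\<lambda>_. 0) (\<lambda>_. 0) 0 c \<Longrightarrow> w = w'"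
proof -
  assume l: "length w = length w'"
    and f: "follows E (\<lambda>_. True) (\<lambda>r. r) w (\<lambda>_. 0) (\<lambda>_. 0) 0 c" "follows E (\<lambda>_. True) (\<lambda>r. r) w' (\<lambda>_. 0) (\<lambda>_. 0) 0 c"
  show "w = w'"
    by (rule nth_equalityI[OF l])
       (simp add: event_edge_prefix[OF f(1) assms(2,1), symmetric] event_edge_prefix[OF f(2) assms(3,1)] l)
next
  assume f: "follows E (\<lambda>r. r \<le> s) (\<lambda>_. s) w (\<lambda>_. 0) (\<lambda>_. 0) 0 c" "follows E (\<lambda>r. r \<le> s) (\<lambda>_. s) w' (\<lambda>_. 0) (\<lambda>_. 0) 0 c"
  have l: "length w = length w'"
    using event_edge_until(1)[OF f(1) assms(2,1)] event_edge_until(1)[OF f(2) assms(3,1)] by simp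
  show "w = w'"
    by (rule nth_equalityI[OF l])
       (simp add: event_edge_until(2)[OF f(1) assms(2,1), symmetric] event_edge_until(2)[OF f(2) assms(3,1)] l)
qed

text \<open>Writes a quantity that depends on the random word as a series over all words, which can
  then be integrated term by term.\<close>

lemma suminf_words_unique:
  fixes F :: "'e list \<Rightarrow> ennreal"
  assumes "finite E" "set w0 \<subseteq> E" "Q w0" "\<And>w. set w \<subseteq> E \<Longrightarrow> Q w \<Longrightarrow> w = w0"
  shows "(\<Sum>h. \<Sum>w | set w \<subseteq> E \<and> length w = h. of_bool (Q w) * F w) = F w0"
proof -
  have "(\<Sum>w | set w \<subseteq> E \<and> length w = h. of_bool (Q w) * F w) = (if h = length w0 then F w0 else 0)" for h
  proof -
    have fin: "finite {w. set w \<subseteq> E \<and> length w = h}" using assms(1) by (rule finite_lists_length_eq)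
    have "(\<Sum>w | set w \<subseteq> E \<and> length w = h. of_bool (Q w) * F w)
        = (\<Sum>w | set w \<subseteq> E \<and> length w = h. if w = w0 then F w0 else 0)"
    proof (rule sum.cong)
      fix w assume "w \<in> {w. set w \<subseteq> E \<and> length w = h}"
      then have "Q w \<longleftrightarrow> w = w0" using assms(3,4) by blast
      then show "of_bool (Q w) * F w = (if w = w0 then F w0 else 0)" by simp
    qed simp
    then show ?thesis using fin assms(2) by simp
  qed
  then show ?thesis
    by (simp only: sums_unique[OF sums_single[of "length w0" "\<lambda>_. F w0"], symmetric])
qed

lemma suminf_words_none:
  assumes "\<And>w. set w \<subseteq> E \<Longrightarrow> \<not> Q w"
  shows "(\<Sum>h. \<Sum>w | set w \<subseteq> E \<and> length w = h. of_bool (Q w) * F w) = (0 :: ennreal)"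
proof -
  have "(\<Sum>w | set w \<subseteq> E \<and> length w = h. of_bool (Q w) * F w) = (0 :: ennreal)" for h
    by (rule sum.neutral) (use assms in auto)
  then show ?thesis by simp
qed

context driving_law
begin

section \<open>Almost sure existence of the followed word\<close>

lemma AE_waits_pos: "AE X in law. \<forall>e\<in>E. \<forall>j. 0 < waits X e j"
proof -
  have "AE X in law. 0 < waits X e j" if e: "e \<in> E" for e j
  proof -
    have [measurable]: "(\<lambda>X. waits X e j) \<in> borel_measurable law"
      unfolding waits_def by (rule coord_measurable) (use e in simp)
    have "(\<integral>\<^sup>+X. indicator {X \<in> space law. 0 < waits X e j} X \<partial>law)
        = (\<integral>\<^sup>+X. of_bool (\<forall>e'\<in>{e}. 0 < waits X e' j) \<partial>law)"
      by (rule nn_integral_cong) (simp split: split_indicator)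
    also have "\<dots> = ennreal (exp (- (\<Sum>e'\<in>{e}. 0)))"
      by (rule prob_all_waits_greater[where k = "\<lambda>_. j" and a = "\<lambda>_. 0"]) (use e in simp_all)
    also have "\<dots> = 1" by simp
    also have "(\<integral>\<^sup>+X. indicator {X \<in> space law. 0 < waits X e j} X \<partial>law) = emeasure law {X \<in> space law. 0 < waits X e j}" by (rule nn_integral_indicator) measurable
    finally have "prob {X \<in> space law. 0 < waits X e j} = 1"
      by (simp add: emeasure_eq_measure)
    then show ?thesis by (subst (asm) prob_Collect_eq_1) auto
  qed
  then show ?thesis
    by (simp add: AE_ball_countable countable_finite finite_E AE_all_countable)
qed

abbreviation initially_follows :: "(real \<Rightarrow> bool) \<Rightarrow> (real \<Rightarrow> real) \<Rightarrow> 'e list \<Rightarrow> ('e source \<Rightarrow> real) \<Rightarrow> bool" where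
  "initially_follows P b w X \<equiv> follows E P b w (\<lambda>_. 0) (\<lambda>_. 0) 0 (waits X)"

text \<open>For different words the events are disjoint up to a null set, and their probabilities
  add up to 1. The set \<open>L\<close> holds the admissible lengths: a single one for a fixed
  number of events, all of them for a fixed time.\<close>

lemma AE_follows:
  assumes m: "Measurable.pred borel P" "b \<in> borel_measurable borel"
    and \<kappa>: "\<And>w. set w \<subseteq> E \<Longrightarrow> length w \<in> L \<Longrightarrow> follows_prob P b w (\<lambda>_. 0) (\<lambda>_. 0) 0 = \<kappa> (length w)"
    and total: "(\<Sum>h. of_bool (h \<in> L) * (of_nat (card E ^ h) * \<kappa> h)) = 1"
    and unique: "\<And>X w w'. \<forall>e\<in>E. \<forall>j. 0 < waits X e j \<Longrightarrow> set w \<subseteq> E \<Longrightarrow> set w' \<subseteq> E \<Longrightarrow>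
      length w \<in> L \<Longrightarrow> length w' \<in> L \<Longrightarrow> initially_follows P b w X \<Longrightarrow> initially_follows P b w' X \<Longrightarrow> w = w'"
  shows "AE X in law. \<exists>w. set w \<subseteq> E \<and> length w \<in> L \<and> initially_follows P b w X"
proof -
  define Q where "Q w X \<longleftrightarrow> length w \<in> L \<and> initially_follows P b w X" for w X
  have Q [measurable]: "Measurable.pred law (Q w)" if "set w \<subseteq> E" for w
    using measurable_follows[OF that m] by (simp add: Q_def[abs_def])
  define Z where "Z = {X \<in> space law. \<exists>w\<in>{w. set w \<subseteq> E}. Q w X}"
  have "countable {w. set w \<subseteq> E}"
    using countable_lists[OF countable_finite[OF finite_E]] by (simp add: lists_eq_set)
  then have Z: "Z \<in> sets law"
    unfolding Z_def by (intro sets.sets_Collect_countable_Ex') (use Q in \<open>auto simp: pred_def\<close>)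
  have "1 = (\<Sum>h. of_bool (h \<in> L) * (of_nat (card E ^ h) * \<kappa> h))" using total by simp
  also have "\<dots> = (\<Sum>h. \<Sum>w | set w \<subseteq> E \<and> length w = h. \<integral>\<^sup>+X. of_bool (Q w X) * 1 \<partial>law)"
  proof (rule suminf_cong)
    fix h
    have "(\<integral>\<^sup>+X. of_bool (Q w X) * 1 \<partial>law) = of_bool (h \<in> L) * \<kappa> h" if "set w \<subseteq> E" "length w = h" for w
      using \<kappa>[of w] that by (auto simp: Q_def follows_prob_def)
    then show "of_bool (h \<in> L) * (of_nat (card E ^ h) * \<kappa> h)
        = (\<Sum>w | set w \<subseteq> E \<and> length w = h. \<integral>\<^sup>+X. of_bool (Q w X) * 1 \<partial>law)"
      using card_lists_length_eq[OF finite_E, of h] by (auto simp: mult_ac)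
  qed
  also have "\<dots> = (\<Sum>h. \<integral>\<^sup>+X. (\<Sum>w | set w \<subseteq> E \<and> length w = h. of_bool (Q w X) * 1) \<partial>law)"
    by (intro suminf_cong nn_integral_sum[symmetric] borel_measurable_times_ennreal borel_measurable_of_bool Q) auto
  also have "\<dots> = (\<integral>\<^sup>+X. (\<Sum>h. \<Sum>w | set w \<subseteq> E \<and> length w = h. of_bool (Q w X) * 1) \<partial>law)"
    by (intro nn_integral_suminf[symmetric] borel_measurable_sum borel_measurable_times_ennreal borel_measurable_of_bool Q) auto
  also have "\<dots> \<le> (\<integral>\<^sup>+X. indicator Z X \<partial>law)"
  proof (rule nn_integral_mono_AE)
    show "AE X in law. (\<Sum>h. \<Sum>w | set w \<subseteq> E \<and> length w = h. of_bool (Q w X) * 1) \<le> (indicator Z X :: ennreal)"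
      using AE_waits_pos AE_space
    proof eventually_elim
      case (elim X)
      show ?case
      proof (cases "\<exists>w. set w \<subseteq> E \<and> Q w X")
        case True
        then obtain w where w: "set w \<subseteq> E" "Q w X" by blast
        have "w' = w" if "set w' \<subseteq> E" "Q w' X" for w'
          using w that unfolding Q_def by (intro unique[OF elim(1)]) simp_all
        then have "(\<Sum>h. \<Sum>w | set w \<subseteq> E \<and> length w = h. of_bool (Q w X) * 1) = (1 :: ennreal)"
          by (rule suminf_words_unique[where Q = "\<lambda>w. Q w X" and F = "\<lambda>_. 1", OF finite_E w])
        moreover have "X \<in> Z" using w elim(2) by (auto simp: Z_def)
        ultimately show ?thesis by simp
      next
        case False
        then show ?thesis using suminf_words_none[of E "\<lambda>w. Q w X" "\<lambda>_. 1"] by simp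
      qed
    qed
  qed
  also have "\<dots> = emeasure law Z" using Z by simp
  finally have "1 \<le> prob Z" by (simp add: emeasure_eq_measure)
  then have "prob Z = 1" using prob_le_1[of Z] by (intro antisym)
  then have "AE X in law. X \<in> Z" using Z by (simp add: AE_in_set_eq_1)
  then show ?thesis by eventually_elim (auto simp: Z_def Q_def)
qed

end

locale cycle_driving = cycle_process n orient p + driving_law "cycle_edges n" S
  for n :: nat and orient p and S :: "real measure" +
  fixes x :: "nat profile"
  assumes initial_law: "v < n \<Longrightarrow> emeasure S {real v} = ennreal (load_rate x v / n)"
begin

section \<open>Expected displacement as a series over words\<close>

lemma step_pow_nonneg:
  fixes g :: "nat \<Rightarrow> real"
  assumes "\<And>w. 0 \<le> g w" "v < n"
  shows "0 \<le> (step ^^ h) (\<lambda>_. g) y v"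
  using assms(2) by (induction h arbitrary: y v) (auto intro!: step_nonneg simp: assms(1))

text \<open>All words of length \<open>h\<close> have the same probability
  \<open>\<kappa> h\<close>, so by \<open>sum_mark_avg\<close> the sum over them is
  \<open>\<kappa> h * n ^ h\<close> times the iterate of \<open>step\<close>.\<close>

lemma nn_integral_displacement:
  assumes m: "Measurable.pred borel P" "b \<in> borel_measurable borel"
    and \<kappa>: "\<And>w. set w \<subseteq> cycle_edges n \<Longrightarrow> length w \<in> L \<Longrightarrow>
      follows_prob P b w (\<lambda>_. 0) (\<lambda>_. 0) 0 = ennreal (\<kappa> (length w))" "\<And>h. 0 \<le> \<kappa> h"
  shows "(\<integral>\<^sup>+X. (\<Sum>h. \<Sum>w | set w \<subseteq> cycle_edges n \<and> length w = h.
       of_bool (length w \<in> L \<and> initially_follows P b w X) *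
       (\<Sum>v<n. of_bool (X Start = real v) * ennreal (displacement v (tag_run orient p w (marks X) 0 x v)))) \<partial>law)
    = (\<Sum>h. of_bool (h \<in> L) * ennreal (\<kappa> h * n ^ h *
       ((\<Sum>v<n. load_rate x v * (step ^^ h) (\<lambda>_. displacement v) x v) / n)))"
proof -
  define T where "T w v X = of_bool (X Start = real v) * of_bool (initially_follows P b w X)
       * ennreal (displacement v (tag_run orient p w (marks X) 0 x v))" for w v and X :: "nat set source \<Rightarrow> real"
  have mT: "T w v \<in> borel_measurable law" if "set w \<subseteq> cycle_edges n" for w v
  proof -
    have [measurable]: "Measurable.pred law (initially_follows P b w)"
      by (rule measurable_follows[OF that m])
    have [measurable]: "(\<lambda>X. ennreal (displacement v (tag_run orient p w (marks X) 0 x v))) \<in> borel_measurable law"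
      by (rule measurable_tag_run) (simp add: marks_def coord_measurable)
    show ?thesis unfolding T_def[abs_def] by measurable
  qed
  have fin: "finite {w. set w \<subseteq> cycle_edges n \<and> length w = h}" for h by (rule finite_words)
  have "(\<integral>\<^sup>+X. (\<Sum>h. \<Sum>w | set w \<subseteq> cycle_edges n \<and> length w = h.
       of_bool (length w \<in> L \<and> initially_follows P b w X) *
       (\<Sum>v<n. of_bool (X Start = real v) * ennreal (displacement v (tag_run orient p w (marks X) 0 x v)))) \<partial>law)
    = (\<integral>\<^sup>+X. (\<Sum>h. of_bool (h \<in> L) * (\<Sum>w | set w \<subseteq> cycle_edges n \<and> length w = h. \<Sum>v<n. T w v X)) \<partial>law)"
  proof (intro nn_integral_cong suminf_cong)
    fix X h
    show "(\<Sum>w | set w \<subseteq> cycle_edges n \<and> length w = h.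
       of_bool (length w \<in> L \<and> initially_follows P b w X) *
       (\<Sum>v<n. of_bool (X Start = real v) * ennreal (displacement v (tag_run orient p w (marks X) 0 x v))))
      = of_bool (h \<in> L) * (\<Sum>w | set w \<subseteq> cycle_edges n \<and> length w = h. \<Sum>v<n. T w v X)"
      unfolding sum_distrib_left T_def by (intro sum.cong) (auto simp: mult_ac)
  qed
  also have "\<dots> = (\<Sum>h. of_bool (h \<in> L) * (\<Sum>w | set w \<subseteq> cycle_edges n \<and> length w = h. \<Sum>v<n. \<integral>\<^sup>+X. T w v X \<partial>law))"
  proof -
    have ms: "(\<lambda>X. \<Sum>v<n. T w v X) \<in> borel_measurable law" if "set w \<subseteq> cycle_edges n" for w
      by (intro borel_measurable_sum mT that)
    have mw: "(\<lambda>X. \<Sum>w | set w \<subseteq> cycle_edges n \<and> length w = h. \<Sum>v<n. T w v X) \<in> borel_measurable law" for h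
      by (intro borel_measurable_sum mT) simp
    have "(\<integral>\<^sup>+X. (\<Sum>w | set w \<subseteq> cycle_edges n \<and> length w = h. \<Sum>v<n. T w v X) \<partial>law)
       = (\<Sum>w | set w \<subseteq> cycle_edges n \<and> length w = h. \<Sum>v<n. \<integral>\<^sup>+X. T w v X \<partial>law)" for h
    proof -
      have "(\<integral>\<^sup>+X. (\<Sum>w | set w \<subseteq> cycle_edges n \<and> length w = h. \<Sum>v<n. T w v X) \<partial>law)
         = (\<Sum>w | set w \<subseteq> cycle_edges n \<and> length w = h. \<integral>\<^sup>+X. (\<Sum>v<n. T w v X) \<partial>law)"
        by (rule nn_integral_sum) (simp add: ms)
      also have "\<dots> = (\<Sum>w | set w \<subseteq> cycle_edges n \<and> length w = h. \<Sum>v<n. \<integral>\<^sup>+X. T w v X \<partial>law)"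
        by (intro sum.cong refl nn_integral_sum mT) simp
      finally show ?thesis .
    qed
    then show ?thesis
      by (subst nn_integral_suminf) (simp_all add: mw nn_integral_cmult borel_measurable_times_ennreal)
  qed
  also have "\<dots> = (\<Sum>h. of_bool (h \<in> L) * ennreal (\<kappa> h * n ^ h *
       ((\<Sum>v<n. load_rate x v * (step ^^ h) (\<lambda>_. displacement v) x v) / n)))"
  proof (rule suminf_cong)
    fix h
    define W where "W = {w. set w \<subseteq> cycle_edges n \<and> length w = h}"
    show "of_bool (h \<in> L) * (\<Sum>w | set w \<subseteq> cycle_edges n \<and> length w = h. \<Sum>v<n. \<integral>\<^sup>+X. T w v X \<partial>law)
      = of_bool (h \<in> L) * ennreal (\<kappa> h * n ^ h *
       ((\<Sum>v<n. load_rate x v * (step ^^ h) (\<lambda>_. displacement v) x v) / n))"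
    proof (cases "h \<in> L")
      case True
      have triple: "ennreal r * ennreal s * ennreal t = ennreal (r * s * t)" if "0 \<le> r" "0 \<le> s" for r s t
        using that by (simp add: ennreal_mult')
      have "(\<integral>\<^sup>+X. T w v X \<partial>law) = ennreal (load_rate x v / n) * ennreal (\<kappa> h)
          * mark_avg orient p (\<lambda>u. ennreal (displacement v u)) w x v" if "w \<in> W" "v < n" for w v
        unfolding T_def
        using nn_integral_Start_follows_tag_run[OF _ m, where w = w and g = "\<lambda>u. ennreal (displacement v u)"
            and orient = orient and p = p and x = x and s = "real v" and v = v and l = 0 and w' = w] that True \<kappa>(1)[of w]
        by (simp add: initial_law W_def)
      then have "(\<Sum>w\<in>W. \<Sum>v<n. \<integral>\<^sup>+X. T w v X \<partial>law)
        = (\<Sum>w\<in>W. \<Sum>v<n. ennreal (load_rate x v / n) * ennreal (\<kappa> h) * mark_avg orient p (\<lambda>u. ennreal (displacement v u)) w x v)"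
        by (intro sum.cong) auto
      also have "\<dots> = (\<Sum>v<n. ennreal (load_rate x v / n) * ennreal (\<kappa> h) * (\<Sum>w\<in>W. mark_avg orient p (\<lambda>u. ennreal (displacement v u)) w x v))"
        by (subst sum.swap) (simp add: sum_distrib_left)
      also have "\<dots> = (\<Sum>v<n. ennreal (load_rate x v / n * \<kappa> h * (n ^ h * (step ^^ h) (\<lambda>_. displacement v) x v)))"
      proof (rule sum.cong)
        fix v assume "v \<in> {..<n}"
        then have v: "v < n" by simp
        have "(\<Sum>w\<in>W. mark_avg orient p (\<lambda>u. ennreal (displacement v u)) w x v)
            = ennreal (n ^ h * (step ^^ h) (\<lambda>_. displacement v) x v)"
          unfolding W_def by (rule sum_mark_avg) (simp_all add: v displacement_def)
        then show "ennreal (load_rate x v / n) * ennreal (\<kappa> h) * (\<Sum>w\<in>W. mark_avg orient p (\<lambda>u. ennreal (displacement v u)) w x v)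
          = ennreal (load_rate x v / n * \<kappa> h * (n ^ h * (step ^^ h) (\<lambda>_. displacement v) x v))"
          using triple[of "load_rate x v / n" "\<kappa> h"] \<kappa>(2) load_rate_nonneg[OF v] by simp
      qed simp
      also have "\<dots> = ennreal (\<Sum>v<n. load_rate x v / n * \<kappa> h * (n ^ h * (step ^^ h) (\<lambda>_. displacement v) x v))"
        by (rule sum_ennreal)
           (intro mult_nonneg_nonneg divide_nonneg_nonneg step_pow_nonneg \<kappa>(2),
             simp_all add: load_rate_nonneg displacement_def)
      also have "(\<Sum>v<n. load_rate x v / n * \<kappa> h * (n ^ h * (step ^^ h) (\<lambda>_. displacement v) x v))
          = \<kappa> h * n ^ h * ((\<Sum>v<n. load_rate x v * (step ^^ h) (\<lambda>_. displacement v) x v) / n)"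
        by (simp add: sum_distrib_left sum_divide_distrib mult_ac)
      finally show ?thesis by (simp add: W_def)
    qed simp
  qed
  finally show ?thesis .
qed

end

context cycle_process
begin

lemma tag_run_less: "set w \<subseteq> cycle_edges n \<Longrightarrow> v < n \<Longrightarrow> tag_run orient p w m l x v < n"
  by (induction w arbitrary: l x v) (auto simp: moved_tag_less)

text \<open>Common core of both bounds: \<open>D\<close> stands for the tag after a fixed number of
  events or at a fixed time, and \<open>P\<close>, \<open>b\<close>, \<open>L\<close>, \<kappa> say
  which words occur and how likely each of them is.\<close>

lemma nn_integral_tag_distance_le:
  fixes M :: "'w measure" and D :: "'w \<Rightarrow> nat"
  assumes driving: "driving_randomness M (cycle_edges n) J0 C U"
    and J0: "J0 \<in> measurable M (count_space {..<n})"
    and J0_law: "\<And>v. v < n \<Longrightarrow> measure M {\<omega> \<in> space M. J0 \<omega> = v} = load_rate x v / n"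
    and m: "Measurable.pred borel P" "b \<in> borel_measurable borel"
    and \<kappa>: "\<And>S w. driving_law (cycle_edges n) S \<Longrightarrow> set w \<subseteq> cycle_edges n \<Longrightarrow> length w \<in> L \<Longrightarrow>
      driving_law.follows_prob (cycle_edges n) S P b w (\<lambda>_. 0) (\<lambda>_. 0) 0 = ennreal (\<kappa> (length w))"
      "\<And>h. 0 \<le> \<kappa> h"
    and total: "(\<Sum>h. of_bool (h \<in> L) * (of_nat (n ^ h) * ennreal (\<kappa> h))) = 1"
    and unique: "\<And>c w w'. \<forall>e\<in>cycle_edges n. \<forall>j. 0 < c e j \<Longrightarrow> set w \<subseteq> cycle_edges n \<Longrightarrow>
      set w' \<subseteq> cycle_edges n \<Longrightarrow> length w \<in> L \<Longrightarrow> length w' \<in> L \<Longrightarrow>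
      follows (cycle_edges n) P b w (\<lambda>_. 0) (\<lambda>_. 0) 0 c \<Longrightarrow> follows (cycle_edges n) P b w' (\<lambda>_. 0) (\<lambda>_. 0) 0 c \<Longrightarrow> w = w'"
    and D: "\<And>\<omega> w. \<forall>e\<in>cycle_edges n. \<forall>j. 0 < C e j \<omega> \<Longrightarrow> set w \<subseteq> cycle_edges n \<Longrightarrow> length w \<in> L \<Longrightarrow>
      follows (cycle_edges n) P b w (\<lambda>_. 0) (\<lambda>_. 0) 0 (\<lambda>e k. C e k \<omega>) \<Longrightarrow>
      D \<omega> = tag_run orient p w (\<lambda>k. U k \<omega>) 0 x (J0 \<omega>)"
  shows "(\<integral>\<^sup>+\<omega>. ennreal ((real (graph_dist (cycle_edges n) (D \<omega>) (J0 \<omega>)))\<^sup>2) \<partial>M)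
    \<le> (\<Sum>h. of_bool (h \<in> L) * ennreal (\<kappa> h * n ^ h * (2 * pi\<^sup>2 * h / n + 2)))"
proof -
  define E where "E = cycle_edges n"
  define S where "S = distr M borel (\<lambda>\<omega>. real (J0 \<omega>))"
  define Y where "Y \<omega> = (\<lambda>i\<in>sources E. source_var J0 C U i \<omega>)" for \<omega>
  have PS: "prob_space M"
    and wait: "\<And>e k. e \<in> E \<Longrightarrow> distributed M lborel (C e k) (exponential_density 1)"
    and mark: "\<And>k. distr M borel (U k) = uniform_measure lborel {0<..<1}"
    and ind: "prob_space.indep_vars M (\<lambda>_. borel) (source_var J0 C U) (sources E)"
    using driving by (auto simp: driving_randomness_def E_def sources_def)
  interpret M: prob_space M by (rule PS)
  have rv: "source_var J0 C U i \<in> borel_measurable M" if "i \<in> sources E" for i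
    using ind that by (auto simp: M.indep_vars_def)
  have J0_rv: "(\<lambda>\<omega>. real (J0 \<omega>)) \<in> borel_measurable M" using rv[of Start] by simp
  interpret DL: driving_law E S
    by (rule driving_law.intro) (simp_all add: E_def finite_cycle_edges S_def M.prob_space_distr J0_rv)
  \<comment> \<open>Mutual independence means that the joint law of all sources is the product
    measure, so the computation can be carried out there.\<close>
  have law_eq: "distr M (PiM (sources E) (\<lambda>_. borel)) Y = DL.law"
  proof -
    have "distr M (PiM (sources E) (\<lambda>_. borel)) Y = (\<Pi>\<^sub>M i\<in>sources E. distr M borel (source_var J0 C U i))"
    proof -
      have "M.indep_vars (\<lambda>_. borel) (source_var J0 C U) (sources E) \<longleftrightarrow>
          distr M (PiM (sources E) (\<lambda>_. borel)) (\<lambda>\<omega>. \<lambda>i\<in>sources E. source_var J0 C U i \<omega>)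
            = (\<Pi>\<^sub>M i\<in>sources E. distr M borel (source_var J0 C U i))"
      proof (rule M.indep_vars_iff_distr_eq_PiM')
        show "sources E \<noteq> {}" unfolding sources_def by blast
      qed (rule rv)
      with ind show ?thesis unfolding Y_def by (rule iffD1[rotated])
    qed
    also have "\<dots> = DL.law"
    proof (rule PiM_cong)
      fix i assume i: "i \<in> sources E"
      show "distr M borel (source_var J0 C U i) = source_law S i"
      proof (cases i)
        case (Wait e k)
        then have "e \<in> E" using i by simp
        have "distr M borel (C e k) = distr M lborel (C e k)" by (rule distr_cong) auto
        also have "\<dots> = density lborel (exponential_density 1)"
          by (rule distributed_distr_eq_density[OF wait[OF \<open>e \<in> E\<close>]])
        finally show ?thesis using Wait by simp
      next
        case Start
        then show ?thesis by (simp add: S_def)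
      next
        case (Mark k)
        then show ?thesis by (simp add: mark)
      qed
    qed (rule refl)
    finally show ?thesis .
  qed
  have Y: "Y \<in> measurable M (PiM (sources E) (\<lambda>_. borel))"
    unfolding Y_def[abs_def] by (rule measurable_restrict) (rule rv)
  have sets_law: "sets DL.law = sets (PiM (sources E) (\<lambda>_. borel))"
    by (rule sets_PiM_cong) (auto simp: DL.sets_source_law)
  interpret CD: cycle_driving n orient p S x
  proof (rule cycle_driving.intro[OF cycle_process_axioms DL.driving_law_axioms[unfolded E_def] cycle_driving_axioms.intro])
    fix v assume v: "v < n"
    have "emeasure S {real v} = emeasure M ((\<lambda>\<omega>. real (J0 \<omega>)) -` {real v} \<inter> space M)"
      unfolding S_def by (rule emeasure_distr) (use J0_rv in auto)
    also have "(\<lambda>\<omega>. real (J0 \<omega>)) -` {real v} \<inter> space M = {\<omega> \<in> space M. J0 \<omega> = v}" by auto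
    finally show "emeasure S {real v} = ennreal (load_rate x v / n)"
      using J0_law[OF v] by (simp add: M.emeasure_eq_measure)
  qed
  have \<kappa>': "DL.follows_prob P b w (\<lambda>_. 0) (\<lambda>_. 0) 0 = ennreal (\<kappa> (length w))" if "set w \<subseteq> E" "length w \<in> L" for w
    unfolding E_def
    by (rule \<kappa>(1)[OF DL.driving_law_axioms[unfolded E_def]]) (use that in \<open>simp_all add: E_def\<close>)
  \<comment> \<open>Almost surely only one word and one starting vertex contribute, and then the
    value is the displacement of the tag.\<close>
  define F where "F X = (\<Sum>h. \<Sum>w | set w \<subseteq> E \<and> length w = h.
       of_bool (length w \<in> L \<and> DL.initially_follows P b w X) *
       (\<Sum>v<n. of_bool (X Start = real v) * ennreal (displacement v (tag_run orient p w (marks X) 0 x v))))"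
    for X :: "nat set source \<Rightarrow> real"
  have mF: "F \<in> borel_measurable DL.law"
  proof -
    have [measurable]: "Measurable.pred DL.law (DL.initially_follows P b w)" if "set w \<subseteq> E" for w
      by (rule DL.measurable_follows[OF that m])
    have [measurable]: "(\<lambda>X. ennreal (displacement v (tag_run orient p w (marks X) 0 x v))) \<in> borel_measurable DL.law" for w v
      by (rule measurable_tag_run) (simp add: marks_def DL.coord_measurable)
    have [measurable]: "(\<lambda>X. X Start) \<in> borel_measurable DL.law" by (rule DL.coord_measurable) simp
    have "(\<lambda>X. of_bool (length w \<in> L \<and> DL.initially_follows P b w X) *
       (\<Sum>v<n. of_bool (X Start = real v) * ennreal (displacement v (tag_run orient p w (marks X) 0 x v))))
       \<in> borel_measurable DL.law" if [simp]: "set w \<subseteq> E" for w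
      by measurable
    then show ?thesis unfolding F_def[abs_def]
      by (intro borel_measurable_suminf_order borel_measurable_sum) simp
  qed
  have "AE X in DL.law. (\<forall>e\<in>E. \<forall>j. 0 < waits X e j) \<and>
      (\<exists>w. set w \<subseteq> E \<and> length w \<in> L \<and> DL.initially_follows P b w X)"
  proof -
    have "AE X in DL.law. \<exists>w. set w \<subseteq> E \<and> length w \<in> L \<and> DL.initially_follows P b w X"
    proof (rule DL.AE_follows[where \<kappa> = "\<lambda>h. ennreal (\<kappa> h)", OF m])
      show "DL.follows_prob P b w (\<lambda>_. 0) (\<lambda>_. 0) 0 = ennreal (\<kappa> (length w))" if "set w \<subseteq> E" "length w \<in> L" for w
        by (rule \<kappa>') (fact that)+
      show "(\<Sum>h. of_bool (h \<in> L) * (of_nat (card E ^ h) * ennreal (\<kappa> h))) = 1"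
        using total by (simp only: E_def card_cycle_edges)
      show "w = w'" if "\<forall>e\<in>E. \<forall>j. 0 < waits X e j" "set w \<subseteq> E" "set w' \<subseteq> E" "length w \<in> L" "length w' \<in> L"
        "DL.initially_follows P b w X" "DL.initially_follows P b w' X" for X w w'
        using that unfolding E_def by (rule unique)
    qed
    with DL.AE_waits_pos show ?thesis by eventually_elim simp
  qed
  then have "AE \<omega> in M. (\<forall>e\<in>E. \<forall>j. 0 < waits (Y \<omega>) e j) \<and>
      (\<exists>w. set w \<subseteq> E \<and> length w \<in> L \<and> DL.initially_follows P b w (Y \<omega>))"
    unfolding law_eq[symmetric] by (rule AE_distrD[OF Y])
  then have "AE \<omega> in M. ennreal ((real (graph_dist (cycle_edges n) (D \<omega>) (J0 \<omega>)))\<^sup>2) \<le> ennreal (n\<^sup>2 / 16) * F (Y \<omega>)"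
    using AE_space
  proof eventually_elim
    case (elim \<omega>)
    then obtain w where w: "set w \<subseteq> E" "length w \<in> L" "DL.initially_follows P b w (Y \<omega>)" by blast
    have pos: "\<forall>e\<in>E. \<forall>j. 0 < waits (Y \<omega>) e j" using elim by blast
    have wY: "waits (Y \<omega>) e k = C e k \<omega>" if "e \<in> E" for e k
      using that by (simp add: waits_def Y_def)
    have mY: "marks (Y \<omega>) = (\<lambda>k. U k \<omega>)" by (simp add: marks_def Y_def fun_eq_iff)
    have J: "J0 \<omega> < n" using measurable_space[OF J0] elim by auto
    have "follows E P b w (\<lambda>_. 0) (\<lambda>_. 0) 0 (waits (Y \<omega>)) = follows E P b w (\<lambda>_. 0) (\<lambda>_. 0) 0 (\<lambda>e k. C e k \<omega>)"
      by (rule follows_cong[OF w(1)]) (simp add: wY)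
    then have f: "follows E P b w (\<lambda>_. 0) (\<lambda>_. 0) 0 (\<lambda>e k. C e k \<omega>)" using w(3) by blast
    have "\<forall>e\<in>E. \<forall>j. 0 < C e j \<omega>" using pos by (simp add: wY)
    then have D: "D \<omega> = tag_run orient p w (\<lambda>k. U k \<omega>) 0 x (J0 \<omega>)"
      by (intro D) (use w f in \<open>simp_all add: E_def\<close>)
    have "F (Y \<omega>) = (\<Sum>v<n. of_bool (Y \<omega> Start = real v) * ennreal (displacement v (tag_run orient p w (marks (Y \<omega>)) 0 x v)))"
      unfolding F_def
    proof (rule suminf_words_unique[where Q = "\<lambda>w. length w \<in> L \<and> DL.initially_follows P b w (Y \<omega>)"])
      fix w' assume "set w' \<subseteq> E" "length w' \<in> L \<and> DL.initially_follows P b w' (Y \<omega>)"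
      then show "w' = w"
        by (intro unique[OF pos[unfolded E_def]]) (use w in \<open>simp_all add: E_def\<close>)
    qed (use w DL.finite_E in auto)
    also have "\<dots> = (\<Sum>v<n. if v = J0 \<omega> then ennreal (displacement (J0 \<omega>) (D \<omega>)) else 0)"
      by (intro sum.cong) (auto simp: Y_def mY[unfolded Y_def] D)
    also have "\<dots> = ennreal (displacement (J0 \<omega>) (D \<omega>))" using J by simp
    finally have F: "F (Y \<omega>) = ennreal (displacement (J0 \<omega>) (D \<omega>))" .
    have "D \<omega> < n" unfolding D using w(1) J by (intro tag_run_less) (simp_all add: E_def)
    from graph_dist_le_displacement[OF this J]
    have "ennreal ((real (graph_dist (cycle_edges n) (D \<omega>) (J0 \<omega>)))\<^sup>2) \<le> ennreal (n\<^sup>2 / 16 * displacement (J0 \<omega>) (D \<omega>))"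
      by (intro ennreal_leI) (simp add: displacement_commute)
    then show ?case unfolding F by (subst ennreal_mult'[symmetric]) simp_all
  qed
  then have "(\<integral>\<^sup>+\<omega>. ennreal ((real (graph_dist (cycle_edges n) (D \<omega>) (J0 \<omega>)))\<^sup>2) \<partial>M)
      \<le> (\<integral>\<^sup>+\<omega>. ennreal (n\<^sup>2 / 16) * F (Y \<omega>) \<partial>M)"
    by (rule nn_integral_mono_AE)
  also have "\<dots> = (\<integral>\<^sup>+X. ennreal (n\<^sup>2 / 16) * F X \<partial>DL.law)"
    unfolding law_eq[symmetric]
    by (rule nn_integral_distr[symmetric, OF Y])
       (use mF in \<open>simp add: measurable_cong_sets[OF sets_law refl]\<close>)
  also have "\<dots> = ennreal (n\<^sup>2 / 16) * (\<integral>\<^sup>+X. F X \<partial>DL.law)"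
    by (rule nn_integral_cmult[OF mF])
  also have "(\<integral>\<^sup>+X. F X \<partial>DL.law) = (\<Sum>h. of_bool (h \<in> L) * ennreal (\<kappa> h * n ^ h *
       ((\<Sum>v<n. load_rate x v * (step ^^ h) (\<lambda>_. displacement v) x v) / n)))"
    unfolding F_def E_def
    by (rule CD.nn_integral_displacement[OF m]) (rule \<kappa>'[unfolded E_def], assumption+, rule \<kappa>(2))
  also have "ennreal (n\<^sup>2 / 16) * \<dots> = (\<Sum>h. ennreal (n\<^sup>2 / 16) * (of_bool (h \<in> L) * ennreal (\<kappa> h * n ^ h *
       ((\<Sum>v<n. load_rate x v * (step ^^ h) (\<lambda>_. displacement v) x v) / n))))"
    by (rule ennreal_suminf_cmult[symmetric])
  also have "\<dots> \<le> (\<Sum>h. of_bool (h \<in> L) * ennreal (\<kappa> h * n ^ h * (2 * pi\<^sup>2 * h / n + 2)))"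
  proof (rule suminf_le)
    fix h
    have "ennreal (n\<^sup>2 / 16) * ennreal (\<kappa> h * n ^ h * ((\<Sum>v<n. load_rate x v * (step ^^ h) (\<lambda>_. displacement v) x v) / n))
       = ennreal (\<kappa> h * n ^ h * (n\<^sup>2 / 16 * ((\<Sum>v<n. load_rate x v * (step ^^ h) (\<lambda>_. displacement v) x v) / n)))"
      by (subst ennreal_mult'[symmetric]) (simp_all add: mult_ac)
    also have "\<dots> \<le> ennreal (\<kappa> h * n ^ h * (2 * pi\<^sup>2 * h / n + 2))"
      by (intro ennreal_leI mult_left_mono sum_displacement_le) (simp add: \<kappa>(2))
    finally show "ennreal (n\<^sup>2 / 16) * (of_bool (h \<in> L) * ennreal (\<kappa> h * n ^ h *
       ((\<Sum>v<n. load_rate x v * (step ^^ h) (\<lambda>_. displacement v) x v) / n)))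
      \<le> of_bool (h \<in> L) * ennreal (\<kappa> h * n ^ h * (2 * pi\<^sup>2 * h / n + 2))"
      by (cases "h \<in> L") simp_all
  qed auto
  finally show ?thesis .
qed

end

lemma suminf_of_bool_single: "(\<Sum>k. of_bool (k \<in> {h}) * f k) = (f h :: ennreal)"
proof -
  have "(\<lambda>k. of_bool (k \<in> {h}) * f k) = (\<lambda>k. if k = h then f k else 0)" by auto
  then show ?thesis by (simp only: sums_unique[OF sums_single, symmetric])
qed

lemma poisson_sums:
  fixes t :: real
  shows "(\<lambda>k. exp (- t) * t ^ k / fact k) sums 1"
    and "(\<lambda>k. exp (- t) * t ^ k / fact k * k) sums t"
proof -
  have e: "(\<lambda>k. t ^ k / fact k) sums exp t"
    using exp_converges[of t] by (simp add: divide_inverse mult.commute)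
  from sums_mult[OF this, of "exp (- t)"] show "(\<lambda>k. exp (- t) * t ^ k / fact k) sums 1"
    by (simp add: exp_minus)
  have "(\<lambda>k. t ^ Suc k / fact (Suc k) * real (Suc k)) = (\<lambda>k. t * (t ^ k / fact k))"
    by (simp add: fun_eq_iff del: of_nat_Suc)
  with sums_mult[OF e, of t] have "(\<lambda>k. t ^ Suc k / fact (Suc k) * real (Suc k)) sums (t * exp t)" by (simp only:)
  then have "(\<lambda>k. t ^ k / fact k * real k) sums (t * exp t)"
    by (subst (asm) sums_Suc_iff) simp
  from sums_mult[OF this, of "exp (- t)"]
  have "(\<lambda>k. exp (- t) * t ^ k / fact k * k) sums (exp (- t) * (t * exp t))" by (simp add: mult.assoc)
  also have "exp (- t) * (t * exp t) = t" by (simp add: exp_minus)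
  finally show "(\<lambda>k. exp (- t) * t ^ k / fact k * k) sums t" .
qed

lemma integral_le_of_nn_integral_le:
  fixes f :: "'a \<Rightarrow> real"
  assumes "f \<in> borel_measurable M" "\<And>x. 0 \<le> f x" "0 \<le> B" "(\<integral>\<^sup>+x. ennreal (f x) \<partial>M) \<le> ennreal B"
  shows "integrable M f \<and> (\<integral>x. f x \<partial>M) \<le> B"
proof -
  have i: "integrable M f"
    by (rule integrableI_nonneg[OF assms(1)])
       (simp add: assms(2), rule le_less_trans[OF assms(4)], simp)
  then have "ennreal (\<integral>x. f x \<partial>M) \<le> ennreal B"
    using nn_integral_eq_integral[OF i] assms(2,4) by simp
  then show ?thesis using i assms(3) by simp
qed

context cycle_process
begin

lemma measure_receiver:
  assumes "v < n"
  shows "measure lborel {r \<in> {0<..<1}. receiver orient p (edge v) r x = w}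
    = (if v = w then give_right x v else 0) + (if nxt v = w then 1 - give_right x v else 0)"
proof -
  define A where "A = {r \<in> {0<..<1}. receiver orient p (edge v) r x = w}"
  have "Measurable.pred borel (\<lambda>r. receiver orient p (edge v) r x = w)"
    by (rule measurable_threshold[where \<rho> = "\<lambda>r. r" and F = "\<lambda>a b r. a = w"]) auto
  then have A: "A \<in> sets lborel"
    unfolding A_def by (simp add: pred_def Collect_conj_eq)
  have m: "(\<lambda>r. ennreal (of_bool (receiver orient p (edge v) r x = w))) \<in> borel_measurable lborel"
    by (rule measurable_threshold[where \<rho> = "\<lambda>r. r" and F = "\<lambda>a b r. ennreal (of_bool (a = w))"]) auto
  have "emeasure lborel A = (\<integral>\<^sup>+r. indicator A r \<partial>lborel)" using A by simp
  also have "\<dots> = (\<integral>\<^sup>+r. ennreal (of_bool (receiver orient p (edge v) r x = w)) * indicator {0<..<1} r \<partial>lborel)"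
    by (rule nn_integral_cong) (simp add: A_def split: split_indicator)
  also have "\<dots> = (\<integral>\<^sup>+r. ennreal (of_bool (receiver orient p (edge v) r x = w)) \<partial>uniform01)"
    by (subst nn_integral_uniform_measure) (use m in \<open>simp_all add: divide_ennreal_def\<close>)
  also have "\<dots> = ennreal ((if v = w then give_right x v else 0) + (if nxt v = w then 1 - give_right x v else 0))"
    using edge_pair_average[OF assms, of "\<lambda>a b. of_bool (a = w)" x x] by (simp add: Let_def)
  finally have "measure lborel A = enn2real (ennreal ((if v = w then give_right x v else 0) + (if nxt v = w then 1 - give_right x v else 0)))"
    unfolding measure_def by (rule arg_cong)
  then show ?thesis unfolding A_def
    using give_right_nonneg[OF assms] give_right_le_1[OF assms, of x] by (subst (asm) enn2real_ennreal) auto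
qed

text \<open>Identifies the rate in the prescribed law of the initial tag with
  \<open>load_rate\<close>. A vertex receives balls from its own edge and from that of
  \<open>prv w\<close>.\<close>

lemma receive_rate_eq:
  assumes "w < n"
  shows "receive_rate (cycle_edges n) orient p x w = load_rate x w"
proof -
  have "receive_rate (cycle_edges n) orient p x w
    = (\<Sum>v<n. (if v = w then give_right x v else 0) + (if nxt v = w then 1 - give_right x v else 0))"
    unfolding receive_rate_def sum_cycle_edges by (intro sum.cong refl measure_receiver) simp
  also have "\<dots> = (\<Sum>v<n. if v = w then give_right x v else 0) + (\<Sum>v<n. if v = prv w then 1 - give_right x v else 0)"
    unfolding sum.distrib using assms by (intro arg_cong2[of _ _ _ _ "(+)"] sum.cong) auto
  also have "\<dots> = load_rate x w"
    using assms by (simp add: load_rate_def give_left_def)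
  finally show ?thesis .
qed

context
  fixes M :: "'w measure" and J0 :: "'w \<Rightarrow> nat" and C U x
  assumes driving: "driving_randomness M (cycle_edges n) J0 C U"
    and J0: "J0 \<in> measurable M (count_space {..<n})"
    and J0_law: "\<And>v. v < n \<Longrightarrow> measure M {\<omega> \<in> space M. J0 \<omega> = v} = load_rate x v / n"
begin

lemma nn_integral_tag_after_distance_le:
  "(\<integral>\<^sup>+\<omega>. ennreal ((real (graph_dist (cycle_edges n)
      (tag_after (cycle_edges n) orient p (\<lambda>e k. C e k \<omega>) (\<lambda>k. U k \<omega>) x (J0 \<omega>) h) (J0 \<omega>)))\<^sup>2) \<partial>M)
    \<le> ennreal (2 * pi\<^sup>2 * h / n + 2)"
proof -
  define \<kappa> where "\<kappa> k = 1 / real n ^ k" for k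
  have "(\<integral>\<^sup>+\<omega>. ennreal ((real (graph_dist (cycle_edges n)
      (tag_after (cycle_edges n) orient p (\<lambda>e k. C e k \<omega>) (\<lambda>k. U k \<omega>) x (J0 \<omega>) h) (J0 \<omega>)))\<^sup>2) \<partial>M)
    \<le> (\<Sum>k. of_bool (k \<in> {h}) * ennreal (\<kappa> k * n ^ k * (2 * pi\<^sup>2 * k / n + 2)))"
  proof (rule nn_integral_tag_distance_le[OF driving J0 J0_law, where P = "\<lambda>_. True" and b = "\<lambda>r. r"])
    fix S w
    assume S: "driving_law (cycle_edges n) S" and w: "set w \<subseteq> cycle_edges n"
    show "driving_law.follows_prob (cycle_edges n) S (\<lambda>_. True) (\<lambda>r. r) w (\<lambda>_. 0) (\<lambda>_. 0) 0 = ennreal (\<kappa> (length w))"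
      by (subst driving_law.follows_prob_prefix[OF S w]) (simp_all add: card_cycle_edges \<kappa>_def)
  next
    have "of_nat (n ^ h) * ennreal (\<kappa> h) = ennreal (real (n ^ h) * \<kappa> h)"
      by (simp add: ennreal_mult' ennreal_of_nat_eq_real_of_nat)
    then show "(\<Sum>k. of_bool (k \<in> {h}) * (of_nat (n ^ k) * ennreal (\<kappa> k))) = 1"
      unfolding suminf_of_bool_single using n_ge_3 by (simp add: \<kappa>_def)
  next
    fix c :: "nat set \<Rightarrow> nat \<Rightarrow> real" and w w'
    assume "\<forall>e\<in>cycle_edges n. \<forall>j. 0 < c e j" "set w \<subseteq> cycle_edges n" "set w' \<subseteq> cycle_edges n"
      "length w \<in> {h}" "length w' \<in> {h}"
      "follows (cycle_edges n) (\<lambda>_. True) (\<lambda>r. r) w (\<lambda>_. 0) (\<lambda>_. 0) 0 c"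
      "follows (cycle_edges n) (\<lambda>_. True) (\<lambda>r. r) w' (\<lambda>_. 0) (\<lambda>_. 0) 0 c"
    then show "w = w'" by (intro follows_unique(1)[of "cycle_edges n" c w w']) simp_all
  next
    fix \<omega> w
    assume *: "\<forall>e\<in>cycle_edges n. \<forall>j. 0 < C e j \<omega>" "set w \<subseteq> cycle_edges n" "length w \<in> {h}"
      "follows (cycle_edges n) (\<lambda>_. True) (\<lambda>r. r) w (\<lambda>_. 0) (\<lambda>_. 0) 0 (\<lambda>e k. C e k \<omega>)"
    then have h: "h = length w" by simp
    show "tag_after (cycle_edges n) orient p (\<lambda>e k. C e k \<omega>) (\<lambda>k. U k \<omega>) x (J0 \<omega>) h
        = tag_run orient p w (\<lambda>k. U k \<omega>) 0 x (J0 \<omega>)"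
      unfolding h
    proof (rule tag_after_eq_run)
      show "event_edge (cycle_edges n) (\<lambda>e k. C e k \<omega>) i = w ! i" if "i < length w" for i
        by (rule event_edge_prefix[OF *(4,2,1) that])
      show "antimono (p e)" if "e \<in> set w" for e
        by (rule antimono_p) (rule subsetD[OF *(2) that])
    qed
  qed (simp_all add: \<kappa>_def)
  also have "\<dots> = ennreal (2 * pi\<^sup>2 * h / n + 2)"
    unfolding suminf_of_bool_single using n_ge_3 by (simp add: \<kappa>_def)
  finally show ?thesis .
qed

lemma nn_integral_tag_at_distance_le:
  assumes s: "0 \<le> s"
  shows "(\<integral>\<^sup>+\<omega>. ennreal ((real (graph_dist (cycle_edges n)
      (tag_at (cycle_edges n) orient p (\<lambda>e k. C e k \<omega>) (\<lambda>k. U k \<omega>) x (J0 \<omega>) s) (J0 \<omega>)))\<^sup>2) \<partial>M)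
    \<le> ennreal (2 * pi\<^sup>2 * s + 2)"
proof -
  \<comment> \<open>The probability of a single word; together the \<open>n ^ k\<close> words of
    length \<open>k\<close> carry the Poisson weight with parameter \<open>n * s\<close>.\<close>
  define \<kappa> where "\<kappa> k = exp (- (n * s)) * s ^ k / fact k" for k
  have \<kappa>n: "\<kappa> k * n ^ k = exp (- (n * s)) * (n * s) ^ k / fact k" for k
    by (simp add: \<kappa>_def power_mult_distrib mult_ac)
  have \<kappa>0: "0 \<le> \<kappa> k" for k using s by (simp add: \<kappa>_def)
  have "(\<integral>\<^sup>+\<omega>. ennreal ((real (graph_dist (cycle_edges n)
      (tag_at (cycle_edges n) orient p (\<lambda>e k. C e k \<omega>) (\<lambda>k. U k \<omega>) x (J0 \<omega>) s) (J0 \<omega>)))\<^sup>2) \<partial>M)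
    \<le> (\<Sum>k. of_bool (k \<in> UNIV) * ennreal (\<kappa> k * n ^ k * (2 * pi\<^sup>2 * k / n + 2)))"
  proof (rule nn_integral_tag_distance_le[OF driving J0 J0_law, where P = "\<lambda>r. r \<le> s" and b = "\<lambda>_. s"])
    fix S w
    assume S: "driving_law (cycle_edges n) S" and w: "set w \<subseteq> cycle_edges n"
    show "driving_law.follows_prob (cycle_edges n) S (\<lambda>r. r \<le> s) (\<lambda>_. s) w (\<lambda>_. 0) (\<lambda>_. 0) 0 = ennreal (\<kappa> (length w))"
      by (subst driving_law.follows_prob_until[OF S w]) (simp_all add: card_cycle_edges \<kappa>_def s)
  next
    have "(\<Sum>k. ennreal (exp (- (n * s)) * (n * s) ^ k / fact k)) = ennreal 1"
      by (rule suminf_ennreal_eq[OF _ poisson_sums(1)]) (use s in simp)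
    then have poisson: "(\<Sum>k. ennreal (exp (- (n * s)) * (n * s) ^ k / fact k)) = 1" by simp
    have "of_nat (n ^ k) * ennreal (\<kappa> k) = ennreal (exp (- (n * s)) * (n * s) ^ k / fact k)" for k
      unfolding \<kappa>n[symmetric] using \<kappa>0 by (simp add: ennreal_mult' ennreal_of_nat_eq_real_of_nat mult.commute)
    then show "(\<Sum>k. of_bool (k \<in> UNIV) * (of_nat (n ^ k) * ennreal (\<kappa> k))) = 1"
      using poisson by (simp only: UNIV_I of_bool_eq mult_1)
  next
    fix c :: "nat set \<Rightarrow> nat \<Rightarrow> real" and w w'
    assume "\<forall>e\<in>cycle_edges n. \<forall>j. 0 < c e j" "set w \<subseteq> cycle_edges n" "set w' \<subseteq> cycle_edges n"
      "follows (cycle_edges n) (\<lambda>r. r \<le> s) (\<lambda>_. s) w (\<lambda>_. 0) (\<lambda>_. 0) 0 c"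
      "follows (cycle_edges n) (\<lambda>r. r \<le> s) (\<lambda>_. s) w' (\<lambda>_. 0) (\<lambda>_. 0) 0 c"
    then show "w = w'" by (rule follows_unique(2))
  next
    fix \<omega> w
    assume *: "\<forall>e\<in>cycle_edges n. \<forall>j. 0 < C e j \<omega>" "set w \<subseteq> cycle_edges n"
      "follows (cycle_edges n) (\<lambda>r. r \<le> s) (\<lambda>_. s) w (\<lambda>_. 0) (\<lambda>_. 0) 0 (\<lambda>e k. C e k \<omega>)"
    show "tag_at (cycle_edges n) orient p (\<lambda>e k. C e k \<omega>) (\<lambda>k. U k \<omega>) x (J0 \<omega>) s
        = tag_run orient p w (\<lambda>k. U k \<omega>) 0 x (J0 \<omega>)"
      unfolding tag_at_def event_edge_until(1)[OF *(3,2,1)]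
    proof (rule tag_after_eq_run)
      show "event_edge (cycle_edges n) (\<lambda>e k. C e k \<omega>) i = w ! i" if "i < length w" for i
        by (rule event_edge_until(2)[OF *(3,2,1) that])
      show "antimono (p e)" if "e \<in> set w" for e
        by (rule antimono_p) (rule subsetD[OF *(2) that])
    qed
  qed (simp_all add: \<kappa>0)
  also have "\<dots> = (\<Sum>k. ennreal (2 * pi\<^sup>2 / n * (exp (- (n * s)) * (n * s) ^ k / fact k * k)
      + 2 * (exp (- (n * s)) * (n * s) ^ k / fact k)))"
    unfolding \<kappa>n by (simp add: algebra_simps)
  \<comment> \<open>The Poisson mean \<open>n * s\<close> replaces the number of events, which
    cancels the division by \<open>n\<close>.\<close>
  also have "\<dots> = ennreal (2 * pi\<^sup>2 / n * (n * s) + 2 * 1)"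
    by (rule suminf_ennreal_eq)
       (use s in simp, intro sums_add sums_mult poisson_sums)
  also have "2 * pi\<^sup>2 / n * (n * s) + 2 * 1 = 2 * pi\<^sup>2 * s + 2" using n_ge_3 by simp
  finally show ?thesis .
qed

end

end

theorem proposition4p2:
  fixes n :: nat
    and orient :: "nat set \<Rightarrow> nat \<times> nat"
    and p :: "nat set \<Rightarrow> int \<Rightarrow> real"
    and x :: "nat profile"
    and M :: "'w measure"
    and J0 :: "'w \<Rightarrow> nat"
    and C :: "nat set \<Rightarrow> nat \<Rightarrow> 'w \<Rightarrow> real"
    and U :: "nat \<Rightarrow> 'w \<Rightarrow> real"
  assumes "n \<ge> 3"
    and "endpoint_local_monotone (cycle_edges n) orient p"
    and "driving_randomness M (cycle_edges n) J0 C U"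
    and "J0 \<in> measurable M (count_space {..<n})"
    and "\<And>w. w < n \<Longrightarrow>
           measure M {\<omega> \<in> space M. J0 \<omega> = w} = receive_rate (cycle_edges n) orient p x w / real n"
  defines "J \<equiv> \<lambda>h \<omega>. tag_after (cycle_edges n) orient p
                       (\<lambda>e k. C e k \<omega>) (\<lambda>k. U k \<omega>) x (J0 \<omega>) h"
    and "Jt \<equiv> \<lambda>s \<omega>. tag_at (cycle_edges n) orient p
                       (\<lambda>e k. C e k \<omega>) (\<lambda>k. U k \<omega>) x (J0 \<omega>) s"
  shows "(\<forall>h::nat.
            integrable M (\<lambda>\<omega>. (real (graph_dist (cycle_edges n) (J h \<omega>) (J0 \<omega>)))\<^sup>2) \<and>
            (\<integral>\<omega>. (real (graph_dist (cycle_edges n) (J h \<omega>) (J0 \<omega>)))\<^sup>2 \<partial>M)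
              \<le> 2 * pi\<^sup>2 * real h / real n + 2) \<and>
         (\<forall>s\<ge>0::real.
            integrable M (\<lambda>\<omega>. (real (graph_dist (cycle_edges n) (Jt s \<omega>) (J0 \<omega>)))\<^sup>2) \<and>
            (\<integral>\<omega>. (real (graph_dist (cycle_edges n) (Jt s \<omega>) (J0 \<omega>)))\<^sup>2 \<partial>M)
              \<le> 2 * pi\<^sup>2 * s + 2)"
proof -
  interpret cycle_process n orient p
    by (rule cycle_process.intro) fact+
  define E where "E = cycle_edges n"
  have J0_law: "measure M {\<omega> \<in> space M. J0 \<omega> = v} = load_rate x v / n" if "v < n" for v
    using assms(5)[OF that] by (simp add: receive_rate_eq[OF that])
  have C: "(\<lambda>\<omega>. C e k \<omega>) \<in> borel_measurable M" if "e \<in> E" for e k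
    using assms(3) that by (auto simp: driving_randomness_def E_def distributed_def)
  have U: "(\<lambda>\<omega>. U k \<omega>) \<in> borel_measurable M" for k
  proof -
    have M: "prob_space M"
      and ind: "prob_space.indep_vars M (\<lambda>_. borel) (source_var J0 C U) (sources E)"
      using assms(3) by (auto simp: driving_randomness_def E_def sources_def)
    have "\<forall>i\<in>sources E. source_var J0 C U i \<in> borel_measurable M"
      using ind unfolding prob_space.indep_vars_def[OF M] by (rule conjunct1)
    from bspec[OF this Mark_in_sources, of k] show ?thesis by simp
  qed
  note fin = finite_cycle_edges[folded E_def]
  \<comment> \<open>The bounds above are for nonnegative integrals; measurability turns them into
    integrability. The initial tag has finitely many values, so it can be fixed first.\<close>
  have meas_after: "(\<lambda>\<omega>. (real (graph_dist E (tag_after E orient p (\<lambda>e k. C e k \<omega>) (\<lambda>k. U k \<omega>) x (J0 \<omega>) h) (J0 \<omega>)))\<^sup>2)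
      \<in> borel_measurable M" for h
  proof (rule measurable_compose_countable'[OF _ assms(4)])
    show "(\<lambda>\<omega>. (real (graph_dist E (tag_after E orient p (\<lambda>e k. C e k \<omega>) (\<lambda>k. U k \<omega>) x v h) v))\<^sup>2)
      \<in> borel_measurable M" for v
      by (rule measurable_compose[OF measurable_tag_after[OF fin C U], where g = "\<lambda>u. (real (graph_dist E u v))\<^sup>2"])
         simp_all
  qed simp
  have meas_at: "(\<lambda>\<omega>. (real (graph_dist E (tag_at E orient p (\<lambda>e k. C e k \<omega>) (\<lambda>k. U k \<omega>) x (J0 \<omega>) s) (J0 \<omega>)))\<^sup>2)
      \<in> borel_measurable M" for s
  proof (rule measurable_compose_countable'[OF _ assms(4)])
    show "(\<lambda>\<omega>. (real (graph_dist E (tag_at E orient p (\<lambda>e k. C e k \<omega>) (\<lambda>k. U k \<omega>) x v s) v))\<^sup>2)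
      \<in> borel_measurable M" for v
      by (rule measurable_compose[OF measurable_tag_at[OF fin C U], where g = "\<lambda>u. (real (graph_dist E u v))\<^sup>2"])
         simp_all
  qed simp
  have "integrable M (\<lambda>\<omega>. (real (graph_dist (cycle_edges n) (J h \<omega>) (J0 \<omega>)))\<^sup>2) \<and>
      (\<integral>\<omega>. (real (graph_dist (cycle_edges n) (J h \<omega>) (J0 \<omega>)))\<^sup>2 \<partial>M) \<le> 2 * pi\<^sup>2 * real h / real n + 2" for h
    unfolding J_def E_def[symmetric]
  proof (rule integral_le_of_nn_integral_le)
    show "(\<lambda>\<omega>. (real (graph_dist E (tag_after E orient p (\<lambda>e k. C e k \<omega>) (\<lambda>k. U k \<omega>) x (J0 \<omega>) h) (J0 \<omega>)))\<^sup>2)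
        \<in> borel_measurable M"
      by (rule meas_after)
    show "(\<integral>\<^sup>+\<omega>. ennreal ((real (graph_dist E (tag_after E orient p (\<lambda>e k. C e k \<omega>) (\<lambda>k. U k \<omega>) x (J0 \<omega>) h) (J0 \<omega>)))\<^sup>2) \<partial>M)
        \<le> ennreal (2 * pi\<^sup>2 * real h / real n + 2)"
      unfolding E_def by (rule nn_integral_tag_after_distance_le[OF assms(3,4) J0_law])
  qed simp_all
  moreover have "integrable M (\<lambda>\<omega>. (real (graph_dist (cycle_edges n) (Jt s \<omega>) (J0 \<omega>)))\<^sup>2) \<and>
      (\<integral>\<omega>. (real (graph_dist (cycle_edges n) (Jt s \<omega>) (J0 \<omega>)))\<^sup>2 \<partial>M) \<le> 2 * pi\<^sup>2 * s + 2" if s: "0 \<le> s" for s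
    unfolding Jt_def E_def[symmetric]
  proof (rule integral_le_of_nn_integral_le)
    show "(\<lambda>\<omega>. (real (graph_dist E (tag_at E orient p (\<lambda>e k. C e k \<omega>) (\<lambda>k. U k \<omega>) x (J0 \<omega>) s) (J0 \<omega>)))\<^sup>2)
        \<in> borel_measurable M"
      by (rule meas_at)
    show "(\<integral>\<^sup>+\<omega>. ennreal ((real (graph_dist E (tag_at E orient p (\<lambda>e k. C e k \<omega>) (\<lambda>k. U k \<omega>) x (J0 \<omega>) s) (J0 \<omega>)))\<^sup>2) \<partial>M)
        \<le> ennreal (2 * pi\<^sup>2 * s + 2)"
      unfolding E_def by (rule nn_integral_tag_at_distance_le[OF assms(3,4) J0_law s])
  qed (use s in simp_all)
  ultimately show ?thesis by blast
qed

end
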